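(* Assume the setting below, including $h\le C_{\mathrm{res}}\kappa^{-1}$, and let $\beta\ge0$. Let $T\in\mathcal T_h$, $v_h\in V_h$, and let $\mathcal C_Tv_h\in W$ be the element corrector. Then there exists a constant $0<\theta_\beta<1$ such that for all $\ell\in\mathbb{N}$ $$|||\mathcal C_Tv_h|||_{\beta,\Omega\setminus\mathsf N^\ell(T)}\lesssim\theta_\beta^\ell\,|||v_h|||_{\beta,T},$$ where $\theta_\beta\le\big(1-\frac{1}{1+C(1+\kappa\beta h)}\big)^{1/12}<1$ for some generic constant $C>0$ independent of $\kappa$, $\beta$ and $h$.
   Context: Let $d\in\{2,3\}$, $\Omega\subset\mathbb{R}^d$ a bounded convex polytope; $L^2=L^2(\cdot;\mathbb{C})$, $H^1=H^1(\cdot;\mathbb{C})$ are real Hilbert spaces with $(v,w)_{L^2(G)}:=\mathrm{Re}\int_G v\overline{w}\,dx$. Let $\kappa>0$ and $\boldsymbol A\in L^\infty(\Omega,\mathbb{R}^d)$ with $\operatorname{div}\boldsymbol A=0$ in $\Omega$, $\boldsymbol A\cdot\mathbf n=0$ on $\partial\Omega$. $\mathcal T_h$ a shape-regular, conforming, quasi-uniform simplicial mesh with mesh size $h$; $V_h$ the complex-valued continuous piecewise affine functions; $\pi_h$ the $L^2$-projection onto $V_h$ with $\|v-\pi_hv\|_{L^2}\le C_{\pi_h}h\|\nabla v\|_{L^2}$; $W:=\{v\in H^1(\Omega):\pi_hv=0\}$. Resolution condition: $h\le C_{\mathrm{res}}\kappa^{-1}$ with $C_{\mathrm{res}}^{-2}\ge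 4C_{\pi_h}^2\|\boldsymbol A\|_{L^\infty}^2+2C_{\pi_h}^2$. For a subdomain $G\subset\overline\Omega$: $a_{\beta,G}(v,w):=(\tfrac{i}{\kappa}\nabla v+\boldsymbol A v,\tfrac{i}{\kappa}\nabla w+\boldsymbol A w)_{L^2(G)}+\beta(v,w)_{L^2(G)}$, $|||v|||_{\beta,G}:=\sqrt{a_{\beta,G}(v,v)}$, $a_\beta:=a_{\beta,\Omega}$. Patches: $\mathsf N(G):=\operatorname{int}\big(\bigcup\{T\in\mathcal T_h:T\cap\overline G\ne\emptyset\}\big)$, $\mathsf N^1(G):=\mathsf N(G)$, $\mathsf N^\ell(G):=\mathsf N(\mathsf N^{\ell-1}(G))$. The element corrector $\mathcal C_T:V_h\to W$ is defined by $a_\beta(\mathcal C_Tv_h,w)=a_{\beta,T}(v_h,w)$ for all $w\in W$. Notation $a\lesssim b$: $a\le Cb$ with $C$ independent of $\kappa,h,\beta$. *)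

theory Defs
  imports "HOL-Analysis.Analysis"
begin

definition pderiv_r :: "((real^'n) \<Rightarrow> real) \<Rightarrow> 'n \<Rightarrow> (real^'n) \<Rightarrow> real" where
  "pderiv_r f j x = frechet_derivative f (at x) (axis j 1)"

fun Ck :: "nat \<Rightarrow> ((real^'n) \<Rightarrow> real) \<Rightarrow> bool" where
  "Ck 0 f = continuous_on UNIV f"
| "Ck (Suc k) f = ((\<forall>x. f differentiable (at x)) \<and> (\<forall>j. Ck k (pderiv_r f j)))"

definition smooth_fun :: "((real^'n) \<Rightarrow> real) \<Rightarrow> bool" where
  "smooth_fun f \<longleftrightarrow> (\<forall>k. Ck k f)"

definition tsupp :: "((real^'n) \<Rightarrow> real) \<Rightarrow> (real^'n) set" where
  "tsupp f = closure {x. f x \<noteq> 0}"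

definition test_fun :: "(real^'n) set \<Rightarrow> ((real^'n) \<Rightarrow> real) \<Rightarrow> bool" where
  "test_fun \<Omega> f \<longleftrightarrow> smooth_fun f \<and> compact (tsupp f) \<and> tsupp f \<subseteq> interior \<Omega>"

definition L2fun :: "(real^'n) set \<Rightarrow> ((real^'n) \<Rightarrow> complex) \<Rightarrow> bool" where
  "L2fun G v \<longleftrightarrow> set_borel_measurable lborel G v \<and>
      set_integrable lborel G (\<lambda>x. (cmod (v x))\<^sup>2)"

definition L2ip :: "(real^'n) set \<Rightarrow> ((real^'n) \<Rightarrow> complex) \<Rightarrow> ((real^'n) \<Rightarrow> complex) \<Rightarrow> real" where
  "L2ip G v w = Re (LINT x:G|lborel. v x * cnj (w x))"

definition L2norm :: "(real^'n) set \<Rightarrow> ((real^'n) \<Rightarrow> complex) \<Rightarrow> real" where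
  "L2norm G v = sqrt (L2ip G v v)"

definition L2ipv :: "(real^'n) set \<Rightarrow> ((real^'n) \<Rightarrow> complex^'n) \<Rightarrow> ((real^'n) \<Rightarrow> complex^'n) \<Rightarrow> real" where
  "L2ipv G u w = Re (LINT x:G|lborel. (\<Sum>j\<in>UNIV. u x $ j * cnj (w x $ j)))"

definition L2normv :: "(real^'n) set \<Rightarrow> ((real^'n) \<Rightarrow> complex^'n) \<Rightarrow> real" where
  "L2normv G u = sqrt (L2ipv G u u)"

definition is_weak_grad :: "(real^'n) set \<Rightarrow> ((real^'n) \<Rightarrow> complex) \<Rightarrow> ((real^'n) \<Rightarrow> complex^'n) \<Rightarrow> bool" where
  "is_weak_grad \<Omega> v g \<longleftrightarrow>
     (\<forall>j. L2fun \<Omega> (\<lambda>x. g x $ j)) \<and>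
     (\<forall>\<phi> j. test_fun \<Omega> \<phi> \<longrightarrow>
        (LINT x:\<Omega>|lborel. v x * complex_of_real (pderiv_r \<phi> j x))
        = - (LINT x:\<Omega>|lborel. g x $ j * complex_of_real (\<phi> x)))"

definition H1 :: "(real^'n) set \<Rightarrow> ((real^'n) \<Rightarrow> complex) \<Rightarrow> bool" where
  "H1 \<Omega> v \<longleftrightarrow> L2fun \<Omega> v \<and> (\<exists>g. is_weak_grad \<Omega> v g)"

text \<open>the weak gradient (unique up to null sets, so all integrals below are well defined)\<close>
definition wgrad :: "(real^'n) set \<Rightarrow> ((real^'n) \<Rightarrow> complex) \<Rightarrow> ((real^'n) \<Rightarrow> complex^'n)" where
  "wgrad \<Omega> v = (SOME g. is_weak_grad \<Omega> v g)"

definition Linf_norm :: "(real^'n) set \<Rightarrow> ((real^'n) \<Rightarrow> real^'n) \<Rightarrow> real" where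
  "Linf_norm \<Omega> A = Inf {M. AE x in lborel. x \<in> \<Omega> \<longrightarrow> norm (A x) \<le> M}"

text \<open>A in L^infty(Omega,R^d), div A = 0 in Omega, A.n = 0 on the boundary (weak form:
  int_Omega A . grad phi = 0 for all smooth phi on R^d)\<close>
definition admissible_potential :: "(real^'n) set \<Rightarrow> ((real^'n) \<Rightarrow> real^'n) \<Rightarrow> bool" where
  "admissible_potential \<Omega> A \<longleftrightarrow>
     set_borel_measurable lborel \<Omega> A \<and>
     (\<exists>M. AE x in lborel. x \<in> \<Omega> \<longrightarrow> norm (A x) \<le> M) \<and>
     (\<forall>\<phi>. smooth_fun \<phi> \<longrightarrow>
        (LINT x:\<Omega>|lborel. (\<Sum>j\<in>UNIV. A x $ j * pderiv_r \<phi> j x)) = 0)"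

definition mag_grad :: "(real^'n) set \<Rightarrow> real \<Rightarrow> ((real^'n) \<Rightarrow> real^'n) \<Rightarrow> ((real^'n) \<Rightarrow> complex) \<Rightarrow> (real^'n) \<Rightarrow> complex^'n" where
  "mag_grad \<Omega> \<kappa> A v x = (\<chi> j. (\<i> / complex_of_real \<kappa>) * wgrad \<Omega> v x $ j + complex_of_real (A x $ j) * v x)"

definition a_form :: "(real^'n) set \<Rightarrow> real \<Rightarrow> ((real^'n) \<Rightarrow> real^'n) \<Rightarrow> real \<Rightarrow> (real^'n) set \<Rightarrow> ((real^'n) \<Rightarrow> complex) \<Rightarrow> ((real^'n) \<Rightarrow> complex) \<Rightarrow> real" where
  "a_form \<Omega> \<kappa> A \<beta> G v w = L2ipv G (mag_grad \<Omega> \<kappa> A v) (mag_grad \<Omega> \<kappa> A w) + \<beta> * L2ip G v w"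

definition enorm :: "(real^'n) set \<Rightarrow> real \<Rightarrow> ((real^'n) \<Rightarrow> real^'n) \<Rightarrow> real \<Rightarrow> (real^'n) set \<Rightarrow> ((real^'n) \<Rightarrow> complex) \<Rightarrow> real" where
  "enorm \<Omega> \<kappa> A \<beta> G v = sqrt (a_form \<Omega> \<kappa> A \<beta> G v v)"

definition inradius :: "(real^'n) set \<Rightarrow> real" where
  "inradius T = Sup {r. \<exists>x. ball x r \<subseteq> T}"

definition conforming_mesh :: "(real^'n) set \<Rightarrow> (real^'n) set set \<Rightarrow> bool" where
  "conforming_mesh \<Omega> \<T> \<longleftrightarrow> finite \<T> \<and> \<T> \<noteq> {} \<and>
     (\<forall>T\<in>\<T>. int CARD('n) simplex T) \<and>
     \<Union>\<T> = \<Omega> \<and>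
     (\<forall>T\<in>\<T>. \<forall>T'\<in>\<T>. (T \<inter> T') face_of T \<and> (T \<inter> T') face_of T')"

definition mesh_size :: "(real^'n) set set \<Rightarrow> real" where
  "mesh_size \<T> = Max (diameter ` \<T>)"

definition shape_regular :: "real \<Rightarrow> (real^'n) set set \<Rightarrow> bool" where
  "shape_regular \<sigma> \<T> \<longleftrightarrow> (\<forall>T\<in>\<T>. diameter T \<le> \<sigma> * inradius T)"

definition quasi_uniform :: "real \<Rightarrow> (real^'n) set set \<Rightarrow> bool" where
  "quasi_uniform \<rho> \<T> \<longleftrightarrow> (\<forall>T\<in>\<T>. \<rho> * mesh_size \<T> \<le> diameter T)"

definition Vh :: "(real^'n) set \<Rightarrow> (real^'n) set set \<Rightarrow> ((real^'n) \<Rightarrow> complex) set" where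
  "Vh \<Omega> \<T> = {v. continuous_on \<Omega> v \<and>
      (\<forall>T\<in>\<T>. \<exists>(a::complex) (b::complex^'n). \<forall>x\<in>T. v x = a + (\<Sum>j\<in>UNIV. b $ j * complex_of_real (x $ j)))}"

definition is_L2_proj :: "(real^'n) set \<Rightarrow> (real^'n) set set \<Rightarrow> ((real^'n) \<Rightarrow> complex) \<Rightarrow> ((real^'n) \<Rightarrow> complex) \<Rightarrow> bool" where
  "is_L2_proj \<Omega> \<T> v p \<longleftrightarrow> p \<in> Vh \<Omega> \<T> \<and> (\<forall>w\<in>Vh \<Omega> \<T>. L2ip \<Omega> (\<lambda>x. v x - p x) w = 0)"

definition Wspace :: "(real^'n) set \<Rightarrow> (real^'n) set set \<Rightarrow> ((real^'n) \<Rightarrow> complex) set" where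
  "Wspace \<Omega> \<T> = {v. H1 \<Omega> v \<and> is_L2_proj \<Omega> \<T> v (\<lambda>_. 0)}"

definition patch :: "(real^'n) set set \<Rightarrow> (real^'n) set \<Rightarrow> (real^'n) set" where
  "patch \<T> G = interior (\<Union>{T\<in>\<T>. T \<inter> closure G \<noteq> {}})"

definition patch_pow :: "(real^'n) set set \<Rightarrow> nat \<Rightarrow> (real^'n) set \<Rightarrow> (real^'n) set" where
  "patch_pow \<T> l G = (patch \<T> ^^ l) G"

end

(* Caccioppoli-type iteration. For c in W let e(c) be the density of
   kappa^-2 (|grad c|^2 + h^-2 |c|^2) + beta |c|^2. By the resolution condition its integral over
   Omega is controlled by a_beta on W. Take a smooth cutoff eta that vanishes on l element layers around T and is
   1 beyond l + N layers, and correct eta c by interior bubbles p on the transition elements so that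
   w = eta c - p lies in W. Testing the corrector equation with w leaves only transition terms, so the energy
   outside l + N layers is at most a constant times the energy in the transition layers, and it decays by a
   fixed factor q < 1 every N layers. Keeping h^-2 |c|^2 in the energy makes local Poincare inequalities
   superfluous, and q does not depend on beta. *)

theory Submission
  imports Defs
begin

section \<open>Smooth functions\<close>

text \<open>Membership in \<open>W\<close> is a global orthogonality to \<open>Vh\<close>, so
  multiplication by a cutoff leaves \<open>W\<close>, and repairing it with the projection itself
  would spread over the whole domain. Bubbles avoid this because on one element finitely many
  moments determine the pairing with \<open>Vh\<close>: the bubbles are dual to the affine
  functions, and their size is controlled by the norm of the functional to be matched. The defect
  sits on transition elements alone only after subtracting a discrete function that carries the
  outer nodal values and to which \<open>c\<close> is orthogonal. The cutoff needs Euclidean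
  distance \<open>h\<close>, whereas patches count elements; a packing argument bounds the number
  \<open>N\<close> of layers that exhaust this distance. Since \<open>wgrad\<close> is an arbitrary
  choice, explicit gradients are tied to it only almost everywhere, through uniqueness of weak
  gradients. The exponent \<open>1/12\<close> is reached by giving rate away: the energy is a
  squared norm, and its decay exponent is weakened by a further factor of six. As the rate is
  uniform in \<beta>, the bound with \<open>\<kappa> * \<beta> * h\<close> follows by
  monotonicity.\<close>

lemma pderiv_r_eq:
  assumes "(f has_derivative f') (at x)"
  shows "pderiv_r f j x = f' (axis j 1)"
  using frechet_derivative_at[OF assms] by (simp add: pderiv_r_def)

lemma has_derivative_pderiv_r:
  fixes f :: "(real^'n) \<Rightarrow> real"
  assumes "f differentiable (at x)"
  shows "(f has_derivative (\<lambda>v. \<Sum>j\<in>UNIV. v $ j * pderiv_r f j x)) (at x)"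
proof -
  have *: "(f has_derivative frechet_derivative f (at x)) (at x)"
    using assms frechet_derivative_works by blast
  then interpret L: bounded_linear "frechet_derivative f (at x)"
    by (rule has_derivative_bounded_linear)
  have "frechet_derivative f (at x) v = (\<Sum>j\<in>UNIV. v $ j * pderiv_r f j x)" for v
  proof -
    have "frechet_derivative f (at x) v = frechet_derivative f (at x) (\<Sum>j\<in>UNIV. v $ j *\<^sub>R axis j 1)"
      using basis_expansion[of v] by (simp add: scalar_mult_eq_scaleR)
    also have "\<dots> = (\<Sum>j\<in>UNIV. v $ j * pderiv_r f j x)"
      by (simp add: L.sum L.scaleR pderiv_r_def)
    finally show ?thesis .
  qed
  then show ?thesis using * by (metis (no_types, lifting) ext)
qed

text \<open>\<open>frechet_derivative\<close> is a choice among the derivatives at a point.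
  Functions that agree near the point have the same derivatives there, so the choices agree even if
  the set of derivatives is empty.\<close>

lemma pderiv_r_local:
  assumes "open U" "x \<in> U" "\<And>y. y \<in> U \<Longrightarrow> f y = g y"
  shows "pderiv_r f j x = pderiv_r g j x"
proof -
  have "(f has_derivative D) (at x) \<longleftrightarrow> (g has_derivative D) (at x)" for D
    using assms has_derivative_transform_within_open[of f D x UNIV U g]
      has_derivative_transform_within_open[of g D x UNIV U f] by auto
  then show ?thesis by (simp add: pderiv_r_def frechet_derivative_def)
qed

lemma pderiv_r_const [simp]: "pderiv_r (\<lambda>_. c) j = (\<lambda>_. 0)"
  by (rule ext) (simp add: pderiv_r_eq[OF has_derivative_const])

lemma pderiv_r_add:
  assumes "f differentiable (at x)" "g differentiable (at x)"
  shows "pderiv_r (\<lambda>x. f x + g x) j x = pderiv_r f j x + pderiv_r g j x"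
  using pderiv_r_eq[OF has_derivative_add[OF assms[unfolded frechet_derivative_works]]]
  by (simp add: pderiv_r_def)

lemma pderiv_r_mult:
  assumes "f differentiable (at x)" "g differentiable (at x)"
  shows "pderiv_r (\<lambda>x. f x * g x) j x = f x * pderiv_r g j x + pderiv_r f j x * g x"
  using pderiv_r_eq[OF has_derivative_mult[OF assms[unfolded frechet_derivative_works]]]
  by (simp add: pderiv_r_def)

text \<open>The right-hand side is written as a product of a constant, a derivative and inverses, so
  that \<open>Ck_inverse\<close> closes with the product rule \<open>Ck_mult\<close>.\<close>

lemma pderiv_r_inverse:
  fixes f :: "(real^'n) \<Rightarrow> real"
  assumes "f differentiable (at x)" "f x \<noteq> 0"
  shows "pderiv_r (\<lambda>x. inverse (f x)) j x = - 1 * (pderiv_r f j x * (inverse (f x) * inverse (f x)))"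
  using pderiv_r_eq[OF Deriv.has_derivative_inverse[OF assms(2) assms(1)[unfolded frechet_derivative_works]]]
  by (simp add: pderiv_r_def)

lemma pderiv_r_affine:
  fixes f :: "(real^'n) \<Rightarrow> real"
  assumes "f differentiable (at (a *\<^sub>R x + b))"
  shows "pderiv_r (\<lambda>x. f (a *\<^sub>R x + b)) j x = a * pderiv_r f j (a *\<^sub>R x + b)"
proof -
  have *: "(f has_derivative frechet_derivative f (at (a *\<^sub>R x + b))) (at (a *\<^sub>R x + b))"
    using assms by (simp add: frechet_derivative_works)
  have "((\<lambda>x. a *\<^sub>R x + b) has_derivative (\<lambda>x. a *\<^sub>R x)) (at x)"
    by (auto intro!: derivative_eq_intros)
  from diff_chain_at[OF this *]
  have "((\<lambda>x. f (a *\<^sub>R x + b)) has_derivative (\<lambda>v. frechet_derivative f (at (a *\<^sub>R x + b)) (a *\<^sub>R v))) (at x)"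
    by (simp add: o_def)
  then show ?thesis
    using linear_scale[OF linear_frechet_derivative[OF assms]]
    by (subst pderiv_r_eq) (auto simp: pderiv_r_def)
qed

lemma Ck_const [simp]: "Ck k (\<lambda>_. c)"
  by (induction k arbitrary: c) auto

text \<open>The product rule multiplies derivatives by the undifferentiated functions, so the
  induction for products and inverses needs these at the lower order too.\<close>

lemma Ck_Suc_D: "Ck (Suc k) f \<Longrightarrow> Ck k f"
proof (induction k arbitrary: f)
  case 0
  then show ?case
    by (auto intro!: continuous_at_imp_continuous_on differentiable_imp_continuous_within)
next
  case (Suc k)
  then show ?case by (metis Ck.simps(2))
qed

lemma Ck_add: "Ck k f \<Longrightarrow> Ck k g \<Longrightarrow> Ck k (\<lambda>x. f x + g x)"
proof (induction k arbitrary: f g)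
  case 0
  then show ?case by (auto intro: continuous_intros)
next
  case (Suc k)
  then have "pderiv_r (\<lambda>x. f x + g x) j = (\<lambda>x. pderiv_r f j x + pderiv_r g j x)" for j
    by (auto simp: pderiv_r_add)
  with Suc show ?case by auto
qed

lemma Ck_mult: "Ck k f \<Longrightarrow> Ck k g \<Longrightarrow> Ck k (\<lambda>x. f x * g x)"
proof (induction k arbitrary: f g)
  case 0
  then show ?case by (auto intro: continuous_intros)
next
  case (Suc k)
  then have *: "pderiv_r (\<lambda>x. f x * g x) j = (\<lambda>x. f x * pderiv_r g j x + pderiv_r f j x * g x)" for j
    by (auto simp: pderiv_r_mult)
  have "Ck k f" "Ck k g" using Suc.prems Ck_Suc_D by blast+
  with Suc show ?case unfolding Ck.simps * by (auto intro!: Ck_add)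
qed

lemma Ck_inverse: "Ck k f \<Longrightarrow> (\<And>x. f x \<noteq> 0) \<Longrightarrow> Ck k (\<lambda>x. inverse (f x))"
proof (induction k)
  case 0
  then show ?case by (auto intro: continuous_intros)
next
  case (Suc k)
  then have *: "pderiv_r (\<lambda>x. inverse (f x)) j = (\<lambda>x. - 1 * (pderiv_r f j x * (inverse (f x) * inverse (f x))))" for j
    by (auto simp: pderiv_r_inverse)
  have "Ck k f" using Suc.prems Ck_Suc_D by blast
  with Suc show ?case unfolding Ck.simps *
    by (intro conjI allI Ck_mult Ck_const) (auto intro!: differentiable_inverse)
qed

lemma Ck_affine: "Ck k f \<Longrightarrow> Ck k (\<lambda>x. f (a *\<^sub>R x + b))"
proof (induction k arbitrary: f)
  case 0
  then show ?case
    by (auto intro!: continuous_on_compose2[of UNIV f] continuous_intros)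
next
  case (Suc k)
  then have *: "pderiv_r (\<lambda>x. f (a *\<^sub>R x + b)) j = (\<lambda>x. a * pderiv_r f j (a *\<^sub>R x + b))" for j
    by (auto simp: pderiv_r_affine)
  have "(\<lambda>x. f (a *\<^sub>R x + b)) differentiable at x" for x
    by (rule differentiable_compose) (use Suc.prems in \<open>auto intro!: derivative_intros\<close>)
  with Suc show ?case unfolding Ck.simps * by (auto intro!: Ck_mult)
qed

lemma pderiv_r_coord: "pderiv_r (\<lambda>x. x $ i) j x = (if i = j then 1 else 0)"
  by (subst pderiv_r_eq[OF bounded_linear_imp_has_derivative[OF bounded_linear_vec_nth]])
     (simp add: axis_def)

lemma Ck_coord: "Ck k (\<lambda>x::real^'n. x $ i)"
proof (induction k)
  case (Suc k)
  have "pderiv_r (\<lambda>x::real^'n. x $ i) j = (\<lambda>x. if i = j then 1 else 0)" for j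
    by (simp add: pderiv_r_coord fun_eq_iff)
  then show ?case
    by (auto intro!: bounded_linear_imp_differentiable bounded_linear_vec_nth)
qed (auto intro: continuous_intros)

lemma smooth_const [simp]: "smooth_fun (\<lambda>_. c)"
  and smooth_add: "smooth_fun f \<Longrightarrow> smooth_fun g \<Longrightarrow> smooth_fun (\<lambda>x. f x + g x)"
  and smooth_mult: "smooth_fun f \<Longrightarrow> smooth_fun g \<Longrightarrow> smooth_fun (\<lambda>x. f x * g x)"
  and smooth_inverse: "smooth_fun f \<Longrightarrow> (\<And>x. f x \<noteq> 0) \<Longrightarrow> smooth_fun (\<lambda>x. inverse (f x))"
  and smooth_affine: "smooth_fun f \<Longrightarrow> smooth_fun (\<lambda>x. f (a *\<^sub>R x + b))"
  and smooth_coord: "smooth_fun (\<lambda>x. x $ i)"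
  by (auto simp: smooth_fun_def intro: Ck_add Ck_mult Ck_inverse Ck_affine Ck_coord)

lemma smooth_diff: "smooth_fun f \<Longrightarrow> smooth_fun g \<Longrightarrow> smooth_fun (\<lambda>x. f x - g x)"
  using smooth_add[of f "\<lambda>x. -1 * g x"] smooth_mult[of "\<lambda>_. -1" g] by simp

lemma smooth_prod: "(\<And>i. i \<in> I \<Longrightarrow> smooth_fun (f i)) \<Longrightarrow> smooth_fun (\<lambda>x. \<Prod>i\<in>I. f i x)"
  by (induction I rule: infinite_finite_induct) (auto intro: smooth_mult)

lemma smooth_differentiable: "smooth_fun f \<Longrightarrow> f differentiable (at x)"
  unfolding smooth_fun_def using Ck.simps(2) by blast

lemma smooth_pderiv: "smooth_fun f \<Longrightarrow> smooth_fun (pderiv_r f j)"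
  unfolding smooth_fun_def using Ck.simps(2) by blast

lemma smooth_continuous: "smooth_fun f \<Longrightarrow> continuous_on S f"
  unfolding smooth_fun_def using Ck.simps(1) continuous_on_subset by blast

lemma smooth_measurable: "smooth_fun f \<Longrightarrow> f \<in> borel_measurable borel"
  by (intro borel_measurable_continuous_onI smooth_continuous)

lemma pderiv_r_cmult:
  "smooth_fun f \<Longrightarrow> pderiv_r (\<lambda>x. c * f x) j x = c * pderiv_r f j x"
  by (simp add: pderiv_r_mult smooth_differentiable)

section \<open>Bump functions and cutoffs\<close>

lemma pderiv_r_const_diff:
  "smooth_fun f \<Longrightarrow> pderiv_r (\<lambda>x. c - f x) j x = - pderiv_r f j x"
  using pderiv_r_add[of "\<lambda>_. c" x "\<lambda>x. (-1) * f x" j] pderiv_r_cmult[of f "-1" j x]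
  by (simp add: smooth_differentiable)

text \<open>The negative powers form, together with the classical \<open>exp (- 1 / x)\<close>, a
  family whose span is closed under differentiation. Smoothness then follows by induction on the
  order for all \<open>k\<close> simultaneously.\<close>

definition flat :: "nat \<Rightarrow> real \<Rightarrow> real" where
  "flat k x = (if x > 0 then exp (- 1 / x) / x ^ k else 0)"

lemma flat_tendsto_0: "(flat k \<longlongrightarrow> 0) (at 0)"
proof -
  have "((\<lambda>x::real. inverse x ^ k / exp (inverse x)) \<longlongrightarrow> 0) (at_right 0)"
    by (rule filterlim_compose[OF tendsto_power_div_exp_0 filterlim_inverse_at_top_right])
  then have "(flat k \<longlongrightarrow> 0) (at_right 0)"
    by (rule Lim_transform_eventually)
       (auto simp: eventually_at_right_field flat_def exp_minus field_simps intro!: exI[of _ 1])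
  moreover have "(flat k \<longlongrightarrow> 0) (at_left 0)"
    by (rule tendsto_eventually) (auto simp: eventually_at_left_field flat_def intro!: exI[of _ "-1"])
  ultimately show ?thesis by (simp add: filterlim_at_split)
qed

lemma DERIV_flat: "(flat k has_real_derivative flat (k+2) x - k * flat (k+1) x) (at x)"
proof (cases "x = 0")
  case True
  \<comment> \<open>Away from \<open>0\<close> the difference quotient of \<open>flat k\<close> is
    \<open>flat (Suc k)\<close>, whose limit is already known.\<close>
  have "((\<lambda>h. (flat k (0 + h) - flat k 0) / h) \<longlongrightarrow> 0) (at 0)"
    by (rule Lim_transform_eventually[OF flat_tendsto_0[of "Suc k"]])
       (auto simp: eventually_at_filter flat_def)
  then show ?thesis unfolding True has_field_derivative_def
    using True by (simp add: flat_def DERIV_def has_field_derivative_def[symmetric])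
next
  case False
  show ?thesis
  proof (cases "x > 0")
    case True
    have "((\<lambda>x. exp (- 1 / x) / x ^ k) has_real_derivative flat (k+2) x - k * flat (k+1) x) (at x)"
      using True
      by (auto intro!: derivative_eq_intros simp: flat_def divide_simps)
         (cases k; auto simp: field_simps power2_eq_square)
    then show ?thesis
      by (rule has_field_derivative_transform_within_open[where S = "{0<..}"]) (use True in \<open>auto simp: flat_def\<close>)
  next
    case neg: False
    have "((\<lambda>x. 0) has_real_derivative flat (k+2) x - k * flat (k+1) x) (at x)"
      using False neg by (simp add: flat_def)
    then show ?thesis
      by (rule has_field_derivative_transform_within_open[where S = "{..<0}"]) (use False neg in \<open>auto simp: flat_def\<close>)
  qed
qed

text \<open>\<open>smooth_fun\<close> speaks of functions on \<open>real^'n\<close> only, so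
  one-dimensional profiles enter through affine functions of a single coordinate.\<close>

lemma smooth_flat: "smooth_fun (\<lambda>x::real^'n. flat k (a * x $ j + b))"
proof -
  have "Ck m (\<lambda>x::real^'n. flat k (a * x $ j + b))" for m
  proof (induction m arbitrary: k)
    case 0
    have "isCont (flat k) t" for t using DERIV_isCont[OF DERIV_flat] .
    then have "continuous_on UNIV (flat k)" by (simp add: continuous_at_imp_continuous_on)
    then show ?case
      by (auto intro!: continuous_on_compose2[of UNIV "flat k"] continuous_intros)
  next
    case (Suc m)
    have *: "((\<lambda>x::real^'n. flat k (a * x $ j + b)) has_derivative
        (\<lambda>v. a * v $ j * (flat (k+2) (a * x $ j + b) - k * flat (k+1) (a * x $ j + b)))) (at x)" for x
    proof -
      have "((\<lambda>x::real^'n. a * x $ j + b) has_derivative (\<lambda>v. a * v $ j)) (at x)"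
        by (auto intro!: derivative_eq_intros bounded_linear_imp_has_derivative bounded_linear_vec_nth)
      from diff_chain_at[OF this DERIV_flat[unfolded has_field_derivative_def]]
      show ?thesis by (simp add: o_def mult.commute)
    qed
    have "pderiv_r (\<lambda>x::real^'n. flat k (a * x $ j + b)) i = (\<lambda>x. (a * (if i = j then 1 else 0)) *
       (flat (k+2) (a * x $ j + b) + (- real k) * flat (k+1) (a * x $ j + b)))" for i
      using pderiv_r_eq[OF *] by (auto simp: axis_def fun_eq_iff)
    moreover have "Ck m (\<lambda>x::real^'n. (a * (if i = j then 1 else 0)) *
       (flat (k+2) (a * x $ j + b) + (- real k) * flat (k+1) (a * x $ j + b)))" for i
      by (intro Ck_mult Ck_add Ck_const Suc)
    ultimately show ?case using * unfolding Ck.simps by (auto simp: differentiable_def)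
  qed
  then show ?thesis by (simp add: smooth_fun_def)
qed

definition smooth_step :: "real \<Rightarrow> real" where
  "smooth_step t = flat 0 t * inverse (flat 0 t + flat 0 (1 - t))"

lemma smooth_step_denom_pos: "flat 0 t + flat 0 (1 - t) > 0"
  by (cases "t > 0") (auto simp: flat_def intro!: add_pos_nonneg)

lemma smooth_step_bounds: "0 \<le> smooth_step t" "smooth_step t \<le> 1"
  and smooth_step_0: "t \<le> 0 \<Longrightarrow> smooth_step t = 0"
  and smooth_step_1: "t \<ge> 1 \<Longrightarrow> smooth_step t = 1"
proof -
  have p: "0 \<le> flat 0 t" "0 \<le> flat 0 (1 - t)" by (auto simp: flat_def)
  show "0 \<le> smooth_step t" "smooth_step t \<le> 1"
    unfolding smooth_step_def divide_inverse[symmetric]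
    using p smooth_step_denom_pos[of t] by (auto simp: divide_le_eq_1)
  show "smooth_step t = 0" if "t \<le> 0" using that by (simp add: smooth_step_def flat_def)
  show "smooth_step t = 1" if "t \<ge> 1" using that by (simp add: smooth_step_def flat_def)
qed

lemma smooth_smooth_step: "smooth_fun (\<lambda>x::real^'n. smooth_step (a * x $ j + b))"
proof -
  have e: "1 - (a * t + b) = (- a) * t + (1 - b)" for t by simp
  have *: "smooth_step (a * t + b) =
      flat 0 (a * t + b) * inverse (flat 0 (a * t + b) + flat 0 ((- a) * t + (1 - b)))"
    and "flat 0 (a * t + b) + flat 0 ((- a) * t + (1 - b)) \<noteq> 0" for t
    using smooth_step_denom_pos[of "a * t + b"] unfolding smooth_step_def e by auto
  then show ?thesis unfolding *
    by (intro smooth_mult smooth_inverse smooth_add smooth_flat) blast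
qed

text \<open>The two reflected factors make the profile even. This symmetry later makes the mixed
  moments of \<open>bump\<close> vanish.\<close>

definition plateau :: "real \<Rightarrow> real" where
  "plateau t = smooth_step (2 * t + 2) * smooth_step ((-2) * t + 2)"

lemma plateau_bounds: "0 \<le> plateau t" "plateau t \<le> 1"
  and plateau_1: "\<bar>t\<bar> \<le> 1/2 \<Longrightarrow> plateau t = 1"
  and plateau_0: "\<bar>t\<bar> \<ge> 1 \<Longrightarrow> plateau t = 0"
  and plateau_even: "plateau (- t) = plateau t"
  by (auto simp: plateau_def smooth_step_bounds mult_le_one abs_if smooth_step_0 smooth_step_1
      mult.commute split: if_splits)

definition bump :: "real^'n \<Rightarrow> real" where
  "bump x = (\<Prod>j\<in>UNIV. plateau (x $ j))"

lemma smooth_bump: "smooth_fun (bump :: real^'n \<Rightarrow> real)"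
proof -
  have "smooth_fun (\<lambda>x::real^'n. plateau (x $ j))" for j
    unfolding plateau_def by (intro smooth_mult smooth_smooth_step)
  then show ?thesis unfolding bump_def[abs_def] by (intro smooth_prod)
qed

lemma bump_bounds: "0 \<le> bump x" "bump x \<le> 1"
  and bump_1: "(\<And>j. \<bar>x $ j\<bar> \<le> 1/2) \<Longrightarrow> bump x = 1"
  and bump_0: "\<bar>x $ j\<bar> \<ge> 1 \<Longrightarrow> bump x = 0"
  by (auto simp: bump_def plateau_bounds plateau_1 plateau_0 prod_nonneg intro!: prod_le_1 exI[of _ j])

lemma pderiv_bump_0:
  fixes x :: "real^'n"
  assumes "\<bar>x $ i\<bar> > 1"
  shows "pderiv_r bump j x = 0"
proof -
  have "open {x::real^'n. \<bar>x $ i\<bar> > 1}"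
    by (intro open_Collect_less continuous_intros)
  then have "pderiv_r bump j x = pderiv_r (\<lambda>_. 0) j x"
    by (rule pderiv_r_local) (use assms bump_0 less_imp_le in auto)
  then show ?thesis by simp
qed

text \<open>Continuity bounds the derivatives on the closed unit cube around the origin, and outside
  of it they vanish.\<close>

lemma bump_pderiv_bounded: "\<exists>M>0. \<forall>j (x::real^'n). \<bar>pderiv_r bump j x\<bar> \<le> M"
proof -
  define B :: "(real^'n) set" where "B = cbox (-1) 1"
  have "\<exists>M. \<forall>x\<in>B. \<bar>pderiv_r bump j x\<bar> \<le> M" for j :: 'n
  proof -
    have "compact (pderiv_r bump j ` B)"
      unfolding B_def by (intro compact_continuous_image smooth_continuous smooth_pderiv smooth_bump compact_cbox)
    then have "bounded (pderiv_r bump j ` B)" by (rule compact_imp_bounded)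
    then show ?thesis by (auto simp: bounded_iff)
  qed
  then obtain M where M: "\<And>j x. x \<in> B \<Longrightarrow> \<bar>pderiv_r bump j x\<bar> \<le> M j" by metis
  have Mp: "M j \<ge> 0" for j using M[of 0 j] by (auto simp: B_def mem_box_cart)
  have "\<bar>pderiv_r bump j x\<bar> \<le> sum M UNIV + 1" for j and x :: "real^'n"
  proof (cases "x \<in> B")
    case True
    have "M j \<le> sum M UNIV" by (rule member_le_sum) (auto simp: Mp)
    then show ?thesis using M[OF True, of j] by linarith
  next
    case False
    then obtain i where "\<bar>x $ i\<bar> > 1" by (simp add: B_def mem_box_cart) (smt (verit))
    then show ?thesis by (simp add: pderiv_bump_0 sum_nonneg Mp add_nonneg_nonneg)
  qed
  moreover have "sum M UNIV + 1 > 0" by (simp add: sum_nonneg Mp add_nonneg_pos)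
  ultimately show ?thesis by blast
qed

lemma pderiv_r_prod_bound:
  fixes f :: "'i \<Rightarrow> (real^'n) \<Rightarrow> real"
  assumes "\<And>i. i \<in> I \<Longrightarrow> smooth_fun (f i)" "\<And>i x. i \<in> I \<Longrightarrow> \<bar>f i x\<bar> \<le> 1"
  shows "\<bar>pderiv_r (\<lambda>x. \<Prod>i\<in>I. f i x) j x\<bar> \<le> (\<Sum>i\<in>I. \<bar>pderiv_r (f i) j x\<bar>)"
  using assms
proof (induction I rule: infinite_finite_induct)
  case (insert a I)
  have P: "\<bar>\<Prod>i\<in>I. f i x\<bar> \<le> 1"
    using insert.prems by (auto simp: abs_prod intro!: prod_le_1)
  have "pderiv_r (\<lambda>x. \<Prod>i\<in>insert a I. f i x) j x =
      f a x * pderiv_r (\<lambda>x. \<Prod>i\<in>I. f i x) j x + pderiv_r (f a) j x * (\<Prod>i\<in>I. f i x)"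
    using insert by (simp add: pderiv_r_mult smooth_differentiable smooth_prod)
  also have "\<bar>\<dots>\<bar> \<le> \<bar>f a x\<bar> * \<bar>pderiv_r (\<lambda>x. \<Prod>i\<in>I. f i x) j x\<bar> + \<bar>pderiv_r (f a) j x\<bar> * \<bar>\<Prod>i\<in>I. f i x\<bar>"
    by (metis abs_mult abs_triangle_ineq)
  also have "\<dots> \<le> 1 * \<bar>pderiv_r (\<lambda>x. \<Prod>i\<in>I. f i x) j x\<bar> + \<bar>pderiv_r (f a) j x\<bar> * 1"
    using insert.prems P by (intro add_mono mult_mono) auto
  finally show ?case using insert by simp
qed auto

text \<open>The cutoff is one minus a product over the points of a grid of width comparable to \<open>\<delta>\<close>
  near \<open>G\<close>; the gradient bound holds because at each point only boundedly many factors vary.\<close>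

lemma smooth_cutoff:
  "\<exists>C>0. \<forall>(G::(real^'n) set) \<delta>. bounded G \<longrightarrow> \<delta> > 0 \<longrightarrow>
     (\<exists>\<psi>. smooth_fun \<psi> \<and> (\<forall>x. 0 \<le> \<psi> x \<and> \<psi> x \<le> 1) \<and> (\<forall>x\<in>G. \<psi> x = 1) \<and>
       (\<forall>x. \<psi> x \<noteq> 0 \<longrightarrow> (\<exists>y\<in>G. dist x y \<le> \<delta>)) \<and> (\<forall>j x. \<bar>pderiv_r \<psi> j x\<bar> \<le> C / \<delta>))"
proof -
  obtain M where M: "M > 0" "\<And>j (x::real^'n). \<bar>pderiv_r bump j x\<bar> \<le> M"
    using bump_pderiv_bounded by blast
  define n where "n = real CARD('n)"
  have n: "n \<ge> 1" by (simp add: n_def Suc_le_eq)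
  \<comment> \<open>At most \<open>3 ^ CARD('n)\<close> grid points matter near a given point, and
    each factor has slope at most \<open>M / e = 2 * n * M / \<delta>\<close>.\<close>
  define C where "C = 3 ^ CARD('n) * M * 2 * n"
  have "C > 0" using M n by (simp add: C_def)
  moreover have "\<exists>\<psi>. smooth_fun \<psi> \<and> (\<forall>x. 0 \<le> \<psi> x \<and> \<psi> x \<le> 1) \<and> (\<forall>x\<in>G. \<psi> x = 1) \<and>
       (\<forall>x. \<psi> x \<noteq> 0 \<longrightarrow> (\<exists>y\<in>G. dist x y \<le> \<delta>)) \<and> (\<forall>j x. \<bar>pderiv_r \<psi> j x\<bar> \<le> C / \<delta>)"
    if G: "bounded G" and \<delta>: "\<delta> > 0" for G :: "(real^'n) set" and \<delta>
  proof -
    \<comment> \<open>A point of the support differs from some point of \<open>G\<close> by at most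
      \<open>2 * e\<close> in each coordinate; summing over \<open>n\<close> coordinates gives
      distance at most \<open>\<delta>\<close>.\<close>
    define e where "e = \<delta> / (2 * n)"
    have e: "e > 0" using \<delta> n by (simp add: e_def)
    obtain B where B: "\<And>y. y \<in> G \<Longrightarrow> norm y \<le> B" using G by (auto simp: bounded_iff)
    define I where "I = {i::'n \<Rightarrow> int. \<exists>y\<in>G. \<forall>j. \<bar>y $ j / e - i j\<bar> \<le> 1/2}"
    have "I \<subseteq> PiE UNIV (\<lambda>_. {-\<lceil>B/e + 1\<rceil>..\<lceil>B/e+1\<rceil>})"
    proof
      fix i assume "i \<in> I"
      then obtain y where y: "y \<in> G" "\<And>j. \<bar>y $ j / e - i j\<bar> \<le> 1/2" by (auto simp: I_def)
      have "\<bar>real_of_int (i j)\<bar> \<le> B/e + 1" for j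
      proof -
        have "\<bar>y $ j\<bar> \<le> B" using B[OF y(1)] component_le_norm_cart[of y j] by linarith
        then have "\<bar>y $ j / e\<bar> \<le> B / e" using e by (simp add: divide_right_mono)
        then show ?thesis using y(2)[of j] by linarith
      qed
      then have "\<bar>i j\<bar> \<le> \<lceil>B/e+1\<rceil>" for j
        by (metis le_of_int_ceiling of_int_abs of_int_le_iff order_trans)
      then show "i \<in> PiE UNIV (\<lambda>_. {-\<lceil>B/e + 1\<rceil>..\<lceil>B/e+1\<rceil>})"
        by (simp add: PiE_def Pi_def abs_le_iff) (smt (verit))
    qed
    then have finI: "finite I" by (rule finite_subset) (intro finite_PiE; simp)
    define b where "b i = (- (\<chi> j. real_of_int (i j)) :: real^'n)" for i
    define f where "f i x = 1 - bump ((1/e) *\<^sub>R x + b i)" for i x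
    define \<psi> where "\<psi> x = 1 - (\<Prod>i\<in>I. f i x)" for x
    have f_smooth: "smooth_fun (f i)" for i
      unfolding f_def[abs_def] by (intro smooth_diff smooth_const smooth_affine smooth_bump)
    have f_bounds: "0 \<le> f i x" "f i x \<le> 1" for i x by (auto simp: f_def bump_bounds)
    have \<psi>_smooth: "smooth_fun \<psi>" unfolding \<psi>_def[abs_def]
      by (intro smooth_diff smooth_const smooth_prod f_smooth)
    have \<psi>_bounds: "0 \<le> \<psi> x \<and> \<psi> x \<le> 1" for x
      by (auto simp: \<psi>_def f_bounds intro!: prod_nonneg prod_le_1)
    have \<psi>_1: "\<psi> x = 1" if "x \<in> G" for x
    proof -
      \<comment> \<open>Rounding picks a grid point whose bump equals one at \<open>x\<close>, so
        its factor is zero and annihilates the product.\<close>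
      define i where "i j = round (x $ j / e)" for j
      have i: "\<bar>x $ j / e - i j\<bar> \<le> 1/2" for j
        unfolding i_def using of_int_round_abs_le[of "x $ j / e"] by (simp add: abs_minus_commute)
      then have "i \<in> I" using that by (auto simp: I_def)
      moreover have "f i x = 0" unfolding f_def
        using i by (subst bump_1) (auto simp: b_def)
      ultimately show ?thesis using finI by (auto simp: \<psi>_def prod_zero)
    qed
    have \<psi>_supp: "\<exists>y\<in>G. dist x y \<le> \<delta>" if "\<psi> x \<noteq> 0" for x
    proof -
      have "\<exists>i\<in>I. f i x \<noteq> 1" using that by (auto simp: \<psi>_def intro: ccontr prod.neutral)
      then obtain i where i: "i \<in> I" "bump ((1/e) *\<^sub>R x + b i) \<noteq> 0" by (auto simp: f_def)
      then have xi: "\<bar>x $ j / e - i j\<bar> < 1" for j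
        using bump_0[of "(1/e) *\<^sub>R x + b i" j] by (force simp: b_def)
      obtain y where y: "y \<in> G" "\<And>j. \<bar>y $ j / e - i j\<bar> \<le> 1/2" using i by (auto simp: I_def)
      have "\<bar>x $ j - y $ j\<bar> \<le> 2 * e" for j
      proof -
        have "\<bar>x $ j / e - y $ j / e\<bar> \<le> 2" using xi[of j] y(2)[of j] by linarith
        then show ?thesis using e by (simp add: field_simps abs_if split: if_splits)
      qed
      then have "norm (x - y) \<le> (\<Sum>j\<in>(UNIV::'n set). 2 * e)"
        by (intro order_trans[OF norm_le_l1_cart] sum_mono) simp
      also have "\<dots> = \<delta>" using n by (simp add: e_def n_def)
      finally show ?thesis using y(1) by (auto simp: dist_norm)
    qed
    have \<psi>_grad: "\<bar>pderiv_r \<psi> j x\<bar> \<le> C / \<delta>" for j x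
    proof -
      define J where "J = PiE UNIV (\<lambda>k. {\<lceil>x $ k / e - 1\<rceil>..\<lfloor>x $ k / e + 1\<rfloor>})"
      have "card {\<lceil>t - 1\<rceil>..\<lfloor>t + 1\<rfloor>} \<le> 3" for t :: real
      proof -
        have "\<lfloor>t\<rfloor> \<le> \<lceil>t\<rceil>" by linarith
        then show ?thesis by (simp add: nat_le_iff)
      qed
      then have cardJ: "card J \<le> 3 ^ CARD('n)"
        using prod_mono[of "UNIV::'n set" "\<lambda>k. card {\<lceil>x $ k / e - 1\<rceil>..\<lfloor>x $ k / e + 1\<rfloor>}" "\<lambda>_. 3"]
        unfolding J_def by (simp add: card_PiE)
      have finJ: "finite J" unfolding J_def by (intro finite_PiE) auto
      have fd: "pderiv_r (f i) j x = - (1/e) * pderiv_r bump j ((1/e) *\<^sub>R x + b i)" for i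
      proof -
        have "pderiv_r (f i) j x = - pderiv_r (\<lambda>x. bump ((1/e) *\<^sub>R x + b i)) j x"
          unfolding f_def[abs_def] by (intro pderiv_r_const_diff smooth_affine smooth_bump)
        also have "\<dots> = - (1/e) * pderiv_r bump j ((1/e) *\<^sub>R x + b i)"
          by (subst pderiv_r_affine) (auto intro!: smooth_differentiable smooth_bump)
        finally show ?thesis .
      qed
      have "\<bar>pderiv_r \<psi> j x\<bar> = \<bar>pderiv_r (\<lambda>x. \<Prod>i\<in>I. f i x) j x\<bar>"
      proof -
        have "pderiv_r \<psi> j x = - pderiv_r (\<lambda>x. \<Prod>i\<in>I. f i x) j x"
          unfolding \<psi>_def[abs_def] by (intro pderiv_r_const_diff smooth_prod f_smooth)
        then show ?thesis by simp
      qed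
      also have "\<dots> \<le> (\<Sum>i\<in>I. \<bar>pderiv_r (f i) j x\<bar>)"
        by (rule pderiv_r_prod_bound) (auto simp: f_smooth f_bounds abs_le_iff intro: order_trans[OF _ f_bounds(1)])
      also have "\<dots> = (\<Sum>i\<in>I \<inter> J. \<bar>pderiv_r (f i) j x\<bar>)"
      proof (rule sum.mono_neutral_right[OF finI]; (rule ballI)?)
        fix i assume "i \<in> I - I \<inter> J"
        then obtain k where "\<not> (\<lceil>x $ k / e - 1\<rceil> \<le> i k \<and> i k \<le> \<lfloor>x $ k / e + 1\<rfloor>)"
          by (auto simp: J_def PiE_def Pi_def)
        then have "\<bar>((1/e) *\<^sub>R x + b i) $ k\<bar> > 1"
          by (simp add: b_def ceiling_le_iff le_floor_iff) linarith
        then show "\<bar>pderiv_r (f i) j x\<bar> = 0" by (simp add: fd pderiv_bump_0)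
      qed blast
      also have "\<dots> \<le> (\<Sum>i\<in>I \<inter> J. M / e)"
        by (rule sum_mono) (use M e in \<open>auto simp: fd abs_mult divide_right_mono\<close>)
      also have "\<dots> \<le> 3 ^ CARD('n) * (M / e)"
      proof -
        have "card (I \<inter> J) \<le> 3 ^ CARD('n)"
          using card_mono[OF finJ, of "I \<inter> J"] cardJ by simp
        then have "real (card (I \<inter> J)) \<le> 3 ^ CARD('n)"
          using of_nat_mono[of _ _, where 'a = real] by fastforce
        then have "real (card (I \<inter> J)) * (M / e) \<le> 3 ^ CARD('n) * (M / e)"
          using M e by (intro mult_right_mono) auto
        then show ?thesis by simp
      qed
      also have "\<dots> = C / \<delta>" using n \<delta> by (simp add: C_def e_def)
      finally show ?thesis .
    qed
    show ?thesis using \<psi>_smooth \<psi>_bounds \<psi>_1 \<psi>_supp \<psi>_grad by blast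
  qed
  ultimately show ?thesis by blast
qed

section \<open>The fundamental lemma of the calculus of variations\<close>

text \<open>Cutoffs of the points of norm at most \<open>k\<close> that keep distance
  \<open>2 * d k\<close> from the complement of \<open>U\<close>, with transition width
  \<open>d k\<close>: the supports stay bounded and inside \<open>U\<close>, while every point of
  \<open>U\<close> is eventually covered.\<close>

lemma open_indicator_approx:
  fixes U :: "(real^'n) set"
  assumes "open U"
  obtains \<phi> :: "nat \<Rightarrow> real^'n \<Rightarrow> real" where
    "\<And>k. smooth_fun (\<phi> k)" "\<And>k. compact (tsupp (\<phi> k))" "\<And>k. tsupp (\<phi> k) \<subseteq> U"
    "\<And>k x. 0 \<le> \<phi> k x" "\<And>k x. \<phi> k x \<le> 1" "\<And>x. (\<lambda>k. \<phi> k x) \<longlonglongrightarrow> indicator U x"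
proof -
  obtain C where C: "\<And>(G::(real^'n) set) \<delta>. bounded G \<Longrightarrow> \<delta> > 0 \<Longrightarrow>
     (\<exists>\<psi>. smooth_fun \<psi> \<and> (\<forall>x. 0 \<le> \<psi> x \<and> \<psi> x \<le> 1) \<and> (\<forall>x\<in>G. \<psi> x = 1) \<and>
       (\<forall>x. \<psi> x \<noteq> 0 \<longrightarrow> (\<exists>y\<in>G. dist x y \<le> \<delta>)) \<and> (\<forall>j x. \<bar>pderiv_r \<psi> j x\<bar> \<le> C / \<delta>))"
    using smooth_cutoff[where 'n = 'n] by blast
  define d where "d k = 1 / (real k + 1)" for k
  have d: "d k > 0" for k by (simp add: d_def)
  define G where "G k = {x. norm x \<le> real k \<and> ball x (2 * d k) \<subseteq> U}" for k
  have bG: "bounded (G k)" for k by (auto simp: G_def bounded_iff)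
  from C[OF bG d] have "\<forall>k. \<exists>\<psi>. smooth_fun \<psi> \<and> (\<forall>x. 0 \<le> \<psi> x \<and> \<psi> x \<le> 1) \<and> (\<forall>x\<in>G k. \<psi> x = 1) \<and>
       (\<forall>x. \<psi> x \<noteq> 0 \<longrightarrow> (\<exists>y\<in>G k. dist x y \<le> d k))"
    by meson
  then obtain \<phi> where \<phi>: "\<And>k. smooth_fun (\<phi> k)" "\<And>k x. 0 \<le> \<phi> k x" "\<And>k x. \<phi> k x \<le> 1"
    "\<And>k x. x \<in> G k \<Longrightarrow> \<phi> k x = 1" "\<And>k x. \<phi> k x \<noteq> 0 \<Longrightarrow> \<exists>y\<in>G k. dist x y \<le> d k"
    by metis
  have supp: "\<exists>y\<in>G k. dist x y < 2 * d k" if xs: "x \<in> tsupp (\<phi> k)" for x k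
  proof -
    obtain z where z: "\<phi> k z \<noteq> 0" "dist z x < d k"
      using xs d[of k] unfolding tsupp_def closure_approachable by blast
    then obtain y where y: "y \<in> G k" "dist z y \<le> d k" using \<phi>(5) by blast
    have "dist x y \<le> dist z x + dist z y" by (metis dist_commute dist_triangle)
    also have "\<dots> < 2 * d k" using z y by simp
    finally show ?thesis using y by blast
  qed
  show ?thesis
  proof
    show "tsupp (\<phi> k) \<subseteq> U" for k
      using supp by (force simp: G_def dist_commute)
    then have z: "\<phi> k x = 0" if "x \<notin> U" for x k
      using that closure_subset[of "{x. \<phi> k x \<noteq> 0}"] by (auto simp: tsupp_def)
    have "norm x \<le> real k + 2 * d k" if xs: "x \<in> tsupp (\<phi> k)" for x k
    proof -
      obtain y where "y \<in> G k" "dist x y < 2 * d k" using supp[OF xs] by blast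
      then show ?thesis using norm_triangle_sub[of x y] by (auto simp: G_def dist_norm)
    qed
    then have "bounded (tsupp (\<phi> k))" for k unfolding bounded_iff by blast
    then show "compact (tsupp (\<phi> k))" for k by (simp add: compact_eq_bounded_closed tsupp_def)
    show "(\<lambda>k. \<phi> k x) \<longlonglongrightarrow> indicator U x" for x
    proof (cases "x \<in> U")
      case True
      then obtain r where r: "r > 0" "ball x r \<subseteq> U" using assms open_contains_ball by blast
      have "(\<lambda>k. 2 * d k) \<longlonglongrightarrow> 2 * 0" unfolding d_def
        by (intro tendsto_mult tendsto_const) (use LIMSEQ_inverse_real_of_nat in \<open>simp add: inverse_eq_divide add.commute\<close>)
      then have "eventually (\<lambda>k. 2 * d k < r) sequentially"
        using order_tendstoD(2)[of "\<lambda>k. 2 * d k" "2 * 0" sequentially r] r by simp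
      moreover have "eventually (\<lambda>k. norm x \<le> real k) sequentially"
        using filterlim_real_sequentially by (simp add: filterlim_at_top)
      ultimately have "eventually (\<lambda>k. \<phi> k x = 1) sequentially"
      proof eventually_elim
        case (elim k)
        then have "ball x (2 * d k) \<subseteq> U" using r subset_ball[of "2 * d k" r x] by force
        with elim show ?case by (intro \<phi>(4)) (auto simp: G_def)
      qed
      then show ?thesis using True by (simp add: tendsto_eventually)
    qed (simp add: z)
  qed (use \<phi> in auto)
qed

lemma test_fun_zero_outside: "test_fun \<Omega> \<phi> \<Longrightarrow> x \<notin> interior \<Omega> \<Longrightarrow> \<phi> x = 0"
  using closure_subset[of "{x. \<phi> x \<noteq> 0}"] by (auto simp: test_fun_def tsupp_def)

text \<open>Test functions that converge boundedly to indicators of open sets show that the integral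
  over every open set vanishes. Open sets are an intersection-stable generator of the Borel sets, so
  all Borel integrals vanish and so does the integrand almost everywhere.\<close>

lemma fundamental_lemma_variations:
  fixes g :: "(real^'n) \<Rightarrow> complex"
  assumes g: "set_integrable lborel \<Omega> g" and \<Omega>: "\<Omega> \<in> sets borel"
    and test: "\<And>\<phi>. test_fun \<Omega> \<phi> \<Longrightarrow> (LINT x:\<Omega>|lborel. g x * complex_of_real (\<phi> x)) = 0"
  shows "AE x in lborel. x \<in> interior \<Omega> \<longrightarrow> g x = 0"
proof -
  define f where "f x = indicator (interior \<Omega>) x *\<^sub>R g x" for x
  have f: "integrable lborel f"
    using set_integrable_subset[OF g, of "interior \<Omega>"] interior_subset[of \<Omega>]
    by (simp add: f_def[abs_def] set_integrable_def)
  have gi: "integrable lborel (\<lambda>x. indicator \<Omega> x *\<^sub>R g x)"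
    using g by (simp add: set_integrable_def)
  have op: "(LINT x:V|lborel. f x) = 0" if V: "open V" for V
  proof -
    obtain \<phi> where \<phi>: "\<And>k. smooth_fun (\<phi> k)" "\<And>k. compact (tsupp (\<phi> k))" "\<And>k. tsupp (\<phi> k) \<subseteq> V \<inter> interior \<Omega>"
      "\<And>k x. 0 \<le> \<phi> k x" "\<And>k x. \<phi> k x \<le> 1" "\<And>x. (\<lambda>k. \<phi> k x) \<longlonglongrightarrow> indicator (V \<inter> interior \<Omega>) x"
      using open_indicator_approx[of "V \<inter> interior \<Omega>"] V by blast
    have tf: "test_fun \<Omega> (\<phi> k)" for k using \<phi> by (auto simp: test_fun_def)
    have "(\<lambda>k. LINT x|lborel. indicator \<Omega> x *\<^sub>R (g x * complex_of_real (\<phi> k x)))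
        \<longlonglongrightarrow> (LINT x|lborel. indicator V x *\<^sub>R f x)"
    proof (rule integral_dominated_convergence)
      show "integrable lborel (\<lambda>x. norm (indicator \<Omega> x *\<^sub>R g x))" using gi by (rule integrable_norm)
      show "AE x in lborel. norm (indicator \<Omega> x *\<^sub>R (g x * complex_of_real (\<phi> k x))) \<le> norm (indicator \<Omega> x *\<^sub>R g x)" for k
        using \<phi>(4,5)[of k] by (auto simp: norm_mult indicator_def mult_left_le)
      show "AE x in lborel. (\<lambda>k. indicator \<Omega> x *\<^sub>R (g x * complex_of_real (\<phi> k x))) \<longlonglongrightarrow> indicator V x *\<^sub>R f x"
      proof (rule AE_I2)
        fix x
        have "(\<lambda>k. indicator \<Omega> x *\<^sub>R (g x * complex_of_real (\<phi> k x))) \<longlonglongrightarrow>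
           indicator \<Omega> x *\<^sub>R (g x * complex_of_real (indicator (V \<inter> interior \<Omega>) x))"
          by (intro tendsto_intros \<phi>(6))
        also have "indicator \<Omega> x *\<^sub>R (g x * complex_of_real (indicator (V \<inter> interior \<Omega>) x)) = indicator V x *\<^sub>R f x"
          using interior_subset[of \<Omega>] by (auto simp: f_def indicator_def)
        finally show "(\<lambda>k. indicator \<Omega> x *\<^sub>R (g x * complex_of_real (\<phi> k x))) \<longlonglongrightarrow> indicator V x *\<^sub>R f x" .
      qed
      show "(\<lambda>x. indicator V x *\<^sub>R f x) \<in> borel_measurable lborel"
        using f V by (intro borel_measurable_scaleR borel_measurable_indicator) auto
      have "(\<lambda>x. indicator \<Omega> x *\<^sub>R (g x * complex_of_real (\<phi> k x))) =
         (\<lambda>x. (indicator \<Omega> x *\<^sub>R g x) * complex_of_real (\<phi> k x))" for k by auto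
      moreover have "(\<lambda>x. (indicator \<Omega> x *\<^sub>R g x) * complex_of_real (\<phi> k x)) \<in> borel_measurable lborel" for k
        using gi smooth_measurable[OF \<phi>(1)[of k]] by (intro borel_measurable_times borel_measurable_of_real) auto
      ultimately show "(\<lambda>x. indicator \<Omega> x *\<^sub>R (g x * complex_of_real (\<phi> k x))) \<in> borel_measurable lborel" for k
        by metis
    qed
    moreover have "(LINT x|lborel. indicator \<Omega> x *\<^sub>R (g x * complex_of_real (\<phi> k x))) = 0" for k
      using test[OF tf] by (simp add: set_lebesgue_integral_def)
    ultimately show ?thesis
      by (simp add: set_lebesgue_integral_def LIMSEQ_const_iff)
  qed
  have meas: "A \<in> sets lborel" if "A \<in> sigma_sets UNIV {S::(real^'n) set. open S}" for A
    using that by (simp add: borel_def)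
  have all: "(LINT x:A|lborel. f x) = 0" if "A \<in> sets borel" for A
  proof -
    have "Int_stable {S::(real^'n) set. open S}" by (auto simp: Int_stable_def)
    moreover have "{S::(real^'n) set. open S} \<subseteq> Pow UNIV" by simp
    moreover have "A \<in> sigma_sets UNIV {S. open S}" using that by (simp add: borel_def)
    ultimately show ?thesis
    proof (induction rule: sigma_sets_induct_disjoint)
      case (compl A)
      have "(LINT x:A \<union> (UNIV - A)|lborel. f x) = (LINT x:A|lborel. f x) + (LINT x:(UNIV - A)|lborel. f x)"
        using f meas[OF compl(1)]
        by (intro set_integral_Un) (auto simp: set_integrable_def intro!: integrable_mult_indicator)
      moreover have "A \<union> (UNIV - A) = UNIV" by blast
      ultimately show ?case using compl op[of UNIV] by simp
    next
      case (union A)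
      then have m: "A i \<in> sets lborel" for i by (intro meas) auto
      have "(LINT x:(\<Union>i. A i)|lborel. f x) = (\<Sum>i. (LINT x:(A i)|lborel. f x))"
        using union m f
        by (intro lebesgue_integral_countable_add)
           (auto simp: disjoint_family_on_def set_integrable_def intro!: integrable_mult_indicator sets.countable_UN)
      then show ?case using union by simp
    qed (use op in auto)
  qed
  have "AE x in lborel. f x = 0"
    by (rule sigma_finite_measure.density_zero) (use f all in \<open>auto intro: sigma_finite_lborel\<close>)
  then show ?thesis by (rule AE_mp) (auto simp: f_def)
qed

section \<open>Weak gradients\<close>

lemma set_borel_measurable_add:
  fixes u v :: "(real^'n) \<Rightarrow> complex"
  assumes "set_borel_measurable lborel G u" "set_borel_measurable lborel G v"
  shows "set_borel_measurable lborel G (\<lambda>x. u x + v x)"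
  using borel_measurable_add[OF assms[unfolded set_borel_measurable_def]]
  by (simp add: set_borel_measurable_def scaleR_add_right)

lemma set_borel_measurable_mult:
  fixes u v :: "(real^'n) \<Rightarrow> complex"
  assumes "set_borel_measurable lborel G u" "set_borel_measurable lborel G v"
  shows "set_borel_measurable lborel G (\<lambda>x. u x * v x)"
proof -
  have "(\<lambda>x. indicator G x *\<^sub>R (u x * v x)) = (\<lambda>x. (indicator G x *\<^sub>R u x) * (indicator G x *\<^sub>R v x))"
    by (auto simp: indicator_def)
  then show ?thesis
    using borel_measurable_times[OF assms[unfolded set_borel_measurable_def]]
    by (simp add: set_borel_measurable_def)
qed

lemma set_borel_measurable_cnj:
  fixes u :: "(real^'n) \<Rightarrow> complex"
  assumes "set_borel_measurable lborel G u"
  shows "set_borel_measurable lborel G (\<lambda>x. cnj (u x))"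
proof -
  have "(\<lambda>x. indicator G x *\<^sub>R cnj (u x)) = (\<lambda>x. cnj (indicator G x *\<^sub>R u x))"
    by (auto simp: indicator_def)
  moreover have "cnj \<in> borel_measurable borel"
    by (intro borel_measurable_continuous_onI continuous_intros)
  ultimately show ?thesis
    using measurable_compose[OF assms[unfolded set_borel_measurable_def], of cnj borel]
    by (simp add: set_borel_measurable_def)
qed

lemma set_borel_measurable_cmod_sq:
  fixes u :: "(real^'n) \<Rightarrow> complex"
  assumes "set_borel_measurable lborel G u"
  shows "set_borel_measurable lborel G (\<lambda>x. (cmod (u x))\<^sup>2)"
proof -
  have "(\<lambda>x. indicator G x *\<^sub>R (cmod (u x))\<^sup>2) = (\<lambda>x. (cmod (indicator G x *\<^sub>R u x))\<^sup>2)"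
    by (auto simp: indicator_def)
  then show ?thesis
    using borel_measurable_power[OF measurable_compose[OF assms[unfolded set_borel_measurable_def] borel_measurable_norm], of 2]
    by (simp add: set_borel_measurable_def)
qed

lemma set_borel_measurable_continuous_complex:
  fixes u :: "(real^'n) \<Rightarrow> complex"
  assumes "G \<in> sets borel" "continuous_on G u"
  shows "set_borel_measurable lborel G u"
  using borel_measurable_continuous_on_indicator[OF assms] by (simp add: set_borel_measurable_def)

lemma set_borel_measurable_subset_borel:
  fixes u :: "(real^'n) \<Rightarrow> 'b::{banach, second_countable_topology}"
  assumes "set_borel_measurable lborel G u" "B \<in> sets borel" "B \<subseteq> G"
  shows "set_borel_measurable lborel B u"
  using set_borel_measurable_subset[of lborel G u B] assms by simp

lemma cmod_mult_le_sum_sq: "cmod (a * b) \<le> (cmod a)\<^sup>2 + (cmod b)\<^sup>2"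
proof -
  have "0 \<le> (cmod a - cmod b)\<^sup>2" "0 \<le> (cmod a)\<^sup>2" "0 \<le> (cmod b)\<^sup>2" by auto
  then have "2 * (cmod a * cmod b) \<le> (cmod a)\<^sup>2 + (cmod b)\<^sup>2" "0 \<le> (cmod a)\<^sup>2 + (cmod b)\<^sup>2"
    by (auto simp: power2_diff)
  then show ?thesis unfolding norm_mult by linarith
qed

lemma cmod_add_sq_le: "(cmod (a + b))\<^sup>2 \<le> 2 * (cmod a)\<^sup>2 + 2 * (cmod b)\<^sup>2"
proof -
  have "(cmod (a + b))\<^sup>2 \<le> (cmod a + cmod b)\<^sup>2" by (intro power_mono norm_triangle_ineq) auto
  moreover have "0 \<le> (cmod a - cmod b)\<^sup>2" by simp
  ultimately show ?thesis by (simp add: power2_sum power2_diff)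
qed

lemma L2fun_mult_integrable:
  assumes "L2fun G u" "L2fun G v"
  shows "set_integrable lborel G (\<lambda>x. u x * v x)"
proof (rule set_integrable_bound)
  show "set_integrable lborel G (\<lambda>x. (cmod (u x))\<^sup>2 + (cmod (v x))\<^sup>2)"
    using assms by (intro set_integral_add) (auto simp: L2fun_def)
  show "set_borel_measurable lborel G (\<lambda>x. u x * v x)"
    using assms by (intro set_borel_measurable_mult) (auto simp: L2fun_def)
  show "AE x in lborel. x \<in> G \<longrightarrow> norm (u x * v x) \<le> norm ((cmod (u x))\<^sup>2 + (cmod (v x))\<^sup>2)"
    using cmod_mult_le_sum_sq by (auto intro: order_trans)
qed

lemma L2fun_cnj: "L2fun G u \<Longrightarrow> L2fun G (\<lambda>x. cnj (u x))"
  by (auto simp: L2fun_def set_borel_measurable_cnj)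

lemma L2fun_add:
  assumes "L2fun G u" "L2fun G v"
  shows "L2fun G (\<lambda>x. u x + v x)"
  unfolding L2fun_def
proof
  show m: "set_borel_measurable lborel G (\<lambda>x. u x + v x)"
    using assms by (intro set_borel_measurable_add) (auto simp: L2fun_def)
  show "set_integrable lborel G (\<lambda>x. (cmod (u x + v x))\<^sup>2)"
  proof (rule set_integrable_bound)
    show "set_integrable lborel G (\<lambda>x. 2 * (cmod (u x))\<^sup>2 + 2 * (cmod (v x))\<^sup>2)"
      using assms by (intro set_integral_add set_integrable_mult_right) (auto simp: L2fun_def)
    show "AE x in lborel. x \<in> G \<longrightarrow> norm ((cmod (u x + v x))\<^sup>2) \<le> norm (2 * (cmod (u x))\<^sup>2 + 2 * (cmod (v x))\<^sup>2)"
      using cmod_add_sq_le by auto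
  qed (rule set_borel_measurable_cmod_sq[OF m])
qed

lemma L2fun_bounded_mult:
  assumes v: "L2fun G v" and m: "set_borel_measurable lborel G f"
    and M: "AE x in lborel. x \<in> G \<longrightarrow> cmod (f x) \<le> M"
  shows "L2fun G (\<lambda>x. f x * v x)"
  unfolding L2fun_def
proof
  show m': "set_borel_measurable lborel G (\<lambda>x. f x * v x)"
    using v m by (intro set_borel_measurable_mult) (auto simp: L2fun_def)
  show "set_integrable lborel G (\<lambda>x. (cmod (f x * v x))\<^sup>2)"
  proof (rule set_integrable_bound)
    show "set_integrable lborel G (\<lambda>x. M\<^sup>2 * (cmod (v x))\<^sup>2)"
      using v by (intro set_integrable_mult_right) (auto simp: L2fun_def)
    show "AE x in lborel. x \<in> G \<longrightarrow> norm ((cmod (f x * v x))\<^sup>2) \<le> norm (M\<^sup>2 * (cmod (v x))\<^sup>2)"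
      using M by (rule AE_mp) (auto simp: norm_mult power_mult_distrib intro!: mult_right_mono power_mono)
  qed (rule set_borel_measurable_cmod_sq[OF m'])
qed

lemma L2fun_cmult: "G \<in> sets borel \<Longrightarrow> L2fun G v \<Longrightarrow> L2fun G (\<lambda>x. c * v x)"
  by (rule L2fun_bounded_mult[where M = "cmod c"])
     (auto intro!: set_borel_measurable_continuous_complex)

lemma L2fun_cont_mult:
  assumes "compact G" "L2fun G v" "continuous_on G f"
  shows "L2fun G (\<lambda>x. f x * v x)"
proof -
  have "bounded (f ` G)" using assms compact_continuous_image compact_imp_bounded by blast
  then obtain M where "\<And>x. x \<in> G \<Longrightarrow> cmod (f x) \<le> M" by (auto simp: bounded_iff)
  then show ?thesis using assms
    by (intro L2fun_bounded_mult[where M = M] set_borel_measurable_continuous_complex)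
       (auto simp: borel_closed compact_imp_closed)
qed

lemma L2fun_const:
  assumes "compact G"
  shows "L2fun G (\<lambda>_. c)"
  unfolding L2fun_def
  using borel_integrable_compact[OF assms, of "\<lambda>_. (cmod c)\<^sup>2"] assms
  by (auto simp: set_integrable_def borel_closed compact_imp_closed intro!: set_borel_measurable_continuous_complex)

lemma L2fun_continuous:
  assumes "compact G" "continuous_on G f"
  shows "L2fun G f"
  using L2fun_cont_mult[OF assms(1) L2fun_const[OF assms(1), of 1] assms(2)] by simp

lemma L2fun_sum:
  assumes "compact G" "\<And>i. i \<in> I \<Longrightarrow> L2fun G (f i)"
  shows "L2fun G (\<lambda>x. \<Sum>i\<in>I. f i x)"
  using assms(2) by (induction I rule: infinite_finite_induct) (auto intro: L2fun_add L2fun_const[OF assms(1)])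

lemma L2fun_subset:
  assumes "L2fun G v" "B \<in> sets borel" "B \<subseteq> G"
  shows "L2fun B v"
  using assms set_integrable_subset[of lborel G "\<lambda>x. (cmod (v x))\<^sup>2" B]
  by (auto simp: L2fun_def intro: set_borel_measurable_subset_borel)

lemma L2fun_integrable:
  assumes "compact G" "L2fun G v"
  shows "set_integrable lborel G v"
  using L2fun_mult_integrable[OF assms(2) L2fun_const[OF assms(1), of 1]] by simp

lemma continuous_on_smooth_complex: "smooth_fun f \<Longrightarrow> continuous_on S (\<lambda>x. complex_of_real (f x))"
  by (intro continuous_on_of_real smooth_continuous)

lemma test_fun_smooth: "test_fun \<Omega> \<phi> \<Longrightarrow> smooth_fun \<phi>"
  by (simp add: test_fun_def)

lemma test_fun_mult:
  assumes "smooth_fun \<eta>" "test_fun \<Omega> \<phi>"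
  shows "test_fun \<Omega> (\<lambda>x. \<eta> x * \<phi> x)"
proof -
  have "tsupp (\<lambda>x. \<eta> x * \<phi> x) \<subseteq> tsupp \<phi>"
    unfolding tsupp_def by (intro closure_mono) auto
  moreover have "compact (tsupp (\<lambda>x. \<eta> x * \<phi> x))"
    using calculation assms(2) unfolding test_fun_def
    by (metis closed_closure closed_subset compact_Int_closed inf.absorb_iff2 inf.commute tsupp_def)
  ultimately show ?thesis using assms by (auto simp: test_fun_def smooth_mult)
qed

section \<open>Algebra of weak gradients\<close>

lemma weak_grad_add:
  assumes "compact \<Omega>" "L2fun \<Omega> u" "L2fun \<Omega> v" "is_weak_grad \<Omega> u g" "is_weak_grad \<Omega> v k"
  shows "is_weak_grad \<Omega> (\<lambda>x. u x + v x) (\<lambda>x. g x + k x)"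
  unfolding is_weak_grad_def
proof (intro conjI allI impI)
  show "L2fun \<Omega> (\<lambda>x. (g x + k x) $ j)" for j
    using assms by (auto simp: is_weak_grad_def intro: L2fun_add)
  fix \<phi> :: "real^'a \<Rightarrow> real" and j assume t: "test_fun \<Omega> \<phi>"
  have c: "continuous_on \<Omega> (\<lambda>x. complex_of_real (\<phi> x))" "continuous_on \<Omega> (\<lambda>x. complex_of_real (pderiv_r \<phi> j x))"
    by (intro continuous_on_smooth_complex smooth_pderiv test_fun_smooth[OF t])+
  have i: "set_integrable lborel \<Omega> (\<lambda>x. w x * complex_of_real (\<phi> x))"
    "set_integrable lborel \<Omega> (\<lambda>x. w x * complex_of_real (pderiv_r \<phi> j x))" if "L2fun \<Omega> w" for w
    using that c L2fun_continuous[OF assms(1)] by (auto intro: L2fun_mult_integrable)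
  have gk: "L2fun \<Omega> (\<lambda>x. g x $ j)" "L2fun \<Omega> (\<lambda>x. k x $ j)"
    using assms by (auto simp: is_weak_grad_def)
  show "(LINT x:\<Omega>|lborel. (u x + v x) * complex_of_real (pderiv_r \<phi> j x))
        = - (LINT x:\<Omega>|lborel. (g x + k x) $ j * complex_of_real (\<phi> x))"
    using assms t by (simp add: distrib_right set_integral_add i gk is_weak_grad_def)
qed

lemma weak_grad_cmult:
  assumes "compact \<Omega>" "is_weak_grad \<Omega> u g"
  shows "is_weak_grad \<Omega> (\<lambda>x. c * u x) (\<lambda>x. \<chi> j. c * g x $ j)"
  using assms
  by (auto simp: is_weak_grad_def mult.assoc borel_closed compact_imp_closed intro!: L2fun_cmult)

text \<open>\<open>\<eta> * \<phi>\<close> is again a test function. Inserting it into the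
  definition for \<open>v\<close> and moving the term with the derivative of \<open>\<eta>\<close>
  to the other side gives the product rule.\<close>

lemma weak_grad_smooth_mult:
  assumes \<Omega>: "compact \<Omega>" and v: "L2fun \<Omega> v" and g: "is_weak_grad \<Omega> v g" and \<eta>: "smooth_fun \<eta>"
  shows "is_weak_grad \<Omega> (\<lambda>x. complex_of_real (\<eta> x) * v x)
     (\<lambda>x. \<chi> j. complex_of_real (\<eta> x) * g x $ j + complex_of_real (pderiv_r \<eta> j x) * v x)"
  unfolding is_weak_grad_def
proof (intro conjI allI impI)
  have gj: "L2fun \<Omega> (\<lambda>x. g x $ j)" for j using g by (simp add: is_weak_grad_def)
  show "L2fun \<Omega> (\<lambda>x. (\<chi> j. complex_of_real (\<eta> x) * g x $ j + complex_of_real (pderiv_r \<eta> j x) * v x) $ j)" for j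
    using \<eta> by (auto intro!: L2fun_add L2fun_cont_mult \<Omega> v gj continuous_on_smooth_complex smooth_pderiv)
  fix \<phi> :: "real^'a \<Rightarrow> real" and j assume t: "test_fun \<Omega> \<phi>"
  have \<phi>: "smooth_fun \<phi>" using t by (rule test_fun_smooth)
  have i: "set_integrable lborel \<Omega> (\<lambda>x. w x * complex_of_real (f x))" if "L2fun \<Omega> w" "smooth_fun f" for w f
    by (intro L2fun_mult_integrable[OF that(1)] L2fun_continuous[OF \<Omega>] continuous_on_smooth_complex that)
  have pd: "pderiv_r (\<lambda>x. \<eta> x * \<phi> x) j x = \<eta> x * pderiv_r \<phi> j x + pderiv_r \<eta> j x * \<phi> x" for x
    using \<eta> \<phi> by (intro pderiv_r_mult smooth_differentiable)
  have aux: "P = - R" if "X = - G" "X = P + Q" "R = G + Q" for P Q R X G :: complex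
  proof -
    have "P = X - Q" using that(2) by simp
    then show ?thesis using that(1,3) by simp
  qed
  have 1: "(LINT x:\<Omega>|lborel. v x * complex_of_real (pderiv_r (\<lambda>x. \<eta> x * \<phi> x) j x))
        = - (LINT x:\<Omega>|lborel. g x $ j * complex_of_real (\<eta> x * \<phi> x))"
    using g test_fun_mult[OF \<eta> t] by (simp add: is_weak_grad_def)
  have 2: "(LINT x:\<Omega>|lborel. v x * complex_of_real (pderiv_r (\<lambda>x. \<eta> x * \<phi> x) j x))
     = (LINT x:\<Omega>|lborel. v x * complex_of_real (\<eta> x * pderiv_r \<phi> j x)) + (LINT x:\<Omega>|lborel. v x * complex_of_real (pderiv_r \<eta> j x * \<phi> x))"
    unfolding pd of_real_add distrib_left using \<eta> \<phi> v
    by (intro set_integral_add i smooth_mult smooth_pderiv)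
  have 3: "(LINT x:\<Omega>|lborel. g x $ j * complex_of_real (\<eta> x * \<phi> x) + v x * complex_of_real (pderiv_r \<eta> j x * \<phi> x))
     = (LINT x:\<Omega>|lborel. g x $ j * complex_of_real (\<eta> x * \<phi> x)) + (LINT x:\<Omega>|lborel. v x * complex_of_real (pderiv_r \<eta> j x * \<phi> x))"
    using \<eta> \<phi> v gj by (intro set_integral_add i smooth_mult smooth_pderiv)
  from aux[OF 1 2 3] have "(LINT x:\<Omega>|lborel. v x * complex_of_real (\<eta> x * pderiv_r \<phi> j x)) =
    - (LINT x:\<Omega>|lborel. g x $ j * complex_of_real (\<eta> x * \<phi> x) + v x * complex_of_real (pderiv_r \<eta> j x * \<phi> x))"
    .
  then show "(LINT x:\<Omega>|lborel. (complex_of_real (\<eta> x) * v x) * complex_of_real (pderiv_r \<phi> j x))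
        = - (LINT x:\<Omega>|lborel. (\<chi> j. complex_of_real (\<eta> x) * g x $ j + complex_of_real (pderiv_r \<eta> j x) * v x) $ j * complex_of_real (\<phi> x))"
    by (simp add: algebra_simps)
qed

text \<open>The difference of two weak gradients integrates to zero against all test functions. Test
  functions live in the interior, so agreement is obtained there; on meshes the boundary is later
  absorbed as a null set.\<close>

lemma weak_grad_unique:
  fixes \<Omega> :: "(real^'n) set"
  assumes \<Omega>: "compact \<Omega>" and g: "is_weak_grad \<Omega> v g" "is_weak_grad \<Omega> v k"
  shows "AE x in lborel. x \<in> interior \<Omega> \<longrightarrow> g x = k x"
proof -
  have "AE x in lborel. x \<in> interior \<Omega> \<longrightarrow> g x $ j - k x $ j = 0" for j
  proof (rule fundamental_lemma_variations)
    have gk: "L2fun \<Omega> (\<lambda>x. g x $ j)" "L2fun \<Omega> (\<lambda>x. k x $ j)" using g by (auto simp: is_weak_grad_def)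
    then show "set_integrable lborel \<Omega> (\<lambda>x. g x $ j - k x $ j)"
      by (intro set_integral_diff L2fun_integrable \<Omega>)
    fix \<phi> assume t: "test_fun \<Omega> \<phi>"
    have i: "set_integrable lborel \<Omega> (\<lambda>x. w x * complex_of_real (\<phi> x))" if "L2fun \<Omega> w" for w
      by (intro L2fun_mult_integrable[OF that] L2fun_continuous[OF \<Omega>] continuous_on_smooth_complex
          test_fun_smooth[OF t])
    have "- (LINT x:\<Omega>|lborel. g x $ j * complex_of_real (\<phi> x)) = - (LINT x:\<Omega>|lborel. k x $ j * complex_of_real (\<phi> x))"
      using g[unfolded is_weak_grad_def, THEN conjunct2, rule_format, OF t, of j] by simp
    then show "(LINT x:\<Omega>|lborel. (g x $ j - k x $ j) * complex_of_real (\<phi> x)) = 0"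
      using set_integral_diff(2)[OF i[OF gk(1)] i[OF gk(2)]] by (simp add: left_diff_distrib)
  qed (use \<Omega> in \<open>auto simp: borel_closed compact_imp_closed\<close>)
  then have "AE x in lborel. \<forall>j. x \<in> interior \<Omega> \<longrightarrow> g x $ j - k x $ j = 0"
    by (intro eventually_all_finite)
  then show ?thesis by (rule AE_mp) (auto simp: vec_eq_iff)
qed

lemma is_weak_grad_wgrad: "H1 \<Omega> v \<Longrightarrow> is_weak_grad \<Omega> v (wgrad \<Omega> v)"
  unfolding H1_def wgrad_def by (elim conjE exE) (rule someI[of "is_weak_grad \<Omega> v"])

lemma L2fun_wgrad: "H1 \<Omega> v \<Longrightarrow> L2fun \<Omega> (\<lambda>x. wgrad \<Omega> v x $ j)"
  using is_weak_grad_wgrad by (auto simp: is_weak_grad_def)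

text \<open>Bridge from the arbitrary choice made by \<open>wgrad\<close> to gradients computed by
  hand.\<close>

lemma wgrad_eq_AE:
  fixes \<Omega> :: "(real^'n) set"
  assumes "compact \<Omega>" "is_weak_grad \<Omega> v g"
  shows "AE x in lborel. x \<in> interior \<Omega> \<longrightarrow> wgrad \<Omega> v x = g x"
proof -
  have "is_weak_grad \<Omega> v (wgrad \<Omega> v)" unfolding wgrad_def using assms(2) by (rule someI[of "is_weak_grad \<Omega> v"])
  then show ?thesis using weak_grad_unique assms by blast
qed

section \<open>Weak gradients of Lipschitz functions\<close>

lemma integral_translate:
  fixes f :: "real^'n \<Rightarrow> complex"
  assumes "f \<in> borel_measurable borel"
  shows "(LINT x|lborel. f (c + x)) = (LINT x|lborel. f x)"
proof -
  have "(LINT x|lborel. f x) = (LINT x|distr lborel borel ((+) c). f x)"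
    by (simp add: lborel_distr_plus)
  also have "\<dots> = (LINT x|lborel. f (c + x))" using assms by (intro integral_distr) auto
  finally show ?thesis by simp
qed

lemma has_real_derivative_along_axis:
  fixes \<phi> :: "real^'n \<Rightarrow> real"
  assumes "smooth_fun \<phi>"
  shows "((\<lambda>t. \<phi> (x + t *\<^sub>R axis j 1)) has_real_derivative pderiv_r \<phi> j (x + t *\<^sub>R axis j 1)) (at t)"
proof -
  have "((\<lambda>t. x + t *\<^sub>R axis j 1) has_derivative (\<lambda>s. s *\<^sub>R axis j 1)) (at t)"
    by (auto intro!: derivative_eq_intros)
  from diff_chain_at[OF this has_derivative_pderiv_r[OF smooth_differentiable[OF assms]]]
  show ?thesis
    by (simp add: has_field_derivative_def o_def axis_def if_distrib if_distribR sum.delta mult_commute_abs cong: if_cong)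
qed

lemma test_fun_pderiv_bounded:
  assumes "test_fun \<Omega> \<phi>"
  shows "\<exists>M\<ge>0. \<forall>x. \<bar>pderiv_r \<phi> j x\<bar> \<le> M \<and> \<bar>\<phi> x\<bar> \<le> M"
proof -
  have s: "smooth_fun \<phi>" using assms by (rule test_fun_smooth)
  have K: "compact (tsupp \<phi>)" using assms by (simp add: test_fun_def)
  have "compact (pderiv_r \<phi> j ` tsupp \<phi>)" "compact (\<phi> ` tsupp \<phi>)"
    by (intro compact_continuous_image smooth_continuous smooth_pderiv s K)+
  then have "bounded (pderiv_r \<phi> j ` tsupp \<phi>)" "bounded (\<phi> ` tsupp \<phi>)"
    by (auto intro: compact_imp_bounded)
  then obtain M N where M: "\<And>x. x \<in> tsupp \<phi> \<Longrightarrow> \<bar>pderiv_r \<phi> j x\<bar> \<le> M"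
    and N: "\<And>x. x \<in> tsupp \<phi> \<Longrightarrow> \<bar>\<phi> x\<bar> \<le> N"
    by (auto simp: bounded_iff)
  have out: "pderiv_r \<phi> j x = 0 \<and> \<phi> x = 0" if "x \<notin> tsupp \<phi>" for x
  proof -
    have z: "\<phi> y = 0" if "y \<in> - tsupp \<phi>" for y
      using that closure_subset[of "{x. \<phi> x \<noteq> 0}"] by (auto simp: tsupp_def)
    have "open (- tsupp \<phi>)" by (simp add: tsupp_def open_Compl)
    moreover have "x \<in> - tsupp \<phi>" using that by simp
    ultimately have "pderiv_r \<phi> j x = pderiv_r (\<lambda>_. 0) j x"
      using z by (rule pderiv_r_local)
    then show ?thesis using z that by simp
  qed
  have "\<bar>pderiv_r \<phi> j x\<bar> \<le> \<bar>M\<bar> + \<bar>N\<bar> \<and> \<bar>\<phi> x\<bar> \<le> \<bar>M\<bar> + \<bar>N\<bar>" for x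
    using M[of x] N[of x] out[of x] by (cases "x \<in> tsupp \<phi>") auto
  then show ?thesis by (intro exI[of _ "\<bar>M\<bar> + \<bar>N\<bar>"]) auto
qed

lemma test_fun_increment_bound:
  assumes s: "smooth_fun \<phi>" and "\<And>x. \<bar>pderiv_r \<phi> j x\<bar> \<le> M"
  shows "\<bar>\<phi> (x + t *\<^sub>R axis j 1) - \<phi> x\<bar> \<le> M * \<bar>t\<bar>"
proof -
  have "norm (\<phi> (x + t *\<^sub>R axis j 1) - \<phi> (x + 0 *\<^sub>R axis j 1)) \<le> M * norm (t - 0)"
  proof (rule field_differentiable_bound[of UNIV "\<lambda>t. \<phi> (x + t *\<^sub>R axis j 1)"])
    show "((\<lambda>t. \<phi> (x + t *\<^sub>R axis j 1)) has_field_derivative pderiv_r \<phi> j (x + z *\<^sub>R axis j 1)) (at z within UNIV)" for z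
      using has_real_derivative_along_axis[OF s] by simp
    show "norm (pderiv_r \<phi> j (x + z *\<^sub>R axis j 1)) \<le> M" for z
      using assms(2) by simp
  qed auto
  then show ?thesis by simp
qed

text \<open>Difference quotients are moved from the test function onto \<open>v\<close> by translation invariance of
  the integral, which avoids integration by parts.\<close>

lemma weak_grad_of_difference_quotients:
  fixes \<Omega> :: "(real^'n) set"
  assumes \<Omega>: "compact \<Omega>"
    and lip: "\<And>x y. x \<in> \<Omega> \<Longrightarrow> y \<in> \<Omega> \<Longrightarrow> cmod (v x - v y) \<le> L * dist x y"
    and gL2: "\<And>j. L2fun \<Omega> (\<lambda>x. g x $ j)"
    and lim: "AE x in lborel. x \<in> interior \<Omega> \<longrightarrow>
      (\<forall>j. ((\<lambda>t. (v (x + t *\<^sub>R axis j 1) - v x) / complex_of_real t) \<longlongrightarrow> g x $ j) (at 0))"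
  shows "is_weak_grad \<Omega> v g"
  unfolding is_weak_grad_def
proof (intro conjI allI impI gL2)
  fix \<phi> :: "real^'n \<Rightarrow> real" and j assume t: "test_fun \<Omega> \<phi>"
  have \<phi>: "smooth_fun \<phi>" using t by (rule test_fun_smooth)
  obtain M where M: "M \<ge> 0" "\<And>x. \<bar>pderiv_r \<phi> j x\<bar> \<le> M" "\<And>x. \<bar>\<phi> x\<bar> \<le> M"
    using test_fun_pderiv_bounded[OF t, of j] by blast
  have "compact (tsupp \<phi>)" "tsupp \<phi> \<subseteq> interior \<Omega>" using t by (auto simp: test_fun_def)
  then obtain d where d: "d > 0" "(\<Union>x\<in>tsupp \<phi>. ball x d) \<subseteq> interior \<Omega>"
    by (rule compact_subset_open_imp_ball_epsilon_subset[OF _ open_interior])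
  define e :: "real^'n" where "e = axis j 1"
  have e: "norm e = 1" by (simp add: e_def norm_axis_1)
  have shift_in: "x + s *\<^sub>R e \<in> \<Omega>" if "\<phi> x \<noteq> 0" "\<bar>s\<bar> < d" for x s
  proof -
    have "x \<in> tsupp \<phi>" using that closure_subset[of "{x. \<phi> x \<noteq> 0}"] by (auto simp: tsupp_def)
    moreover have "x + s *\<^sub>R e \<in> ball x d" using that e by (simp add: dist_norm)
    ultimately show ?thesis using d interior_subset by blast
  qed
  have cont: "continuous_on \<Omega> v"
  proof (rule continuous_on_subset[OF lipschitz_on_continuous_on[of "max L 0" \<Omega> v]])
    show "lipschitz_on (max L 0) \<Omega> v"
      using lip by (intro lipschitz_onI) (auto simp: dist_norm intro!: order_trans[OF lip] mult_right_mono)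
  qed simp
  \<comment> \<open>All steps are shorter than \<open>d\<close>, the margin between the support of
    \<open>\<phi>\<close> and the complement of the interior, so shifted support points remain in
    \<open>\<Omega>\<close>.\<close>
  define s where "s k = d / (real k + 2)" for k :: nat
  have s: "s k > 0" "s k < d" for k using d by (auto simp: s_def field_simps add_strict_increasing)
  have s0: "s \<longlonglongrightarrow> 0"
  proof -
    have "(\<lambda>k. d * inverse (real (Suc (k + 1)))) \<longlonglongrightarrow> d * 0"
      by (intro tendsto_mult tendsto_const LIMSEQ_ignore_initial_segment[OF LIMSEQ_inverse_real_of_nat])
    then show ?thesis by (simp add: s_def[abs_def] inverse_eq_divide add.commute)
  qed
  \<comment> \<open>Extension by zero makes translation of the whole space available. The jump at
    the boundary stays outside the region seen by the shifted \<open>\<phi>\<close>.\<close>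
  define V where "V x = indicator \<Omega> x *\<^sub>R v x" for x
  have V: "integrable lborel V"
    unfolding V_def using \<Omega> cont by (rule borel_integrable_compact)
  then have Vm: "V \<in> borel_measurable borel" using borel_measurable_integrable by force
  have \<phi>m: "\<phi> \<in> borel_measurable borel" using \<phi> by (rule smooth_measurable)
  have shm: "(\<lambda>x. x + c) \<in> borel \<rightarrow>\<^sub>M borel" for c :: "real^'n" by simp
  define F where "F k x = V x * complex_of_real ((\<phi> (x + s k *\<^sub>R e) - \<phi> x) / s k)" for k x
  define G where "G k x = (V (x - s k *\<^sub>R e) - V x) / complex_of_real (s k) * complex_of_real (\<phi> x)" for k x
  have Vphi: "integrable lborel (\<lambda>x. V x * complex_of_real (\<phi> (x + c)))" for c
  proof (rule Bochner_Integration.integrable_bound[of _ "\<lambda>x. M * norm (V x)"])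
    show "AE x in lborel. norm (V x * complex_of_real (\<phi> (x + c))) \<le> norm (M * norm (V x))"
      using M(1) mult_right_mono[OF M(3) norm_ge_zero] by (intro AE_I2) (simp add: norm_mult mult.commute)
    show "(\<lambda>x. V x * complex_of_real (\<phi> (x + c))) \<in> borel_measurable lborel"
      using Vm measurable_compose[OF shm \<phi>m] by (intro borel_measurable_times borel_measurable_of_real) auto
  qed (use V in auto)
  have Vphi': "integrable lborel (\<lambda>x. V (x - c) * complex_of_real (\<phi> x))"
     "(LINT x|lborel. V (x - c) * complex_of_real (\<phi> x)) = (LINT x|lborel. V x * complex_of_real (\<phi> (x + c)))" for c
  proof -
    have m: "(\<lambda>x. V (x - c) * complex_of_real (\<phi> x)) \<in> borel_measurable borel"
      using measurable_compose[OF shm[of "-c"] Vm] \<phi>m by (intro borel_measurable_times borel_measurable_of_real) auto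
    show "(LINT x|lborel. V (x - c) * complex_of_real (\<phi> x)) = (LINT x|lborel. V x * complex_of_real (\<phi> (x + c)))"
      using integral_translate[OF m, of c] by (simp add: add.commute)
    have "integrable (distr lborel borel ((+) (-c))) (\<lambda>x. V x * complex_of_real (\<phi> (x + c)))"
      using Vphi[of c] by (simp add: lborel_distr_plus)
    then show "integrable lborel (\<lambda>x. V (x - c) * complex_of_real (\<phi> x))"
      by (subst (asm) integrable_distr_eq)
         (use Vphi[of c] in \<open>auto simp: algebra_simps\<close>)
  qed
  have FG: "(LINT x|lborel. F k x) = (LINT x|lborel. G k x)" for k
  proof -
    have "(LINT x|lborel. F k x) = (LINT x|lborel. (V x * complex_of_real (\<phi> (x + s k *\<^sub>R e)) - V x * complex_of_real (\<phi> (x + 0))) / complex_of_real (s k))"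
      by (intro Bochner_Integration.integral_cong) (auto simp: F_def algebra_simps diff_divide_distrib)
    also have "\<dots> = ((LINT x|lborel. V (x - s k *\<^sub>R e) * complex_of_real (\<phi> x)) - (LINT x|lborel. V (x - 0) * complex_of_real (\<phi> x))) / complex_of_real (s k)"
      unfolding Vphi'(2) by (simp only: integral_divide_zero Bochner_Integration.integral_diff[OF Vphi Vphi])
    also have "\<dots> = (LINT x|lborel. (V (x - s k *\<^sub>R e) * complex_of_real (\<phi> x) - V (x - 0) * complex_of_real (\<phi> x)) / complex_of_real (s k))"
      by (simp only: integral_divide_zero Bochner_Integration.integral_diff[OF Vphi'(1) Vphi'(1)])
    also have "\<dots> = (LINT x|lborel. G k x)"
      by (intro Bochner_Integration.integral_cong) (auto simp: G_def algebra_simps diff_divide_distrib)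
    finally show ?thesis .
  qed
  have Fm: "F k \<in> borel_measurable lborel" for k
    unfolding F_def using Vm \<phi>m measurable_compose[OF shm \<phi>m]
    by (intro borel_measurable_times borel_measurable_of_real borel_measurable_divide borel_measurable_diff) auto
  have Gm: "G k \<in> borel_measurable lborel" for k
    unfolding G_def using Vm \<phi>m measurable_compose[OF shm[of "- s k *\<^sub>R e"] Vm]
    by (intro borel_measurable_times borel_measurable_of_real borel_measurable_divide borel_measurable_diff) auto
  have pdm: "pderiv_r \<phi> j \<in> borel_measurable borel" using \<phi> by (intro smooth_measurable smooth_pderiv)
  have s_at: "filterlim s (at 0) sequentially" "filterlim (\<lambda>k. - s k) (at 0) sequentially"
  proof -
    have ns: "s k \<noteq> 0" for k using s(1)[of k] by simp
    show "filterlim s (at 0) sequentially"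
      unfolding filterlim_at using s0 ns by simp
    have "(\<lambda>k. - s k) \<longlonglongrightarrow> 0" using tendsto_minus[OF s0] by simp
    then show "filterlim (\<lambda>k. - s k) (at 0) sequentially"
      unfolding filterlim_at using ns by simp
  qed
  have limF: "(\<lambda>k. LINT x|lborel. F k x) \<longlonglongrightarrow> (LINT x|lborel. V x * complex_of_real (pderiv_r \<phi> j x))"
  proof (rule integral_dominated_convergence)
    show "integrable lborel (\<lambda>x. M * norm (V x))" using V by auto
    show "AE x in lborel. norm (F k x) \<le> M * norm (V x)" for k
    proof (rule AE_I2)
      fix x
      have "\<bar>\<phi> (x + s k *\<^sub>R e) - \<phi> x\<bar> \<le> M * s k"
        using test_fun_increment_bound[OF \<phi> M(2), of x "s k"] s(1)[of k] by (simp add: e_def)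
      then have "\<bar>(\<phi> (x + s k *\<^sub>R e) - \<phi> x) / s k\<bar> \<le> M" using s(1)[of k] by (simp add: field_simps)
      then show "norm (F k x) \<le> M * norm (V x)"
        unfolding F_def norm_mult norm_of_real by (metis mult.commute mult_right_mono norm_ge_zero)
    qed
    show "AE x in lborel. (\<lambda>k. F k x) \<longlonglongrightarrow> V x * complex_of_real (pderiv_r \<phi> j x)"
    proof (rule AE_I2)
      fix x
      have "((\<lambda>h. (\<phi> (x + h *\<^sub>R e) - \<phi> x) / h) \<longlongrightarrow> pderiv_r \<phi> j x) (at 0)"
        using has_real_derivative_along_axis[OF \<phi>, of x j 0] by (simp add: DERIV_def e_def)
      from filterlim_compose[OF this s_at(1)]
      show "(\<lambda>k. F k x) \<longlonglongrightarrow> V x * complex_of_real (pderiv_r \<phi> j x)"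
        unfolding F_def by (intro tendsto_mult tendsto_const tendsto_of_real)
    qed
    show "(\<lambda>x. V x * complex_of_real (pderiv_r \<phi> j x)) \<in> borel_measurable lborel"
      using Vm pdm by (intro borel_measurable_times borel_measurable_of_real) auto
  qed (rule Fm)
  \<comment> \<open>Moving the shift from \<open>\<phi>\<close> to \<open>v\<close> reverses its
    direction, which produces the minus sign. The Lipschitz bound supplies the integrable
    majorant.\<close>
  have limG: "(\<lambda>k. LINT x|lborel. G k x) \<longlonglongrightarrow> (LINT x|lborel. - (indicator \<Omega> x *\<^sub>R (g x $ j * complex_of_real (\<phi> x))))"
  proof (rule integral_dominated_convergence)
    show "integrable lborel (\<lambda>x. indicator \<Omega> x *\<^sub>R (\<bar>L\<bar> * M))"
      by (rule borel_integrable_compact[OF \<Omega>]) simp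
    show "AE x in lborel. norm (G k x) \<le> indicator \<Omega> x *\<^sub>R (\<bar>L\<bar> * M)" for k
    proof (rule AE_I2)
      fix x
      show "norm (G k x) \<le> indicator \<Omega> x *\<^sub>R (\<bar>L\<bar> * M)"
      proof (cases "\<phi> x = 0")
        case False
        have i: "x \<in> \<Omega>" "x - s k *\<^sub>R e \<in> \<Omega>"
          using shift_in[OF False, of 0] shift_in[OF False, of "- s k"] d s[of k] by simp_all
        have "cmod (v (x - s k *\<^sub>R e) - v x) \<le> L * s k"
          using lip[OF i(2,1)] s(1)[of k] e by (simp add: dist_norm)
        also have "\<dots> \<le> \<bar>L\<bar> * s k" using s(1)[of k] by (intro mult_right_mono) auto
        finally have "cmod ((v (x - s k *\<^sub>R e) - v x) / complex_of_real (s k)) \<le> \<bar>L\<bar>"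
          using s(1)[of k] by (simp add: norm_divide field_simps)
        then have "cmod ((v (x - s k *\<^sub>R e) - v x) / complex_of_real (s k)) * \<bar>\<phi> x\<bar> \<le> \<bar>L\<bar> * M"
          using M by (intro mult_mono) auto
        then show ?thesis using i by (simp add: G_def V_def norm_mult norm_divide)
      qed (use M in \<open>simp add: G_def\<close>)
    qed
    show "AE x in lborel. (\<lambda>k. G k x) \<longlonglongrightarrow> - (indicator \<Omega> x *\<^sub>R (g x $ j * complex_of_real (\<phi> x)))"
      using lim
    proof (rule AE_mp, intro AE_I2 impI)
      fix x assume lx: "x \<in> interior \<Omega> \<longrightarrow>
        (\<forall>j. ((\<lambda>t. (v (x + t *\<^sub>R axis j 1) - v x) / complex_of_real t) \<longlongrightarrow> g x $ j) (at 0))"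
      show "(\<lambda>k. G k x) \<longlonglongrightarrow> - (indicator \<Omega> x *\<^sub>R (g x $ j * complex_of_real (\<phi> x)))"
      proof (cases "\<phi> x = 0")
        case True
        then show ?thesis by (simp add: G_def)
      next
        case False
        then have x: "x \<in> interior \<Omega>" using test_fun_zero_outside[OF t] by blast
        then have xO: "x \<in> \<Omega>" using interior_subset by blast
        from x have "((\<lambda>t. (v (x + t *\<^sub>R e) - v x) / complex_of_real t) \<longlongrightarrow> g x $ j) (at 0)"
          using lx by (simp add: e_def)
        from filterlim_compose[OF this s_at(2)]
        have "(\<lambda>k. (v (x - s k *\<^sub>R e) - v x) / complex_of_real (- s k)) \<longlonglongrightarrow> g x $ j" by simp
        then have "(\<lambda>k. - ((v (x - s k *\<^sub>R e) - v x) / complex_of_real (- s k)) * complex_of_real (\<phi> x)) \<longlonglongrightarrow> - (g x $ j) * complex_of_real (\<phi> x)"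
          by (intro tendsto_mult tendsto_const tendsto_minus)
        moreover have "- ((v (x - s k *\<^sub>R e) - v x) / complex_of_real (- s k)) * complex_of_real (\<phi> x) = G k x" for k
        proof -
          have "x - s k *\<^sub>R e \<in> \<Omega>" using shift_in[OF False, of "- s k"] s[of k] by simp
          then show ?thesis using xO by (simp add: G_def V_def)
        qed
        ultimately have "(\<lambda>k. G k x) \<longlonglongrightarrow> - (g x $ j) * complex_of_real (\<phi> x)" by (simp only:)
        then show ?thesis using xO by simp
      qed
    qed
    show "(\<lambda>x. - (indicator \<Omega> x *\<^sub>R (g x $ j * complex_of_real (\<phi> x)))) \<in> borel_measurable lborel"
      using set_borel_measurable_mult[of \<Omega> "\<lambda>x. g x $ j" "\<lambda>x. complex_of_real (\<phi> x)"] gL2[of j]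
        set_borel_measurable_continuous_complex[OF _ continuous_on_smooth_complex[OF \<phi>], of \<Omega>] \<Omega>
      by (simp add: L2fun_def set_borel_measurable_def borel_closed compact_imp_closed)
  qed (rule Gm)
  have "(LINT x|lborel. V x * complex_of_real (pderiv_r \<phi> j x)) = - (LINT x|lborel. indicator \<Omega> x *\<^sub>R (g x $ j * complex_of_real (\<phi> x)))"
    using LIMSEQ_unique[OF limF limG[folded FG]] by simp
  then show "(LINT x:\<Omega>|lborel. v x * complex_of_real (pderiv_r \<phi> j x))
        = - (LINT x:\<Omega>|lborel. g x $ j * complex_of_real (\<phi> x))"
    by (simp add: set_lebesgue_integral_def V_def)
qed

lemma weak_grad_one:
  assumes "compact \<Omega>"
  shows "is_weak_grad \<Omega> (\<lambda>_. 1) (\<lambda>_. 0)"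
  by (rule weak_grad_of_difference_quotients[OF assms, of _ 0]) (auto simp: L2fun_const[OF assms])

text \<open>Each summand is a smooth multiple of the constant one, whose weak gradient is zero, so
  the product rule covers smooth functions as well.\<close>

lemma weak_grad_smooth_sum:
  fixes B :: "'i \<Rightarrow> real^'n \<Rightarrow> real"
  assumes \<Omega>: "compact \<Omega>" and "finite I" and B: "\<And>i. i \<in> I \<Longrightarrow> smooth_fun (B i)"
  shows "is_weak_grad \<Omega> (\<lambda>x. \<Sum>i\<in>I. a i * complex_of_real (B i x))
     (\<lambda>x. \<chi> j. \<Sum>i\<in>I. a i * complex_of_real (pderiv_r (B i) j x))"
  using assms(2,3)
proof (induction I)
  case empty
  have "is_weak_grad \<Omega> (\<lambda>x. 0 * 1) (\<lambda>x. \<chi> j. 0 * 0 $ j)"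
    by (rule weak_grad_cmult[OF \<Omega> weak_grad_one[OF \<Omega>]])
  then show ?case by simp
next
  case (insert i I)
  have w: "is_weak_grad \<Omega> (\<lambda>x. a i * (complex_of_real (B i x) * 1))
     (\<lambda>x. \<chi> j. a i * (\<chi> j. complex_of_real (B i x) * 0 $ j + complex_of_real (pderiv_r (B i) j x) * 1) $ j)"
    using insert.prems by (intro weak_grad_cmult weak_grad_smooth_mult weak_grad_one \<Omega> L2fun_const) auto
  have c: "L2fun \<Omega> (\<lambda>x. a k * complex_of_real (B k x))" if "k \<in> insert i I" for k
    by (intro L2fun_continuous[OF \<Omega>] continuous_intros continuous_on_smooth_complex insert.prems that)
  have "is_weak_grad \<Omega> (\<lambda>x. a i * complex_of_real (B i x) + (\<Sum>i\<in>I. a i * complex_of_real (B i x)))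
    (\<lambda>x. (\<chi> j. a i * complex_of_real (pderiv_r (B i) j x)) + (\<chi> j. \<Sum>i\<in>I. a i * complex_of_real (pderiv_r (B i) j x)))"
    using w insert c by (intro weak_grad_add \<Omega> L2fun_sum) auto
  moreover have "(\<lambda>x. (\<chi> j. a i * complex_of_real (pderiv_r (B i) j x)) + (\<chi> j. \<Sum>i\<in>I. a i * complex_of_real (pderiv_r (B i) j x)))
     = (\<lambda>x. \<chi> j. \<Sum>i\<in>insert i I. a i * complex_of_real (pderiv_r (B i) j x))"
    using insert by (auto simp: vec_eq_iff)
  ultimately show ?case using insert by simp
qed

section \<open>Simplicial meshes and affine functions\<close>

lemma mesh_simplex: "conforming_mesh \<Omega> (\<T>::(real^'n) set set) \<Longrightarrow> T \<in> \<T> \<Longrightarrow> int CARD('n) simplex T"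
  and mesh_finite: "conforming_mesh \<Omega> \<T> \<Longrightarrow> finite \<T>"
  and mesh_Union: "conforming_mesh \<Omega> \<T> \<Longrightarrow> \<Union>\<T> = \<Omega>"
  and mesh_nonempty: "conforming_mesh \<Omega> \<T> \<Longrightarrow> \<T> \<noteq> {}"
  and mesh_face: "conforming_mesh \<Omega> \<T> \<Longrightarrow> T \<in> \<T> \<Longrightarrow> T' \<in> \<T> \<Longrightarrow> (T \<inter> T') face_of T"
    "conforming_mesh \<Omega> \<T> \<Longrightarrow> T \<in> \<T> \<Longrightarrow> T' \<in> \<T> \<Longrightarrow> (T \<inter> T') face_of T'"
  unfolding conforming_mesh_def by blast+

lemma mesh_element:
  assumes "conforming_mesh \<Omega> (\<T>::(real^'n) set set)" "T \<in> \<T>"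
  shows "compact T" "convex T" "closed T" "T \<in> sets borel" "bounded T" "T \<subseteq> \<Omega>"
    "interior T \<noteq> {}" "rel_interior T = interior T" "closure (interior T) = T"
proof -
  note s = mesh_simplex[OF assms]
  show c: "compact T" "convex T" using compact_simplex[OF s] convex_simplex[OF s] .
  then show cl: "closed T" "bounded T" by (auto simp: compact_imp_closed compact_imp_bounded)
  then show "T \<in> sets borel" by simp
  show "T \<subseteq> \<Omega>" using mesh_Union[OF assms(1)] assms(2) by blast
  have d: "aff_dim T = int CARD('n)" using aff_dim_simplex[OF s] .
  then show r: "rel_interior T = interior T" using interior_rel_interior_gen[of T] by simp
  have "T \<noteq> {}" using d by auto
  then show i: "interior T \<noteq> {}" using r rel_interior_eq_empty[OF c(2)] by simp
  show "closure (interior T) = T" using convex_closure_interior[OF c(2) i] cl by simp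
qed

text \<open>A face of \<open>T\<close> that contains a relative interior point of \<open>T\<close>
  is all of \<open>T\<close>. So \<open>T\<close> is a face of \<open>T'\<close>; a proper face
  would lie in the relative boundary of \<open>T'\<close>, yet the interior of \<open>T\<close> lies
  in the interior of \<open>T'\<close>.\<close>

lemma mesh_eq_of_interior:
  assumes M: "conforming_mesh \<Omega> (\<T>::(real^'n) set set)" and T: "T \<in> \<T>" "T' \<in> \<T>"
    and x: "x \<in> interior T" "x \<in> T'"
  shows "T = T'"
proof -
  have "x \<in> T \<inter> T'" "x \<in> rel_interior T"
    using x interior_subset mesh_element(8)[OF M T(1)] by auto
  then have TT: "T \<inter> T' = T"
    using face_of_subset_rel_boundary[OF mesh_face(1)[OF M T]] by blast
  show ?thesis
  proof (rule ccontr)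
    assume "T \<noteq> T'"
    then have "T \<subseteq> T' - rel_interior T'"
      using face_of_subset_rel_boundary[OF mesh_face(2)[OF M T]] TT by simp
    moreover have "x \<in> rel_interior T'"
      using x(1) TT interior_mono[of T T'] mesh_element(8)[OF M T(2)] by blast
    ultimately show False using x interior_subset by blast
  qed
qed

lemma AE_not_in_frontier_convex:
  fixes S :: "(real^'n) set"
  assumes "convex S"
  shows "AE x in lborel. x \<notin> frontier S"
proof -
  have "frontier S \<in> null_sets lborel"
    using negligible_convex_frontier[OF assms] null_sets_completion_iff[of "frontier S" lborel]
    by (simp add: negligible_iff_null_sets)
  then show ?thesis by (rule AE_not_in)
qed

text \<open>Frontiers of convex sets are null sets and there are finitely many elements, so
  pointwise arguments may be restricted to element interiors.\<close>

lemma AE_mesh_interior: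
  assumes "conforming_mesh \<Omega> (\<T>::(real^'n) set set)"
  shows "AE x in lborel. \<forall>T\<in>\<T>. x \<in> T \<longrightarrow> x \<in> interior T"
proof -
  have "AE x in lborel. x \<in> T \<longrightarrow> x \<in> interior T" if "T \<in> \<T>" for T
    using AE_not_in_frontier_convex[OF mesh_element(2)[OF assms that]]
    by (rule AE_mp) (use closure_subset in \<open>auto simp: frontier_def\<close>)
  then show ?thesis using mesh_finite[OF assms] by (intro AE_finite_allI) auto
qed

section \<open>Complex affine functions on simplices\<close>

definition affine_fun :: "(real^'n \<Rightarrow> complex) \<Rightarrow> bool" where
  "affine_fun f \<longleftrightarrow> (\<exists>a (b::complex^'n). \<forall>x. f x = a + (\<Sum>j\<in>UNIV. b $ j * complex_of_real (x $ j)))"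

lemma affine_fun_combination:
  assumes "affine_fun f" "u + v = 1"
  shows "f (u *\<^sub>R x + v *\<^sub>R y) = complex_of_real u * f x + complex_of_real v * f y"
proof -
  obtain a and b :: "complex^'a" where f: "\<And>x. f x = a + (\<Sum>j\<in>UNIV. b $ j * complex_of_real (x $ j))"
    using assms by (auto simp: affine_fun_def)
  have "f (u *\<^sub>R x + v *\<^sub>R y) = complex_of_real (u + v) * a + (\<Sum>j\<in>UNIV. b $ j * complex_of_real (u * x $ j + v * y $ j))"
    using assms(2) by (simp add: f)
  also have "\<dots> = complex_of_real u * f x + complex_of_real v * f y"
    unfolding f by (simp add: algebra_simps sum.distrib sum_distrib_left)
  finally show ?thesis .
qed

text \<open>The set of agreement is convex, because affine functions respect convex
  combinations.\<close>

lemma affine_fun_eq_on_hull: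
  assumes "affine_fun f" "affine_fun g" "\<And>z. z \<in> S \<Longrightarrow> f z = g z" "x \<in> convex hull S"
  shows "f x = g x"
proof -
  have "convex {x. f x = g x}"
    using assms by (auto simp: convex_def affine_fun_combination)
  then have "convex hull S \<subseteq> {x. f x = g x}" using assms by (intro hull_minimal) auto
  then show ?thesis using assms by blast
qed

lemma affine_fun_bound_on_hull:
  assumes "affine_fun f" "\<And>z. z \<in> S \<Longrightarrow> cmod (f z) \<le> M" "x \<in> convex hull S"
  shows "cmod (f x) \<le> M"
proof -
  have "convex {x. cmod (f x) \<le> M}"
  proof (clarsimp simp: convex_def affine_fun_combination[OF assms(1)])
    fix x y and u v :: real
    assume a: "cmod (f x) \<le> M" "cmod (f y) \<le> M" "0 \<le> u" "0 \<le> v" "u + v = 1"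
    have "cmod (complex_of_real u * f x + complex_of_real v * f y) \<le> u * cmod (f x) + v * cmod (f y)"
      using a norm_triangle_ineq[of "complex_of_real u * f x" "complex_of_real v * f y"] by (simp add: norm_mult)
    also have "\<dots> \<le> u * M + v * M" using a by (intro add_mono mult_left_mono)
    also have "\<dots> = M" using a by (simp flip: distrib_right)
    finally show "cmod (complex_of_real u * f x + complex_of_real v * f y) \<le> M" .
  qed
  then have "convex hull S \<subseteq> {x. cmod (f x) \<le> M}" using assms by (intro hull_minimal) auto
  then show ?thesis using assms by blast
qed

lemma affine_fun_continuous: "affine_fun f \<Longrightarrow> continuous_on S f"
  unfolding affine_fun_def
  by (elim exE, rule continuous_on_eq[rotated]) (auto intro!: continuous_intros)

lemma affine_fun_zero: "affine_fun (\<lambda>_. 0)"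
  unfolding affine_fun_def by (rule exI[of _ 0], rule exI[of _ 0]) simp

lemma affine_fun_add:
  assumes "affine_fun f" "affine_fun g"
  shows "affine_fun (\<lambda>x. f x + g x)"
proof -
  obtain a b c d where "\<And>x. f x = a + (\<Sum>j\<in>UNIV. b $ j * complex_of_real (x $ j))"
     "\<And>x. g x = c + (\<Sum>j\<in>UNIV. d $ j * complex_of_real (x $ j))"
    using assms unfolding affine_fun_def by metis
  then show ?thesis unfolding affine_fun_def
    by (intro exI[of _ "a + c"] exI[of _ "b + d"]) (simp add: sum.distrib distrib_right)
qed

lemma affine_fun_cmult:
  assumes "affine_fun f"
  shows "affine_fun (\<lambda>x. c * f x)"
proof -
  obtain a b where "\<And>x. f x = a + (\<Sum>j\<in>UNIV. b $ j * complex_of_real (x $ j))"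
    using assms unfolding affine_fun_def by metis
  then show ?thesis unfolding affine_fun_def
    by (intro exI[of _ "c * a"] exI[of _ "\<chi> j. c * b $ j"]) (simp add: sum_distrib_left algebra_simps)
qed

lemma affine_fun_sum: "(\<And>i. i \<in> I \<Longrightarrow> affine_fun (f i)) \<Longrightarrow> affine_fun (\<lambda>x. \<Sum>i\<in>I. f i x)"
  by (induction I rule: infinite_finite_induct) (auto intro: affine_fun_add affine_fun_zero)

text \<open>Relative to one point \<open>p\<close>, affine independence becomes linear independence
  of the differences, and a linear map may be prescribed on an independent set.\<close>

lemma affine_fun_interpolate:
  fixes C :: "(real^'n) set"
  assumes "\<not> affine_dependent C"
  shows "\<exists>f. affine_fun f \<and> (\<forall>z\<in>C. f z = g z)"
proof (cases "C = {}")
  case True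
  then show ?thesis using affine_fun_zero by auto
next
  case False
  then obtain p where p: "p \<in> C" by blast
  then have "independent ((\<lambda>x. - p + x) ` (C - {p}))"
    using assms affine_dependent_iff_dependent2[OF p] by simp
  from linear_independent_extend[OF this, of "\<lambda>y. g (p + y) - g p"]
  obtain f where f: "linear f" "\<And>z. z \<in> C - {p} \<Longrightarrow> f (- p + z) = g z - g p" by auto
  interpret f: linear f by fact
  have rep: "f x = (\<Sum>j\<in>UNIV. (\<chi> j. f (axis j 1)) $ j * complex_of_real (x $ j))" for x
  proof -
    have "f x = f (\<Sum>j\<in>UNIV. x $ j *\<^sub>R axis j 1)"
      using basis_expansion[of x] by (simp add: scalar_mult_eq_scaleR)
    also have "\<dots> = (\<Sum>j\<in>UNIV. (\<chi> j. f (axis j 1)) $ j * complex_of_real (x $ j))"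
      by (simp add: f.sum f.scaleR) (simp add: scaleR_conv_of_real mult.commute)
    finally show ?thesis .
  qed
  show ?thesis
  proof (intro exI[of _ "\<lambda>x. (g p - f p) + f x"] conjI ballI)
    show "affine_fun (\<lambda>x. g p - f p + f x)" unfolding affine_fun_def
      by (intro exI[of _ "g p - f p"] exI[of _ "\<chi> j. f (axis j 1)"] allI) (metis rep)
    fix z assume "z \<in> C"
    then show "g p - f p + f z = g z"
      using f(2)[of z] by (cases "z = p") (auto simp: f.diff algebra_simps)
  qed
qed

text \<open>Vertices are encoded as extreme points, for which passing to a face is simple: the
  extreme points of a face are those of the set that lie in the face.\<close>

definition verts :: "(real^'n) set \<Rightarrow> (real^'n) set" where
  "verts T = {z. z extreme_point_of T}"

lemma mesh_verts:
  assumes "conforming_mesh \<Omega> (\<T>::(real^'n) set set)" "T \<in> \<T>"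
  shows "finite (verts T)" "card (verts T) = CARD('n) + 1" "\<not> affine_dependent (verts T)"
    "T = convex hull (verts T)" "verts T \<subseteq> T"
proof -
  obtain C where C: "\<not> affine_dependent C" "int (card C) = int CARD('n) + 1" "T = convex hull C"
    using mesh_simplex[OF assms] by (auto simp: simplex_def)
  have v: "verts T = C"
    using C by (auto simp: verts_def extreme_point_of_convex_hull_affine_independent)
  show "finite (verts T)" "card (verts T) = CARD('n) + 1" "\<not> affine_dependent (verts T)"
    "T = convex hull (verts T)" using C v by (auto intro: aff_independent_finite)
  then show "verts T \<subseteq> T" using hull_subset by metis
qed

text \<open>The intersection is a compact convex common face, hence the hull of its extreme points,
  and these are the vertices shared by both elements.\<close>

lemma mesh_Int_hull:
  assumes M: "conforming_mesh \<Omega> (\<T>::(real^'n) set set)" and T: "T \<in> \<T>" "T' \<in> \<T>"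
  shows "T \<inter> T' = convex hull (verts T \<inter> verts T')"
proof -
  have "T \<inter> T' = convex hull {z. z extreme_point_of (T \<inter> T')}"
    using mesh_element[OF M T(1)] mesh_element[OF M T(2)]
    by (intro Krein_Milman_Minkowski compact_Int convex_Int)
  also have "{z. z extreme_point_of (T \<inter> T')} = verts T \<inter> verts T'"
  proof -
    have "z \<in> S" if "z extreme_point_of S" for z and S :: "(real^'n) set"
      using that by (simp add: extreme_point_of_def)
    then show ?thesis
      using extreme_point_of_face[OF mesh_face(1)[OF M T]] extreme_point_of_face[OF mesh_face(2)[OF M T]]
      unfolding verts_def by blast
  qed
  finally show ?thesis .
qed

lemma Vh_affine:
  assumes "v \<in> Vh \<Omega> \<T>" "T \<in> \<T>"
  obtains f where "affine_fun f" "\<And>x. x \<in> T \<Longrightarrow> v x = f x"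
proof -
  obtain a b where ab: "\<And>x. x \<in> T \<Longrightarrow> v x = a + (\<Sum>j\<in>UNIV. b $ j * complex_of_real (x $ j))"
    using assms unfolding Vh_def by blast
  show ?thesis
    by (rule that[of "\<lambda>x. a + (\<Sum>j\<in>UNIV. b $ j * complex_of_real (x $ j))"])
       (use ab in \<open>auto simp: affine_fun_def\<close>)
qed

text \<open>Element interpolants agree on every intersection, since it is the hull of shared
  vertices. The glued function is continuous as the cover by elements is finite and closed.\<close>

lemma Vh_interpolate:
  assumes M: "conforming_mesh \<Omega> (\<T>::(real^'n) set set)"
  shows "\<exists>q\<in>Vh \<Omega> \<T>. \<forall>T\<in>\<T>. \<forall>z\<in>verts T. q z = g z"
proof -
  have "\<forall>T\<in>\<T>. \<exists>f. affine_fun f \<and> (\<forall>z\<in>verts T. f z = g z)"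
    using affine_fun_interpolate mesh_verts(3)[OF M] by blast
  then obtain F where F: "\<And>T. T \<in> \<T> \<Longrightarrow> affine_fun (F T)" "\<And>T z. T \<in> \<T> \<Longrightarrow> z \<in> verts T \<Longrightarrow> F T z = g z"
    by metis
  \<comment> \<open>The choice of element does not influence the value, as the interpolants agree
    wherever elements meet.\<close>
  define q where "q x = F (SOME T. T \<in> \<T> \<and> x \<in> T) x" for x
  have q: "q x = F T x" if T: "T \<in> \<T>" "x \<in> T" for T x
  proof -
    define T' where "T' = (SOME T. T \<in> \<T> \<and> x \<in> T)"
    have T': "T' \<in> \<T> \<and> x \<in> T'" unfolding T'_def by (rule someI[of _ T]) (use T in simp)
    then have "x \<in> T' \<inter> T" using T by simp
    then have "x \<in> convex hull (verts T' \<inter> verts T)"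
      unfolding mesh_Int_hull[OF M conjunct1[OF T'] T(1)] .
    moreover have "F T' z = F T z" if "z \<in> verts T' \<inter> verts T" for z
      using F(2)[OF conjunct1[OF T']] F(2)[OF T(1)] that by simp
    ultimately have "F T' x = F T x"
      using affine_fun_eq_on_hull[OF F(1)[OF conjunct1[OF T']] F(1)[OF T(1)]] by metis
    then show ?thesis by (simp add: q_def T'_def)
  qed
  have "continuous_on (\<Union>T\<in>\<T>. T) q"
  proof (rule continuous_on_closed_Union)
    show "continuous_on T q" if "T \<in> \<T>" for T
      using affine_fun_continuous[OF F(1)[OF that], of T] q[OF that] by (simp cong: continuous_on_cong)
  qed (use mesh_finite[OF M] mesh_element(3)[OF M] in auto)
  then have "q \<in> Vh \<Omega> \<T>"
    unfolding Vh_def using mesh_Union[OF M] F(1) q by (fastforce simp: affine_fun_def)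
  moreover have "q z = g z" if "T \<in> \<T>" "z \<in> verts T" for T z
    using that q F mesh_verts(5)[OF M] by (metis subsetD)
  ultimately show ?thesis by blast
qed

text \<open>The right-hand side of the corrector equation involves the weak gradient of
  \<open>v\<close>. A piecewise affine function on a convex domain is globally Lipschitz, so
  difference quotients identify its weak gradient with the elementwise slopes.\<close>

lemma Vh_H1:
  fixes \<Omega> :: "(real^'n) set"
  assumes M: "conforming_mesh \<Omega> \<T>" and \<Omega>: "compact \<Omega>" "convex \<Omega>" and v: "v \<in> Vh \<Omega> \<T>"
  shows "H1 \<Omega> v"
proof -
  have "\<forall>T\<in>\<T>. \<exists>a (b::complex^'n). \<forall>x\<in>T. v x = a + (\<Sum>j\<in>UNIV. b $ j * complex_of_real (x $ j))"
    using v by (simp add: Vh_def)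
  then obtain a and b :: "(real^'n) set \<Rightarrow> complex^'n"
    where ab: "\<And>T x. T \<in> \<T> \<Longrightarrow> x \<in> T \<Longrightarrow> v x = a T + (\<Sum>j\<in>UNIV. b T $ j * complex_of_real (x $ j))"
    by metis
  define L where "L = (\<Sum>T\<in>\<T>. \<Sum>j\<in>UNIV. cmod (b T $ j))"
  have fin: "finite \<T>" using mesh_finite[OF M] .
  have L0: "L \<ge> 0" by (auto simp: L_def intro!: sum_nonneg)
  have lipT: "cmod (v x - v y) \<le> L * dist x y" if "T \<in> \<T>" "x \<in> T" "y \<in> T" for T x y
  proof -
    have "v x - v y = (\<Sum>j\<in>UNIV. b T $ j * complex_of_real ((x - y) $ j))"
      using that by (simp add: ab sum_subtractf algebra_simps)
    then have "cmod (v x - v y) \<le> (\<Sum>j\<in>UNIV. cmod (b T $ j * complex_of_real ((x - y) $ j)))"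
      by (simp add: norm_sum)
    also have "\<dots> \<le> (\<Sum>j\<in>UNIV. cmod (b T $ j) * dist x y)"
      unfolding norm_mult norm_of_real dist_norm by (intro sum_mono mult_left_mono component_le_norm_cart) auto
    also have "\<dots> = (\<Sum>j\<in>UNIV. cmod (b T $ j)) * dist x y" by (simp add: sum_distrib_right)
    also have "\<dots> \<le> L * dist x y" unfolding L_def
      by (intro mult_right_mono member_le_sum that fin) (auto intro: sum_nonneg)
    finally show ?thesis .
  qed
  have lip: "cmod (v x - v y) \<le> L * dist x y" if xy: "x \<in> \<Omega>" "y \<in> \<Omega>" for x y
  proof -
    define p where "p t = x + t *\<^sub>R (y - x)" for t
    have pd: "dist (p s) (p t) = dist s t * dist x y" for s t
    proof -
      have "p s - p t = (s - t) *\<^sub>R (y - x)" by (simp add: p_def algebra_simps)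
      then show ?thesis by (simp add: dist_norm norm_minus_commute)
    qed
    \<comment> \<open>The preimages of the elements under the segment are closed and cover the unit
      interval, on each of which the Lipschitz bound holds; convexity of \<open>\<Omega>\<close>
      keeps the segment inside.\<close>
    have "lipschitz_on (L * dist x y) {0..1} (\<lambda>t. v (p t))"
    proof (rule lipschitz_on_closed_Union[of \<T> _ "\<lambda>T. p -` T"])
      show "lipschitz_on (L * dist x y) (p -` T) (\<lambda>t. v (p t))" if "T \<in> \<T>" for T
      proof (rule lipschitz_onI)
        fix s t assume "s \<in> p -` T" "t \<in> p -` T"
        then have "cmod (v (p s) - v (p t)) \<le> L * dist (p s) (p t)" using lipT[OF that] by simp
        then show "dist (v (p s)) (v (p t)) \<le> L * dist x y * dist s t"
          by (simp add: dist_norm[of "v (p s)"] pd mult_ac)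
      qed (use L0 in simp)
      show "closed (p -` T)" if "T \<in> \<T>" for T
        by (rule closed_vimage) (use mesh_element(3)[OF M that] in \<open>auto simp: p_def intro!: continuous_intros\<close>)
      have "p t \<in> \<Omega>" if "0 \<le> t" "t \<le> 1" for t
      proof -
        have "p t = (1 - t) *\<^sub>R x + t *\<^sub>R y" by (simp add: p_def algebra_simps)
        then show ?thesis using convexD[OF \<Omega>(2) xy, of "1 - t" t] that by simp
      qed
      then show "{0..1} \<subseteq> (\<Union>T\<in>\<T>. p -` T)" using mesh_Union[OF M] by auto
    qed (use fin L0 in auto)
    from lipschitz_onD[OF this, of 0 1] show ?thesis by (simp add: p_def dist_norm)
  qed
  \<comment> \<open>The slope of the unique element whose interior contains \<open>x\<close>; on the
    null set outside these interiors the value is zero.\<close>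
  define g where "g x = (\<chi> j. \<Sum>T\<in>\<T>. indicator (interior T) x *\<^sub>R b T $ j)" for x
  have gT: "g x = b T" if "T \<in> \<T>" "x \<in> interior T" for T x
  proof -
    have "indicator (interior T') x = (if T' = T then 1 else 0 :: real)" if "T' \<in> \<T>" for T'
      using mesh_eq_of_interior[OF M \<open>T \<in> \<T>\<close> that \<open>x \<in> interior T\<close>] \<open>x \<in> interior T\<close> interior_subset
      by (auto simp: indicator_def)
    then have "(\<Sum>T'\<in>\<T>. indicator (interior T') x *\<^sub>R b T' $ j) = (\<Sum>T'\<in>\<T>. if T' = T then b T $ j else 0)" for j
      by (intro sum.cong) auto
    then show ?thesis using fin that by (simp add: g_def vec_eq_iff)
  qed
  have "is_weak_grad \<Omega> v g"
  proof (rule weak_grad_of_difference_quotients[OF \<Omega>(1) lip])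
    show "L2fun \<Omega> (\<lambda>x. g x $ j)" for j
    proof -
      have "L2fun \<Omega> (\<lambda>x. indicator (interior T) x *\<^sub>R b T $ j)" for T
      proof -
        have "L2fun \<Omega> (\<lambda>x. complex_of_real (indicator (interior T) x) * b T $ j)"
        proof (rule L2fun_bounded_mult[OF L2fun_const[OF \<Omega>(1)], of _ 1])
          have "(\<lambda>x. indicator \<Omega> x *\<^sub>R complex_of_real (indicator (interior T) x)) \<in> borel_measurable borel"
            using \<Omega>(1) by (intro borel_measurable_scaleR borel_measurable_of_real borel_measurable_indicator)
              (auto simp: borel_closed compact_imp_closed)
          then show "set_borel_measurable lborel \<Omega> (\<lambda>x. complex_of_real (indicator (interior T) x))"
            by (simp add: set_borel_measurable_def)
        qed (auto simp: indicator_def)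
        then show ?thesis by (simp add: scaleR_conv_of_real)
      qed
      then show ?thesis unfolding g_def by (simp add: L2fun_sum[OF \<Omega>(1)])
    qed
    show "AE x in lborel. x \<in> interior \<Omega> \<longrightarrow>
      (\<forall>j. ((\<lambda>t. (v (x + t *\<^sub>R axis j 1) - v x) / complex_of_real t) \<longlongrightarrow> g x $ j) (at 0))"
      using AE_mesh_interior[OF M]
    proof (rule AE_mp, intro AE_I2 impI allI)
      fix x j assume x: "\<forall>T\<in>\<T>. x \<in> T \<longrightarrow> x \<in> interior T" "x \<in> interior \<Omega>"
      then obtain T where T: "T \<in> \<T>" "x \<in> interior T"
        using mesh_Union[OF M] interior_subset[of \<Omega>] by blast
      have "((\<lambda>t. x + t *\<^sub>R axis j 1) \<longlongrightarrow> x + 0 *\<^sub>R axis j 1) (at 0)" by (intro tendsto_intros)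
      then have "((\<lambda>t. x + t *\<^sub>R axis j 1) \<longlongrightarrow> x) (at 0)" by simp
      then have "eventually (\<lambda>t. x + t *\<^sub>R axis j 1 \<in> interior T) (at 0)"
        using T by (intro topological_tendstoD) auto
      moreover have "eventually (\<lambda>t. t \<noteq> 0) (at (0::real))" by (simp add: eventually_at_filter)
      ultimately have "eventually (\<lambda>t. (v (x + t *\<^sub>R axis j 1) - v x) / complex_of_real t = g x $ j) (at 0)"
      proof eventually_elim
        case (elim t)
        have "v (x + t *\<^sub>R axis j 1) - v x = (\<Sum>i\<in>UNIV. b T $ i * complex_of_real ((t *\<^sub>R axis j 1) $ i))"
          using ab[OF T(1), of x] ab[OF T(1), of "x + t *\<^sub>R axis j 1"] T elim interior_subset[of T]
          by (simp add: subset_iff algebra_simps sum.distrib)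
        also have "\<dots> = b T $ j * complex_of_real t"
          by (simp add: axis_def if_distrib sum.delta cong: if_cong)
        finally show ?case using elim gT[OF T] by simp
      qed
      then show "((\<lambda>t. (v (x + t *\<^sub>R axis j 1) - v x) / complex_of_real t) \<longlongrightarrow> g x $ j) (at 0)"
        by (rule tendsto_eventually)
    qed
  qed
  moreover have "L2fun \<Omega> v" using v \<Omega> by (intro L2fun_continuous) (auto simp: Vh_def)
  ultimately show ?thesis by (auto simp: H1_def)
qed

section \<open>Element layers\<close>

text \<open>Combinatorial counterpart of \<open>patch_pow\<close>: families of closed elements
  instead of open regions, so that energies become finite sums over elements.\<close>

primrec layers :: "(real^'n) set set \<Rightarrow> (real^'n) set \<Rightarrow> nat \<Rightarrow> (real^'n) set set" where
  "layers \<T> T 0 = {T}"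
| "layers \<T> T (Suc l) = {K \<in> \<T>. K \<inter> \<Union>(layers \<T> T l) \<noteq> {}}"

lemma layers_subset: "T \<in> \<T> \<Longrightarrow> layers \<T> T l \<subseteq> \<T>"
  by (cases l) auto

lemma layers_mono:
  assumes M: "conforming_mesh \<Omega> \<T>" and T: "T \<in> \<T>" and "l \<le> m"
  shows "layers \<T> T l \<subseteq> layers \<T> T m"
proof (rule lift_Suc_mono_le[OF _ \<open>l \<le> m\<close>])
  fix k
  show "layers \<T> T k \<subseteq> layers \<T> T (Suc k)"
  proof
    fix K assume K: "K \<in> layers \<T> T k"
    then have "K \<in> \<T>" using layers_subset[OF T] by blast
    moreover have "K \<noteq> {}" using mesh_element(7)[OF M \<open>K \<in> \<T>\<close>] by auto
    ultimately show "K \<in> layers \<T> T (Suc k)" using K by auto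
  qed
qed

text \<open>Every element is the closure of its interior, so the interior taken in
  \<open>patch\<close> loses nothing once the next patch takes the closure.\<close>

lemma closure_interior_Union_mesh:
  assumes M: "conforming_mesh \<Omega> \<T>" and F: "F \<subseteq> \<T>"
  shows "closure (interior (\<Union>F)) = \<Union>F"
proof
  have "closed (\<Union>F)"
    using F mesh_finite[OF M] mesh_element(3)[OF M] by (intro closed_Union) (auto intro: finite_subset)
  then show "closure (interior (\<Union>F)) \<subseteq> \<Union>F" by (simp add: closure_minimal interior_subset)
  show "\<Union>F \<subseteq> closure (interior (\<Union>F))"
  proof
    fix x assume "x \<in> \<Union>F"
    then obtain K where K: "K \<in> F" "x \<in> K" by blast
    then have "x \<in> closure (interior K)" using mesh_element(9)[OF M] F by auto
    moreover have "interior K \<subseteq> interior (\<Union>F)" using K by (intro interior_mono) auto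
    ultimately show "x \<in> closure (interior (\<Union>F))" using closure_mono by blast
  qed
qed

text \<open>\<open>patch\<close> depends only on the closure of its argument, which allows induction
  on closures. The second identity starts at \<open>l = 1\<close>, since the zeroth iterate is the
  closed element itself and not its interior.\<close>

lemma patch_pow_layers:
  assumes M: "conforming_mesh \<Omega> \<T>" and T: "T \<in> \<T>"
  shows "closure (patch_pow \<T> l T) = \<Union>(layers \<T> T l)"
    and "l \<ge> 1 \<Longrightarrow> patch_pow \<T> l T = interior (\<Union>(layers \<T> T l))"
proof -
  have step: "patch_pow \<T> (Suc l) T = interior (\<Union>(layers \<T> T (Suc l)))"
    if "closure (patch_pow \<T> l T) = \<Union>(layers \<T> T l)" for l
    using that by (simp add: patch_pow_def patch_def)
  have cl: "closure (patch_pow \<T> l T) = \<Union>(layers \<T> T l)" for l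
  proof (induction l)
    case 0
    then show ?case using mesh_element(3)[OF M T] by (simp add: patch_pow_def)
  next
    case (Suc l)
    show ?case unfolding step[OF Suc] using closure_interior_Union_mesh[OF M layers_subset[OF T]] .
  qed
  show "closure (patch_pow \<T> l T) = \<Union>(layers \<T> T l)" by (rule cl)
  show "patch_pow \<T> l T = interior (\<Union>(layers \<T> T l))" if "l \<ge> 1"
    using step[OF cl] that by (cases l) auto
qed

section \<open>Counting elements at distance comparable to the mesh size\<close>

lemma mesh_dist_le:
  assumes M: "conforming_mesh \<Omega> (\<T>::(real^'n) set set)" and T: "T \<in> \<T>" and "x \<in> T" "y \<in> T"
  shows "dist x y \<le> mesh_size \<T>"
proof -
  have "dist x y \<le> diameter T" using mesh_element(5)[OF M T] assms by (intro diameter_bounded_bound)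
  also have "\<dots> \<le> mesh_size \<T>" unfolding mesh_size_def using mesh_finite[OF M] T by (intro Max_ge) auto
  finally show ?thesis .
qed

lemma mesh_size_pos:
  assumes M: "conforming_mesh \<Omega> (\<T>::(real^'n) set set)"
  shows "mesh_size \<T> > 0"
proof -
  obtain T where T: "T \<in> \<T>" using mesh_nonempty[OF M] by blast
  then obtain x r where r: "r > 0" "ball x r \<subseteq> interior T"
    using mesh_element(7)[OF M] open_interior open_contains_ball by (metis ex_in_conv)
  define y where "y = x + (r/2) *\<^sub>R axis undefined 1"
  have d: "dist x y = r/2" using r by (simp add: y_def dist_norm norm_axis_1)
  then have "x \<in> T" "y \<in> T" using r interior_subset[of T] by (auto simp: subset_iff)
  from mesh_dist_le[OF M T this] show ?thesis using d r by simp
qed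

text \<open>\<open>inradius\<close> is a supremum. Halving the lower bound given by shape regularity
  and quasi-uniformity makes it strict, so some admissible ball exceeds it.\<close>

lemma mesh_inner_ball:
  assumes M: "conforming_mesh \<Omega> (\<T>::(real^'n) set set)" and T: "T \<in> \<T>"
    and reg: "shape_regular \<sigma> \<T>" "quasi_uniform \<rho> \<T>" "\<sigma> > 0" "\<rho> > 0"
  obtains x where "ball x (\<rho> * mesh_size \<T> / (2 * \<sigma>)) \<subseteq> T"
proof -
  have "\<rho> * mesh_size \<T> \<le> \<sigma> * inradius T"
    using reg T unfolding shape_regular_def quasi_uniform_def by (meson order_trans)
  then have "\<rho> * mesh_size \<T> / \<sigma> \<le> inradius T"
    using reg by (simp add: divide_le_eq mult.commute)
  moreover have "\<rho> * mesh_size \<T> / (2 * \<sigma>) < \<rho> * mesh_size \<T> / \<sigma>"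
    using reg mesh_size_pos[OF M] by (simp add: field_simps)
  ultimately have lt: "\<rho> * mesh_size \<T> / (2 * \<sigma>) < Sup {r. \<exists>x. ball x r \<subseteq> T}"
    by (simp add: inradius_def)
  have "{r. \<exists>x. ball x r \<subseteq> T} \<noteq> {}"
  proof
    assume "{r. \<exists>x. ball x r \<subseteq> T} = {}"
    moreover have "0 \<in> {r. \<exists>x. ball x r \<subseteq> T}" by simp
    ultimately show False by simp
  qed
  from less_cSupD[OF this lt]
  obtain r x where r: "\<rho> * mesh_size \<T> / (2 * \<sigma>) < r" "ball x r \<subseteq> T" by auto
  then have "ball x (\<rho> * mesh_size \<T> / (2 * \<sigma>)) \<subseteq> T"
    using subset_ball[of "\<rho> * mesh_size \<T> / (2 * \<sigma>)" r x] by force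
  then show thesis by (rule that)
qed

text \<open>Volume packing: the inner balls of radius \<open>r = \<rho> * h / (2 * \<sigma>)\<close>
  are disjoint and lie in a ball of radius \<open>3 * h\<close>, and the ratio of the radii is
  \<open>6 * \<sigma> / \<rho>\<close>.\<close>

lemma mesh_card_near:
  assumes M: "conforming_mesh \<Omega> (\<T>::(real^'n) set set)"
    and reg: "shape_regular \<sigma> \<T>" "quasi_uniform \<rho> \<T>" "\<sigma> > 0" "\<rho> > 0"
  shows "real (card {K \<in> \<T>. K \<inter> cball x (mesh_size \<T>) \<noteq> {}}) \<le> (6 * \<sigma> / \<rho>) ^ CARD('n)"
proof -
  define h where "h = mesh_size \<T>"
  have h: "h > 0" using mesh_size_pos[OF M] by (simp add: h_def)
  define r where "r = \<rho> * h / (2 * \<sigma>)"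
  have r: "r > 0" using h reg by (simp add: r_def)
  define S where "S = {K \<in> \<T>. K \<inter> cball x h \<noteq> {}}"
  have finS: "finite S" using mesh_finite[OF M] by (simp add: S_def)
  have "\<forall>K\<in>\<T>. \<exists>c. ball c r \<subseteq> K" using mesh_inner_ball[OF M _ reg] unfolding r_def h_def by metis
  then obtain c where c: "\<And>K. K \<in> \<T> \<Longrightarrow> ball (c K) r \<subseteq> K" by metis
  then have ci: "ball (c K) r \<subseteq> interior K" if "K \<in> \<T>" for K using that by (simp add: interior_maximal)
  have disj: "disjoint_family_on (\<lambda>K. ball (c K) r) S"
    unfolding disjoint_family_on_def
  proof (intro ballI impI)
    fix K K' assume K: "K \<in> S" "K' \<in> S" "K \<noteq> K'"
    then have "K \<in> \<T>" "K' \<in> \<T>" by (auto simp: S_def)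
    then show "ball (c K) r \<inter> ball (c K') r = {}"
      using ci[of K] c[of K'] mesh_eq_of_interior[OF M, of K K'] K(3) by blast
  qed
  have sub: "ball (c K) r \<subseteq> ball x (3 * h)" if kS: "K \<in> S" for K
  proof
    fix y assume "y \<in> ball (c K) r"
    moreover have KT: "K \<in> \<T>" using kS by (simp add: S_def)
    ultimately have "y \<in> K" using c by blast
    obtain z where z: "z \<in> K" "dist x z \<le> h" using kS by (auto simp: S_def)
    have "dist x y \<le> dist x z + dist z y" by (rule dist_triangle)
    also have "\<dots> \<le> h + h" using z mesh_dist_le[OF M KT z(1) \<open>y \<in> K\<close>] by (simp add: h_def)
    finally show "y \<in> ball x (3 * h)" using h by simp
  qed
  define b where "b = measure lborel (ball (0::real^'n) 1)"
  have b: "b > 0" unfolding b_def by (rule content_ball_pos) simp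
  have "real (card S) * (r ^ CARD('n) * b) = (\<Sum>K\<in>S. measure lborel (ball (c K) r))"
    using r content_ball_conv_unit_ball[of r "c _"] by (simp add: b_def)
  also have "\<dots> = measure lborel (\<Union>K\<in>S. ball (c K) r)"
    by (rule measure_finite_Union[symmetric]) (use finS disj emeasure_lborel_ball_finite in \<open>auto simp: less_top\<close>)
  also have "\<dots> \<le> measure lborel (ball x (3 * h))"
    by (rule measure_mono_fmeasurable)
       (use sub finS emeasure_lborel_ball_finite[of x "3 * h"] in \<open>auto intro!: borel_open simp: fmeasurable_def less_top\<close>)
  also have "\<dots> = (3 * h) ^ CARD('n) * b"
    using h content_ball_conv_unit_ball[of "3 * h" x] by (simp add: b_def)
  finally have "real (card S) * r ^ CARD('n) \<le> (3 * h) ^ CARD('n)" using b by simp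
  moreover have "3 * h = (6 * \<sigma> / \<rho>) * r" using reg by (simp add: r_def field_simps)
  ultimately have "real (card S) * r ^ CARD('n) \<le> (6 * \<sigma> / \<rho>) ^ CARD('n) * r ^ CARD('n)"
    by (simp only: power_mult_distrib)
  then show ?thesis using r by (simp add: S_def h_def)
qed

text \<open>A segment of length at most \<open>h\<close> meets at most \<open>N\<close> elements; by connectedness every step
  through the layers picks up a new one of them until all have been reached.\<close>

lemma layers_reach:
  assumes M: "conforming_mesh \<Omega> (\<T>::(real^'n) set set)" and \<Omega>: "convex \<Omega>"
    and reg: "shape_regular \<sigma> \<T>" "quasi_uniform \<rho> \<T>" "\<sigma> > 0" "\<rho> > 0"
    and N: "(6 * \<sigma> / \<rho>) ^ CARD('n) \<le> real N"
    and T: "T \<in> \<T>" and x: "x \<in> \<Union>(layers \<T> T l)" and y: "y \<in> K" "K \<in> \<T>"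
    and d: "dist x y \<le> mesh_size \<T>"
  shows "K \<in> layers \<T> T (l + N)"
proof -
  define s where "s = closed_segment x y"
  define S where "S = {K \<in> \<T>. K \<inter> s \<noteq> {}}"
  have finS: "finite S" using mesh_finite[OF M] by (simp add: S_def)
  have "x \<in> \<Omega>" "y \<in> \<Omega>" using x y layers_subset[OF T] mesh_Union[OF M] by blast+
  then have s\<Omega>: "s \<subseteq> \<Omega>" using \<Omega> by (simp add: s_def closed_segment_subset)
  have "s \<subseteq> cball x (mesh_size \<T>)"
    unfolding s_def by (rule closed_segment_subset) (use d mesh_size_pos[OF M] in auto)
  then have "S \<subseteq> {K \<in> \<T>. K \<inter> cball x (mesh_size \<T>) \<noteq> {}}" by (auto simp: S_def)
  then have "card S \<le> card {K \<in> \<T>. K \<inter> cball x (mesh_size \<T>) \<noteq> {}}"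
    using mesh_finite[OF M] by (intro card_mono) auto
  then have cS: "card S \<le> N" using mesh_card_near[OF M reg, of x] N by linarith
  define A where "A k = S \<inter> layers \<T> T (l + k)" for k
  have A_mono: "A j \<subseteq> A k" if "j \<le> k" for j k
    using layers_mono[OF M T, of "l + j" "l + k"] that by (auto simp: A_def)
  have closedA: "closed (\<Union>F)" if "F \<subseteq> S" for F
    using that finS mesh_element(3)[OF M] by (intro closed_Union) (auto simp: S_def intro: finite_subset)
  obtain K0 where K0: "K0 \<in> layers \<T> T l" "x \<in> K0" using x by blast
  have A0: "K0 \<in> A 0" using K0 layers_subset[OF T, of l] by (auto simp: A_def S_def s_def)
  have step: "card (A k) < card (A (Suc k))" if ne: "A k \<noteq> S" for k
  proof -
    have "A k \<subseteq> S" by (auto simp: A_def)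
    \<comment> \<open>Otherwise the reached and the remaining elements would split the segment into
      two disjoint nonempty closed parts.\<close>
    have "\<exists>p\<in>s. p \<in> \<Union>(A k) \<and> p \<in> \<Union>(S - A k)"
    proof (rule ccontr)
      assume no: "\<not> ?thesis"
      have "s \<subseteq> \<Union>(A k) \<union> \<Union>(S - A k)"
      proof
        fix p assume p: "p \<in> s"
        then obtain J where "J \<in> \<T>" "p \<in> J" using s\<Omega> mesh_Union[OF M] by blast
        then have "J \<in> S" using p by (auto simp: S_def)
        then show "p \<in> \<Union>(A k) \<union> \<Union>(S - A k)" using \<open>p \<in> J\<close> by blast
      qed
      moreover have "\<Union>(A k) \<inter> s \<noteq> {}"
        using A0 A_mono[of 0 k] K0 by (auto simp: s_def)
      moreover have "\<Union>(S - A k) \<inter> s \<noteq> {}"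
        using ne \<open>A k \<subseteq> S\<close> by (auto simp: S_def)
      moreover have "connected s" by (simp add: s_def)
      ultimately show False
        using no closedA[OF \<open>A k \<subseteq> S\<close>] closedA[of "S - A k"] unfolding connected_closed by blast
    qed
    then obtain p J J' where "J \<in> A k" "p \<in> J" "J' \<in> S - A k" "p \<in> J'" by blast
    then have "J' \<in> A (Suc k)" "J' \<notin> A k" by (auto simp: A_def S_def)
    then have "A k \<subset> A (Suc k)" using A_mono[of k "Suc k"] by auto
    then show ?thesis using finS by (intro psubset_card_mono) (auto simp: A_def)
  qed
  \<comment> \<open>For \<open>k = N\<close> the second alternative contradicts
    \<open>card S \<le> N\<close>, so all elements on the segment have been reached.\<close>
  have "A k = S \<or> card (A k) \<ge> k + 1" for k
  proof (induction k)
    case 0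
    have "card (A 0) > 0" using A0 finS by (auto simp: card_gt_0_iff A_def)
    then show ?case by simp
  next
    case (Suc k)
    show ?case
    proof (cases "A k = S")
      case True
      then show ?thesis using A_mono[of k "Suc k"] by (auto simp: A_def)
    next
      case False
      then show ?thesis using Suc step[OF False] by auto
    qed
  qed
  from this[of N] have "A N = S"
  proof
    assume "card (A N) \<ge> N + 1"
    moreover have "card (A N) \<le> card S" using finS by (intro card_mono) (auto simp: A_def)
    ultimately show ?thesis using cS by simp
  qed
  moreover have "K \<in> S" using y by (auto simp: S_def s_def)
  ultimately show ?thesis by (auto simp: A_def)
qed

section \<open>Bubble functions\<close>

text \<open>The option type indexes the affine functions: \<open>None\<close> for the constant,
  \<open>Some j\<close> for a coordinate, \<open>CARD('n) + 1\<close> in total.\<close>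

fun affine_basis :: "'n option \<Rightarrow> real^'n \<Rightarrow> real" where
  "affine_basis None y = 1"
| "affine_basis (Some j) y = y $ j"

lemma smooth_affine_basis: "smooth_fun (affine_basis i)"
proof (cases i)
  case None
  then have "affine_basis i = (\<lambda>_. 1)" by auto
  then show ?thesis by simp
next
  case (Some j)
  then have "affine_basis i = (\<lambda>y. y $ j)" by auto
  then show ?thesis by (simp add: smooth_coord)
qed

definition reflect :: "'n \<Rightarrow> real^'n \<Rightarrow> real^'n" where
  "reflect j x = (\<chi> k. if k = j then - x $ k else x $ k)"

text \<open>A reflection is a diagonal linear map with entries of modulus one, so the change of
  variables has density one.\<close>

lemma integral_reflect:
  fixes f :: "real^'n \<Rightarrow> real"
  assumes f: "f \<in> borel_measurable borel"
  shows "(LINT x|lborel. f (reflect j x)) = (LINT x|lborel. f x)"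
proof -
  define c where "c b = (if b = axis j 1 then -1 else 1 :: real)" for b :: "real^'n"
  define T where "T x = 0 + (\<Sum>b\<in>Basis. (c b * (x \<bullet> b)) *\<^sub>R b)" for x :: "real^'n"
  have T: "T = reflect j"
  proof
    fix x
    have "T x $ k = T x \<bullet> axis k 1" for k by (simp add: inner_axis)
    moreover have "T x \<bullet> axis k 1 = c (axis k 1) * (x \<bullet> axis k 1)" for k
      by (simp add: T_def inner_sum_left_Basis)
    moreover have "(axis k 1 = (axis j 1 :: real^'n)) \<longleftrightarrow> k = j" for k by (simp add: axis_eq_axis)
    ultimately have "T x $ k = reflect j x $ k" for k
      by (simp add: reflect_def c_def inner_axis)
    then show "T x = reflect j x" by (simp add: vec_eq_iff)
  qed
  have m: "T \<in> borel \<rightarrow>\<^sub>M borel"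
    unfolding T_def by (intro borel_measurable_continuous_onI continuous_intros)
  have "(\<Prod>b\<in>Basis. \<bar>c b\<bar>) = 1" by (intro prod.neutral) (simp add: c_def)
  then have "lborel = density (distr lborel borel T) (\<lambda>_. ennreal 1)"
    using lborel_affine_euclidean[of c 0] by (simp add: c_def T_def[abs_def])
  then have L: "lborel = distr lborel borel T" by (simp add: density_1)
  have "(LINT x|lborel. f x) = (LINT x|distr lborel borel T. f x)" using L by simp
  also have "\<dots> = (LINT x|lborel. f (T x))" using m f by (intro integral_distr) auto
  finally show ?thesis by (simp add: T)
qed

lemma bump_reflect: "bump (reflect j x) = bump x"
  unfolding bump_def reflect_def by (intro prod.cong) (auto simp: plateau_even)

lemma bump_integrable:
  fixes f :: "real^'n \<Rightarrow> real"
  assumes "continuous_on UNIV f"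
  shows "integrable lborel (\<lambda>y. bump y * f y)"
proof -
  have "integrable lborel (\<lambda>y. indicator (cbox (-1) 1) y *\<^sub>R (bump y * f y))"
    by (intro borel_integrable_compact compact_cbox continuous_on_mult
        smooth_continuous[OF smooth_bump] continuous_on_subset[OF assms subset_UNIV])
  moreover have "indicator (cbox (-1) 1) y *\<^sub>R (bump y * f y) = bump y * f y" for y
  proof (cases "y \<in> cbox (-1) 1")
    case False
    then obtain j where "\<not> (- 1 \<le> y $ j \<and> y $ j \<le> 1)" by (auto simp: mem_box_cart)
    then have "\<bar>y $ j\<bar> \<ge> 1" by linarith
    then show ?thesis using bump_0 by (metis mult_zero_left scaleR_zero_right)
  qed simp
  ultimately show ?thesis by (simp only:)
qed

text \<open>Diagonal entries of the Gram matrix of \<open>affine_basis\<close> in the inner product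
  weighted by \<open>bump\<close>.\<close>

definition bump_moment :: "'n::finite option \<Rightarrow> real" where
  "bump_moment i = (LINT y|lborel. bump y * (affine_basis i y * affine_basis i y))"

lemma bump_moment_pos: "bump_moment (i :: 'n::finite option) > 0"
proof -
  \<comment> \<open>On this cube \<open>bump\<close> equals one and every squared basis function is
    at least \<open>1/16\<close>, which bounds the moment from below.\<close>
  define Q where "Q = cbox (vec (1/4)) (vec (1/2) :: real^'n)"
  have Q: "measure lborel Q > 0"
  proof -
    have "measure lborel Q = (\<Prod>i\<in>(UNIV::'n set). 1/2 - 1/4)"
      unfolding Q_def by (subst content_cbox_cart) (auto simp: mem_box_cart ex_in_conv[symmetric] intro: exI[of _ "vec (1/2)"])
    then show ?thesis by simp
  qed
  have c: "continuous_on UNIV (\<lambda>y::real^'n. affine_basis i y * affine_basis i y)"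
    by (intro continuous_intros smooth_continuous smooth_affine_basis)
  have "0 < 1/16 * measure lborel Q" using Q by simp
  also have "\<dots> = (LINT y|lborel. indicator Q y *\<^sub>R (1/16))"
    by (simp add: Q_def)
  also have "\<dots> \<le> bump_moment i"
    unfolding bump_moment_def
  proof (rule integral_mono)
    show "integrable lborel (\<lambda>y. indicator Q y *\<^sub>R (1/16::real))"
      unfolding Q_def by (rule borel_integrable_compact) auto
    fix y :: "real^'n"
    show "indicator Q y *\<^sub>R (1/16) \<le> bump y * (affine_basis i y * affine_basis i y)"
    proof (cases "y \<in> Q")
      case True
      then have y: "1/4 \<le> y $ j" "y $ j \<le> 1/2" for j by (auto simp: Q_def mem_box_cart)
      have "\<bar>y $ j\<bar> \<le> 1/2" for j using y[of j] by linarith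
      then have "bump y = 1" by (rule bump_1)
      moreover have "1/16 \<le> affine_basis i y * affine_basis i y"
      proof (cases i)
        case (Some j)
        then show ?thesis using mult_mono[OF y(1)[of j] y(1)[of j]] by (simp add: y(1) order_trans[OF _ y(1)])
      qed simp
      ultimately show ?thesis using True by simp
    qed (simp add: bump_bounds)
  qed (rule bump_integrable[OF c])
  finally show ?thesis .
qed

text \<open>Two distinct basis functions differ in some coordinate that occurs in exactly one of
  them. Reflecting it flips the sign of the product and preserves \<open>bump\<close>.\<close>

lemma bump_orthogonal:
  fixes i k :: "'n::finite option"
  assumes "i \<noteq> k"
  shows "(LINT y|lborel. bump y * (affine_basis i y * affine_basis k y)) = 0"
proof -
  obtain j where j: "\<And>y. affine_basis i (reflect j y) * affine_basis k (reflect j y) = - (affine_basis i y * affine_basis k y)"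
  proof (cases i)
    case None
    then obtain m where "k = Some m" using assms by (cases k) auto
    then show ?thesis using that[of m] None by (simp add: reflect_def)
  next
    case (Some m)
    then show ?thesis using that[of m] assms by (cases k) (auto simp: reflect_def)
  qed
  let ?f = "\<lambda>y. bump y * (affine_basis i y * affine_basis k y)"
  have "?f \<in> borel_measurable borel"
    by (intro smooth_measurable smooth_mult smooth_bump smooth_affine_basis)
  from integral_reflect[OF this, of j]
  have "(LINT y|lborel. ?f y) = (LINT y|lborel. - ?f y)" by (simp add: bump_reflect j)
  then show ?thesis by simp
qed

text \<open>As the weighted Gram matrix is diagonal, division by its diagonal entries already yields
  the basis dual to \<open>affine_basis\<close>.\<close>

definition bubble :: "'n::finite option \<Rightarrow> real^'n \<Rightarrow> real" where
  "bubble i y = bump y * ((1 / bump_moment i) * affine_basis i y)"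

lemma smooth_bubble: "smooth_fun (bubble i)"
  unfolding bubble_def[abs_def] by (intro smooth_mult smooth_bump smooth_affine_basis smooth_const)

lemma bubble_0: "\<bar>y $ j\<bar> \<ge> 1 \<Longrightarrow> bubble i y = 0"
  by (simp add: bubble_def bump_0)

lemma bubble_dual:
  "integrable lborel (\<lambda>y. bubble i y * affine_basis k y)"
  "(LINT y|lborel. bubble i y * affine_basis k y) = (if i = k then 1 else 0)"
proof -
  have e: "bubble i y * affine_basis k y = (1 / bump_moment i) * (bump y * (affine_basis i y * affine_basis k y))" for y
    by (simp add: bubble_def)
  have "continuous_on UNIV (\<lambda>y::real^'a. affine_basis i y * affine_basis k y)"
    by (intro continuous_intros smooth_continuous smooth_affine_basis)
  then show "integrable lborel (\<lambda>y. bubble i y * affine_basis k y)"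
    unfolding e by (intro integrable_mult_right bump_integrable)
  have "(LINT y|lborel. bubble i y * affine_basis k y) = (1 / bump_moment i) * (LINT y|lborel. bump y * (affine_basis i y * affine_basis k y))"
    unfolding e by (rule integral_mult_right_zero)
  then show "(LINT y|lborel. bubble i y * affine_basis k y) = (if i = k then 1 else 0)"
    using bump_moment_pos[of i] by (auto simp: bump_orthogonal bump_moment_def)
qed

lemma bubble_bounded: "\<exists>M>0. \<forall>i j (x::real^'n). \<bar>bubble i x\<bar> \<le> M \<and> \<bar>pderiv_r (bubble i) j x\<bar> \<le> M"
proof -
  have "test_fun (cbox (-2) 2) (bubble i)" for i :: "'n option"
  proof -
    have "{x. bubble i x \<noteq> 0} \<subseteq> cbox (-1) 1"
    proof
      fix x assume "x \<in> {x. bubble i x \<noteq> 0}"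
      then have "\<not> \<bar>x $ j\<bar> \<ge> 1" for j using bubble_0[of x j i] by blast
      then have "\<bar>x $ j\<bar> < 1" for j using not_le by blast
      then show "x \<in> cbox (-1) 1" by (simp add: mem_box_cart abs_less_iff less_imp_le)
    qed
    then have t: "tsupp (bubble i) \<subseteq> cbox (-1) 1"
      unfolding tsupp_def by (intro closure_minimal closed_cbox)
    moreover have "compact (tsupp (bubble i))"
      using t closed_closure compact_cbox unfolding tsupp_def
      by (metis closed_Int_compact inf.absorb_iff1)
    moreover have "cbox (-1) 1 \<subseteq> interior (cbox (-2) (2::real^'n))"
      by (auto simp: mem_box_cart) (smt (verit))+
    ultimately show ?thesis using smooth_bubble by (auto simp: test_fun_def)
  qed
  then have "\<forall>i j. \<exists>M\<ge>0. \<forall>x::real^'n. \<bar>pderiv_r (bubble i) j x\<bar> \<le> M \<and> \<bar>bubble i x\<bar> \<le> M"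
    using test_fun_pderiv_bounded by blast
  then obtain M where M: "\<And>i j. M i j \<ge> 0"
    "\<And>i j (x::real^'n). \<bar>pderiv_r (bubble i) j x\<bar> \<le> M i j \<and> \<bar>bubble i x\<bar> \<le> M i j" by metis
  define S where "S = (\<Sum>i\<in>UNIV. \<Sum>j\<in>UNIV. M i j) + 1"
  have "M i j \<le> S" for i j
  proof -
    have "M i j \<le> (\<Sum>j\<in>UNIV. M i j)" by (rule member_le_sum) (auto simp: M)
    also have "\<dots> \<le> (\<Sum>i\<in>UNIV. \<Sum>j\<in>UNIV. M i j)"
      by (rule member_le_sum[of _ _ "\<lambda>i. \<Sum>j\<in>UNIV. M i j"]) (auto simp: M sum_nonneg)
    finally show ?thesis by (simp add: S_def)
  qed
  moreover have "S > 0" unfolding S_def by (intro add_nonneg_pos sum_nonneg M) auto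
  ultimately show ?thesis using M(2) order_trans by (intro exI[of _ S]) blast
qed

text \<open>The factor \<open>1 / s ^ CARD('n)\<close> cancels the Jacobian, so duality with
  \<open>scaled_basis\<close> is independent of \<open>s\<close>.\<close>

definition scaled_bubble :: "real^'n \<Rightarrow> real \<Rightarrow> 'n::finite option \<Rightarrow> real^'n \<Rightarrow> real" where
  "scaled_bubble x0 s i x = (1 / s ^ CARD('n)) * bubble i ((1/s) *\<^sub>R x + (- (1/s) *\<^sub>R x0))"

definition scaled_basis :: "real^'n \<Rightarrow> real \<Rightarrow> 'n::finite option \<Rightarrow> real^'n \<Rightarrow> real" where
  "scaled_basis x0 s i x = affine_basis i ((1/s) *\<^sub>R x + (- (1/s) *\<^sub>R x0))"

lemma integral_affine_real:
  fixes f :: "real^'n \<Rightarrow> real"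
  assumes "f \<in> borel_measurable borel" "c > 0"
  shows "(LINT x|lborel. f x) = c ^ CARD('n) * (LINT x|lborel. f (c *\<^sub>R x + t))"
proof -
  have m: "(\<lambda>x. t + c *\<^sub>R x) \<in> borel \<rightarrow>\<^sub>M borel"
    by (intro borel_measurable_continuous_onI continuous_intros)
  have "(LINT x|lborel. f x) = (LINT x|density (distr lborel borel (\<lambda>x. t + c *\<^sub>R x)) (\<lambda>_. c ^ CARD('n)). f x)"
    using lborel_affine[of c t] assms by simp
  also have "\<dots> = (LINT x|distr lborel borel (\<lambda>x. t + c *\<^sub>R x). c ^ CARD('n) *\<^sub>R f x)"
    using assms by (intro integral_density) auto
  also have "\<dots> = (LINT x|lborel. c ^ CARD('n) *\<^sub>R f (t + c *\<^sub>R x))"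
    using assms m by (intro integral_distr) auto
  finally show ?thesis by (simp add: add.commute)
qed

lemma smooth_scaled_bubble: "smooth_fun (scaled_bubble x0 s i)"
  unfolding scaled_bubble_def[abs_def] by (intro smooth_mult smooth_const smooth_affine smooth_bubble)

lemma scaled_bubble_dual:
  fixes x0 :: "real^'n"
  assumes s: "s > 0"
  shows "(LINT x|lborel. scaled_bubble x0 s i x * scaled_basis x0 s k x) = (if i = k then 1 else 0)"
proof -
  let ?f = "\<lambda>y. bubble i y * affine_basis k y"
  have "?f \<in> borel_measurable borel" by (intro smooth_measurable smooth_mult smooth_bubble smooth_affine_basis)
  from integral_affine_real[OF this, of "1/s" "- (1/s) *\<^sub>R x0"] s
  have "(LINT y|lborel. ?f y) = (1/s) ^ CARD('n) * (LINT x|lborel. ?f ((1/s) *\<^sub>R x + - (1/s) *\<^sub>R x0))" by simp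
  also have "\<dots> = (LINT x|lborel. scaled_bubble x0 s i x * scaled_basis x0 s k x)"
    unfolding scaled_bubble_def scaled_basis_def
    by (subst integral_mult_right_zero[symmetric]) (simp add: power_one_over mult.assoc)
  finally show ?thesis unfolding bubble_dual(2) by (rule sym)
qed

text \<open>The support lies in a cube of half-width \<open>s\<close>; bounding the norm by the sum
  of the coordinates places it in a ball of radius \<open>CARD('n) * s\<close>.\<close>

lemma scaled_bubble_support:
  fixes x0 :: "real^'n"
  assumes s: "s > 0" and nz: "scaled_bubble x0 s i x \<noteq> 0"
  shows "x \<in> ball x0 (real CARD('n) * s)"
proof -
  have "\<bar>(x - x0) $ j\<bar> < s" for j
  proof -
    have "\<not> \<bar>((1/s) *\<^sub>R x + (- (1/s) *\<^sub>R x0)) $ j\<bar> \<ge> 1"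
      using nz bubble_0[of "(1/s) *\<^sub>R x + (- (1/s) *\<^sub>R x0)" j i] by (auto simp: scaled_bubble_def)
    moreover have "((1/s) *\<^sub>R x + (- (1/s) *\<^sub>R x0)) $ j = (x - x0) $ j / s" by (simp add: diff_divide_distrib)
    ultimately show ?thesis using s by (simp add: abs_divide)
  qed
  then have "(\<Sum>j\<in>UNIV. \<bar>(x - x0) $ j\<bar>) < (\<Sum>j\<in>(UNIV::'n set). s)"
    by (intro sum_strict_mono) auto
  then have "norm (x - x0) < real CARD('n) * s"
    using norm_le_l1_cart[of "x - x0"] by simp
  then show ?thesis by (simp add: dist_norm norm_minus_commute)
qed

lemma scaled_bubble_bounds:
  "\<exists>M>0. \<forall>(x0::real^'n) s i x j. s > 0 \<longrightarrow> \<bar>scaled_bubble x0 s i x\<bar> \<le> M / s ^ CARD('n) \<and>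
      \<bar>pderiv_r (scaled_bubble x0 s i) j x\<bar> \<le> M / s ^ CARD('n) / s"
proof -
  obtain M where M: "M > 0" "\<And>i j (x::real^'n). \<bar>bubble i x\<bar> \<le> M" "\<And>i j (x::real^'n). \<bar>pderiv_r (bubble i) j x\<bar> \<le> M"
    using bubble_bounded by blast
  have "\<bar>scaled_bubble x0 s i x\<bar> \<le> M / s ^ CARD('n) \<and>
      \<bar>pderiv_r (scaled_bubble x0 s i) j x\<bar> \<le> M / s ^ CARD('n) / s" if s: "s > 0" for x0 :: "real^'n" and s i x j
  proof
    have sn: "s ^ CARD('n) > 0" using s by simp
    show "\<bar>scaled_bubble x0 s i x\<bar> \<le> M / s ^ CARD('n)"
      using M(2)[of i] sn by (simp add: scaled_bubble_def abs_mult divide_right_mono)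
    have "pderiv_r (scaled_bubble x0 s i) j x = (1 / s ^ CARD('n)) * ((1/s) * pderiv_r (bubble i) j ((1/s) *\<^sub>R x + (- (1/s) *\<^sub>R x0)))"
      unfolding scaled_bubble_def[abs_def]
      by (subst pderiv_r_cmult, intro smooth_affine smooth_bubble, subst pderiv_r_affine)
         (auto intro: smooth_differentiable smooth_bubble)
    also have "\<bar>\<dots>\<bar> = \<bar>pderiv_r (bubble i) j ((1/s) *\<^sub>R x + (- (1/s) *\<^sub>R x0))\<bar> / s ^ CARD('n) / s"
      using s by (simp add: abs_mult)
    also have "\<dots> \<le> M / s ^ CARD('n) / s"
      using s sn by (intro divide_right_mono M) auto
    finally show "\<bar>pderiv_r (scaled_bubble x0 s i) j x\<bar> \<le> M / s ^ CARD('n) / s" .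
  qed
  then show ?thesis using M(1) by blast
qed

section \<open>Moment correction\<close>

lemma sum_UNIV_option:
  fixes f :: "'n::finite option \<Rightarrow> 'b::comm_monoid_add"
  shows "(\<Sum>i\<in>UNIV. f i) = f None + (\<Sum>j\<in>UNIV. f (Some j))"
  unfolding UNIV_option_conv by (subst sum.insert) (auto simp: sum.reindex)

lemma affine_fun_const: "affine_fun (\<lambda>_. c)"
  unfolding affine_fun_def by (rule exI[of _ c], rule exI[of _ 0]) simp

lemma affine_fun_coord: "affine_fun (\<lambda>x. complex_of_real (x $ j))"
  unfolding affine_fun_def
  by (rule exI[of _ 0], rule exI[of _ "axis j 1"]) (simp add: axis_def if_distrib if_distribR sum.delta cong: if_cong)

lemma affine_fun_scaled_basis: "affine_fun (\<lambda>x. complex_of_real (scaled_basis x0 s i x))"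
proof (cases i)
  case None
  then show ?thesis by (simp add: scaled_basis_def affine_fun_const)
next
  case (Some j)
  have "affine_fun (\<lambda>x. complex_of_real (1/s) * complex_of_real (x $ j) + complex_of_real (- (1/s) * x0 $ j))"
    by (intro affine_fun_add affine_fun_cmult affine_fun_coord affine_fun_const)
  then show ?thesis using Some by (simp add: scaled_basis_def)
qed

lemma affine_fun_scaled_expansion:
  fixes q :: "real^'n \<Rightarrow> complex"
  assumes "affine_fun q" "s > 0"
  shows "\<exists>\<beta>. \<forall>x. q x = (\<Sum>i\<in>UNIV. \<beta> i * complex_of_real (scaled_basis x0 s i x))"
proof -
  obtain a b where q: "\<And>x. q x = a + (\<Sum>j\<in>UNIV. b $ j * complex_of_real (x $ j))"
    using assms(1) unfolding affine_fun_def by blast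
  define \<beta> where "\<beta> i = (case i of None \<Rightarrow> a + (\<Sum>j\<in>UNIV. b $ j * complex_of_real (x0 $ j)) | Some j \<Rightarrow> b $ j * complex_of_real s)" for i
  have "q x = (\<Sum>i\<in>UNIV. \<beta> i * complex_of_real (scaled_basis x0 s i x))" for x
  proof -
    have "(\<Sum>j\<in>UNIV. \<beta> (Some j) * complex_of_real (scaled_basis x0 s (Some j) x)) =
      (\<Sum>j\<in>UNIV. b $ j * complex_of_real (x $ j) - b $ j * complex_of_real (x0 $ j))"
      using assms(2) by (intro sum.cong) (auto simp: \<beta>_def scaled_basis_def field_simps)
    then show ?thesis
      unfolding sum_UNIV_option q by (simp add: \<beta>_def scaled_basis_def sum_subtractf)
  qed
  then show ?thesis by blast
qed

lemma scaled_basis_bound: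
  assumes "s > 0" "dist x x0 \<le> h"
  shows "\<bar>scaled_basis x0 s i x\<bar> \<le> 1 + h / s"
proof (cases i)
  case None
  have "0 \<le> h" using assms(2) zero_le_dist[of x x0] by linarith
  then show ?thesis using None assms by (simp add: scaled_basis_def)
next
  case (Some j)
  have "\<bar>(x - x0) $ j\<bar> \<le> h"
    using component_le_norm_cart[of "x - x0" j] assms(2) by (simp add: dist_norm)
  then have "\<bar>(x - x0) $ j\<bar> / s \<le> h / s" using assms by (simp add: divide_right_mono)
  moreover have "scaled_basis x0 s i x = (x - x0) $ j / s"
    using Some by (simp add: scaled_basis_def diff_divide_distrib)
  ultimately show ?thesis using assms(1) by (simp add: abs_divide)
qed

text \<open>\<open>F K\<close> is a prescribed complex linear functional on affine functions over
  \<open>K\<close>, and \<open>D K\<close> bounds it relative to the maximum norm. Functionals are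
  used rather than densities because the data later contain nodal values. The pairing carries no
  conjugation, in keeping with linearity of \<open>F K\<close>. Bundling the statement lets
  \<open>C\<close> be chosen before the mesh.\<close>

definition moment_corrector :: "real \<Rightarrow> (real^'n) set \<Rightarrow> (real^'n) set set \<Rightarrow> bool" where
  "moment_corrector C \<Omega> \<T> \<longleftrightarrow> (\<forall>R F D. R \<subseteq> \<T> \<longrightarrow>
    (\<forall>K\<in>R. \<forall>q r. affine_fun q \<longrightarrow> affine_fun r \<longrightarrow> F K (\<lambda>x. q x + r x) = F K q + F K r) \<longrightarrow>
    (\<forall>K\<in>R. \<forall>q a. affine_fun q \<longrightarrow> F K (\<lambda>x. a * q x) = a * F K q) \<longrightarrow>
    (\<forall>K\<in>R. \<forall>q r. (\<forall>x\<in>K. q x = r x) \<longrightarrow> F K q = F K r) \<longrightarrow>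
    (\<forall>K\<in>R. \<forall>q m. affine_fun q \<longrightarrow> (\<forall>x\<in>K. cmod (q x) \<le> m) \<longrightarrow> cmod (F K q) \<le> m * D K) \<longrightarrow>
    (\<exists>p g. L2fun \<Omega> p \<and> is_weak_grad \<Omega> p g \<and>
      (\<forall>v\<in>Vh \<Omega> \<T>. (LINT x:\<Omega>|lborel. p x * v x) = (\<Sum>K\<in>R. F K v)) \<and>
      (\<forall>K\<in>\<T> - R. \<forall>x\<in>interior K. p x = 0 \<and> g x = 0) \<and>
      (\<forall>K\<in>R. \<forall>x\<in>interior K. cmod (p x) \<le> C * D K / mesh_size \<T> ^ CARD('n) \<and>
         (\<forall>j. cmod (g x $ j) \<le> C * D K / mesh_size \<T> ^ CARD('n) / mesh_size \<T>))))"

text \<open>Local replacement for the non-local \<open>L\<^sup>2\<close> projection: bubbles inside single elements restore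
  prescribed moments against \<open>V\<^sub>h\<close>.\<close>

lemma moment_correction:
  fixes \<sigma> \<rho> :: real
  assumes reg: "\<sigma> > 0" "\<rho> > 0"
  shows "\<exists>C>0. \<forall>(\<Omega>::(real^'n) set) \<T>.
    compact \<Omega> \<longrightarrow> conforming_mesh \<Omega> \<T> \<longrightarrow> shape_regular \<sigma> \<T> \<longrightarrow> quasi_uniform \<rho> \<T> \<longrightarrow>
    moment_corrector C \<Omega> \<T>"
proof -
  obtain M where M: "M > 0"
    "\<And>(x0::real^'n) s i x. s > 0 \<Longrightarrow> \<bar>scaled_bubble x0 s i x\<bar> \<le> M / s ^ CARD('n)"
    "\<And>(x0::real^'n) s i x j. s > 0 \<Longrightarrow> \<bar>pderiv_r (scaled_bubble x0 s i) j x\<bar> \<le> M / s ^ CARD('n) / s"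
    using scaled_bubble_bounds[where 'n = 'n] by blast
  define n where "n = real CARD('n)"
  have n: "n \<ge> 1" by (simp add: n_def Suc_le_eq)
  \<comment> \<open>Chosen such that a bubble of scale \<open>s = h / \<tau>\<close> has its support
    in the inner ball: \<open>n * s = \<rho> * h / (2 * \<sigma>)\<close>.\<close>
  define \<tau> where "\<tau> = n * (2 * \<sigma> / \<rho>)"
  have \<tau>: "\<tau> > 0" using n reg by (simp add: \<tau>_def)
  \<comment> \<open>There are \<open>n + 1\<close> bubbles per element, with coefficients at most
    \<open>(1 + \<tau>) * D K\<close> and size \<open>M * \<tau> ^ CARD('n) / h ^ CARD('n)\<close>.
    The last factor dominates both \<open>1\<close>, for the values, and \<open>\<tau>\<close>, for
    the gradient.\<close>
  define C where "C = (n + 1) * ((1 + \<tau>) * (M * \<tau> ^ CARD('n))) * (1 + \<tau>)"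
  have C: "C > 0" using n \<tau> M by (simp add: C_def)
  show ?thesis unfolding moment_corrector_def
  proof (intro exI[of _ C] conjI allI impI C)
    fix \<Omega> :: "(real^'n) set" and \<T> R
      and F :: "(real^'n) set \<Rightarrow> (real^'n \<Rightarrow> complex) \<Rightarrow> complex" and D :: "(real^'n) set \<Rightarrow> real"
    assume \<Omega>: "compact \<Omega>" and Me: "conforming_mesh \<Omega> \<T>" and sr: "shape_regular \<sigma> \<T>" and qu: "quasi_uniform \<rho> \<T>"
      and R: "R \<subseteq> \<T>"
      and Fadd: "\<forall>K\<in>R. \<forall>q r. affine_fun q \<longrightarrow> affine_fun r \<longrightarrow> F K (\<lambda>x. q x + r x) = F K q + F K r"
      and Fmult: "\<forall>K\<in>R. \<forall>q a. affine_fun q \<longrightarrow> F K (\<lambda>x. a * q x) = a * F K q"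
      and Fcong: "\<forall>K\<in>R. \<forall>q r. (\<forall>x\<in>K. q x = r x) \<longrightarrow> F K q = F K r"
      and Fbnd: "\<forall>K\<in>R. \<forall>q m. affine_fun q \<longrightarrow> (\<forall>x\<in>K. cmod (q x) \<le> m) \<longrightarrow> cmod (F K q) \<le> m * D K"
    define h where "h = mesh_size \<T>"
    have h: "h > 0" unfolding h_def by (rule mesh_size_pos[OF Me])
    define s where "s = h / \<tau>"
    have s: "s > 0" using h \<tau> by (simp add: s_def)
    have ns: "n * s = \<rho> * h / (2 * \<sigma>)" using n reg by (simp add: s_def \<tau>_def)
    have hs: "h / s = \<tau>" using h \<tau> by (simp add: s_def)
    have finR: "finite R" using R mesh_finite[OF Me] finite_subset by blast
    have "\<forall>K\<in>\<T>. \<exists>c. ball c (n * s) \<subseteq> K"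
      using mesh_inner_ball[OF Me _ sr qu reg] unfolding ns h_def by metis
    then obtain c where c: "\<And>K. K \<in> \<T> \<Longrightarrow> ball (c K) (n * s) \<subseteq> K" by metis
    have cK: "c K \<in> K" if "K \<in> \<T>" for K using c[OF that] n s by (auto simp: subset_iff)
    define b where "b K = scaled_bubble (c K) s" for K
    define Q where "Q K i x = complex_of_real (scaled_basis (c K) s i x)" for K i x
    have bs: "smooth_fun (b K i)" for K i unfolding b_def by (rule smooth_scaled_bubble)
    have Qa: "affine_fun (Q K i)" for K i
      unfolding Q_def[abs_def] by (rule affine_fun_scaled_basis)
    have b_supp: "x \<in> interior K" if "K \<in> \<T>" "b K i x \<noteq> 0" for K i x
    proof -
      have "x \<in> ball (c K) (n * s)"
        using scaled_bubble_support[OF s, of "c K" i x] that by (simp add: b_def n_def)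
      then show ?thesis using interior_maximal[OF c[OF that(1)]] by blast
    qed
    have b0: "b K i x = 0" if "K \<in> \<T>" "K' \<in> \<T>" "K \<noteq> K'" "x \<in> interior K'" for K K' i x
      using b_supp[OF that(1), of i x] mesh_eq_of_interior[OF Me that(2,1) that(4)] interior_subset that(3) by blast
    have db0: "pderiv_r (b K i) j x = 0" if "K \<in> \<T>" "K' \<in> \<T>" "K \<noteq> K'" "x \<in> interior K'" for K K' i j x
    proof -
      have "pderiv_r (b K i) j x = pderiv_r (\<lambda>_. 0) j x"
        by (rule pderiv_r_local[OF open_interior that(4)]) (rule b0[OF that(1-3)])
      then show ?thesis by simp
    qed
    \<comment> \<open>By duality these coefficients prescribe the moment of \<open>p\<close> against
      each local basis function \<open>Q K i\<close>.\<close>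
    define \<alpha> where "\<alpha> K i = F K (Q K i)" for K i
    define p where "p x = (\<Sum>ki\<in>R \<times> UNIV. \<alpha> (fst ki) (snd ki) * complex_of_real (b (fst ki) (snd ki) x))" for x
    define g :: "real^'n \<Rightarrow> complex^'n" where
      "g x = (\<chi> j. \<Sum>ki\<in>R \<times> UNIV. \<alpha> (fst ki) (snd ki) * complex_of_real (pderiv_r (b (fst ki) (snd ki)) j x))" for x
    have pg: "is_weak_grad \<Omega> p g"
      unfolding p_def[abs_def] g_def[abs_def] by (rule weak_grad_smooth_sum[OF \<Omega>]) (use finR bs in auto)
    have p2: "L2fun \<Omega> p"
      unfolding p_def[abs_def] by (intro L2fun_sum \<Omega> L2fun_continuous continuous_intros continuous_on_smooth_complex bs)
    have p_sum: "p x = (\<Sum>K\<in>R. \<Sum>i\<in>UNIV. \<alpha> K i * complex_of_real (b K i x))" for x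
      unfolding p_def by (simp add: sum.cartesian_product case_prod_unfold)
    have g_sum: "g x $ j = (\<Sum>K\<in>R. \<Sum>i\<in>UNIV. \<alpha> K i * complex_of_real (pderiv_r (b K i) j x))" for x j
      unfolding g_def by (simp add: sum.cartesian_product case_prod_unfold)
    have p_loc: "p x = (if K \<in> R then \<Sum>i\<in>UNIV. \<alpha> K i * complex_of_real (b K i x) else 0)"
      if "K \<in> \<T>" "x \<in> interior K" for K x
    proof -
      have "p x = (\<Sum>J\<in>R. if J = K then \<Sum>i\<in>UNIV. \<alpha> K i * complex_of_real (b K i x) else 0)"
        unfolding p_sum
      proof (rule sum.cong[OF refl])
        fix J assume "J \<in> R"
        then show "(\<Sum>i\<in>UNIV. \<alpha> J i * complex_of_real (b J i x)) =
            (if J = K then \<Sum>i\<in>UNIV. \<alpha> K i * complex_of_real (b K i x) else 0)"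
          using b0[OF subsetD[OF R] that(1) _ that(2), of J] by (cases "J = K") simp_all
      qed
      then show ?thesis using finR by simp
    qed
    have g_loc: "g x $ j = (if K \<in> R then \<Sum>i\<in>UNIV. \<alpha> K i * complex_of_real (pderiv_r (b K i) j x) else 0)"
      if "K \<in> \<T>" "x \<in> interior K" for K x j
    proof -
      have "g x $ j = (\<Sum>J\<in>R. if J = K then \<Sum>i\<in>UNIV. \<alpha> K i * complex_of_real (pderiv_r (b K i) j x) else 0)"
        unfolding g_sum
      proof (rule sum.cong[OF refl])
        fix J assume "J \<in> R"
        then show "(\<Sum>i\<in>UNIV. \<alpha> J i * complex_of_real (pderiv_r (b J i) j x)) =
            (if J = K then \<Sum>i\<in>UNIV. \<alpha> K i * complex_of_real (pderiv_r (b K i) j x) else 0)"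
          using db0[OF subsetD[OF R] that(1) _ that(2), of J] by (cases "J = K") simp_all
      qed
      then show ?thesis using finR by simp
    qed
    have \<alpha>: "cmod (\<alpha> K i) \<le> (1 + \<tau>) * D K" if "K \<in> R" for K i
    proof -
      have KT: "K \<in> \<T>" using that R by blast
      have "cmod (Q K i x) \<le> 1 + \<tau>" if "x \<in> K" for x
        using scaled_basis_bound[OF s, of x "c K" h i] mesh_dist_le[OF Me KT that cK[OF KT]]
        by (simp add: Q_def hs[unfolded h_def] h_def)
      then show ?thesis using Fbnd that Qa unfolding \<alpha>_def by blast
    qed
    have D0: "D K \<ge> 0" if "K \<in> R" for K
      using order_trans[OF norm_ge_zero Fbnd[rule_format, OF that affine_fun_zero, of 1]] by simp
    have bnd: "cmod (\<Sum>i\<in>UNIV. \<alpha> K i * complex_of_real (f i)) \<le> (n + 1) * ((1 + \<tau>) * D K * B)"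
      if "K \<in> R" "\<And>i. \<bar>f i\<bar> \<le> B" for K B and f :: "'n option \<Rightarrow> real"
    proof -
      have "cmod (\<Sum>i\<in>UNIV. \<alpha> K i * complex_of_real (f i)) \<le> (\<Sum>i\<in>(UNIV::'n option set). (1 + \<tau>) * D K * B)"
        unfolding norm_mult norm_of_real
        by (intro sum_norm_le) (auto simp: norm_mult intro!: mult_mono \<alpha>[OF that(1)] that(2) mult_nonneg_nonneg D0[OF that(1)] less_imp_le[OF \<tau>] add_nonneg_nonneg)
      also have "\<dots> = (n + 1) * ((1 + \<tau>) * D K * B)"
        by (simp add: n_def card_option distrib_right)
      finally show ?thesis .
    qed
    have sn: "M / s ^ CARD('n) = M * \<tau> ^ CARD('n) / h ^ CARD('n)"
      using h \<tau> by (simp add: s_def power_divide)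
    have Ms: "M / s ^ CARD('n) / s = M * \<tau> ^ CARD('n) / h ^ CARD('n) * \<tau> / h"
      using h \<tau> unfolding sn by (simp add: s_def)
    have p_bound: "cmod (p x) \<le> C * D K / h ^ CARD('n)" if K: "K \<in> R" and x: "x \<in> interior K" for K x
    proof -
      have "cmod (p x) \<le> (n + 1) * ((1 + \<tau>) * D K * (M * \<tau> ^ CARD('n) / h ^ CARD('n)))"
        using p_loc[of K x] bnd[OF K, of "\<lambda>i. b K i x" "M / s ^ CARD('n)"] M(2)[OF s] K x R
        by (auto simp: b_def sn)
      also have "\<dots> = ((n + 1) * ((1 + \<tau>) * (M * \<tau> ^ CARD('n))) * 1) * D K / h ^ CARD('n)" by simp
      also have "\<dots> \<le> C * D K / h ^ CARD('n)"
        unfolding C_def using D0[OF K] h \<tau> n M by (intro divide_right_mono mult_right_mono mult_left_mono) auto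
      finally show ?thesis .
    qed
    have g_bound: "cmod (g x $ j) \<le> C * D K / h ^ CARD('n) / h" if K: "K \<in> R" and x: "x \<in> interior K" for K x j
    proof -
      have "cmod (g x $ j) \<le> (n + 1) * ((1 + \<tau>) * D K * (M * \<tau> ^ CARD('n) / h ^ CARD('n) * \<tau> / h))"
        using g_loc[of K x j] bnd[OF K, of "\<lambda>i. pderiv_r (b K i) j x" "M / s ^ CARD('n) / s"] M(3)[OF s] K x R
        unfolding Ms by (auto simp: b_def)
      also have "\<dots> = ((n + 1) * ((1 + \<tau>) * (M * \<tau> ^ CARD('n))) * \<tau>) * D K / h ^ CARD('n) / h" by simp
      also have "\<dots> \<le> C * D K / h ^ CARD('n) / h"
        unfolding C_def using D0[OF K] h \<tau> n M by (intro divide_right_mono mult_right_mono mult_left_mono) auto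
      finally show ?thesis .
    qed
    have moments: "(LINT x:\<Omega>|lborel. p x * v x) = (\<Sum>K\<in>R. F K v)" if v: "v \<in> Vh \<Omega> \<T>" for v
    proof -
      have bv: "L2fun \<Omega> (\<lambda>x. complex_of_real (b K i x))" for K i
        by (intro L2fun_continuous \<Omega> continuous_on_smooth_complex bs)
      have v2: "L2fun \<Omega> v" using v by (intro L2fun_continuous \<Omega>) (simp add: Vh_def)
      have ibv: "set_integrable lborel \<Omega> (\<lambda>x. complex_of_real (b K i x) * v x)" for K i
        by (rule L2fun_mult_integrable[OF bv v2])
      \<comment> \<open>The bubbles of \<open>K\<close> see only the affine restriction of
        \<open>v\<close> to \<open>K\<close>. Duality reads off its coefficients, and linearity of
        \<open>F K\<close> reassembles them.\<close>
      have one: "(\<Sum>i\<in>UNIV. \<alpha> K i * (LINT x:\<Omega>|lborel. complex_of_real (b K i x) * v x)) = F K v" if K: "K \<in> R" for K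
      proof -
        have KT: "K \<in> \<T>" using K R by blast
        obtain q where q: "affine_fun q" "\<And>x. x \<in> K \<Longrightarrow> v x = q x" using Vh_affine[OF v KT] by blast
        obtain \<beta> where \<beta>: "\<And>x. q x = (\<Sum>i\<in>UNIV. \<beta> i * Q K i x)"
          using affine_fun_scaled_expansion[OF q(1) s, of "c K"] unfolding Q_def by blast
        have int: "integrable lborel (\<lambda>x. complex_of_real (b K i x) * Q K k x)" for i k
        proof -
          have "integrable lborel (\<lambda>x. indicator K x *\<^sub>R (complex_of_real (b K i x) * Q K k x))"
            using mesh_element(1)[OF Me KT]
            by (intro borel_integrable_compact continuous_on_mult continuous_on_smooth_complex bs affine_fun_continuous Qa)
          moreover have "indicator K x *\<^sub>R (complex_of_real (b K i x) * Q K k x) = complex_of_real (b K i x) * Q K k x" for x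
            using b_supp[OF KT, of i x] interior_subset[of K] by (cases "b K i x = 0") (auto simp: indicator_def)
          ultimately show ?thesis by (simp only:)
        qed
        have dual: "(LINT x|lborel. complex_of_real (b K i x) * Q K k x) = (if i = k then 1 else 0)" for i k
        proof -
          have "(LINT x|lborel. complex_of_real (b K i x) * Q K k x) = (LINT x|lborel. complex_of_real (scaled_bubble (c K) s i x * scaled_basis (c K) s k x))"
            by (simp add: b_def Q_def)
          also have "\<dots> = complex_of_real (LINT x|lborel. scaled_bubble (c K) s i x * scaled_basis (c K) s k x)"
            by (rule integral_complex_of_real)
          finally show ?thesis using scaled_bubble_dual[OF s, of "c K" i k] by simp
        qed
        have "(LINT x:\<Omega>|lborel. complex_of_real (b K i x) * v x) = \<beta> i" for i
        proof -
          have "indicator \<Omega> x *\<^sub>R (complex_of_real (b K i x) * v x) = (\<Sum>k\<in>UNIV. \<beta> k * (complex_of_real (b K i x) * Q K k x))" for x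
          proof (cases "b K i x = 0")
            case False
            then have "x \<in> K" using b_supp[OF KT] interior_subset by blast
            moreover then have "x \<in> \<Omega>" using mesh_element(6)[OF Me KT] by blast
            ultimately show ?thesis by (simp add: q(2) \<beta> sum_distrib_left mult_ac)
          qed simp
          then have "(LINT x:\<Omega>|lborel. complex_of_real (b K i x) * v x) = (LINT x|lborel. (\<Sum>k\<in>UNIV. \<beta> k * (complex_of_real (b K i x) * Q K k x)))"
            by (simp only: set_lebesgue_integral_def)
          also have "\<dots> = (\<Sum>k\<in>UNIV. \<beta> k * (LINT x|lborel. complex_of_real (b K i x) * Q K k x))"
            by (subst Bochner_Integration.integral_sum) (auto intro!: integrable_mult_right int)
          also have "\<dots> = \<beta> i" by (simp add: dual if_distrib sum.delta cong: if_cong)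
          finally show ?thesis .
        qed
        then have "(\<Sum>i\<in>UNIV. \<alpha> K i * (LINT x:\<Omega>|lborel. complex_of_real (b K i x) * v x)) = (\<Sum>i\<in>UNIV. \<beta> i * F K (Q K i))"
          by (simp add: \<alpha>_def mult.commute)
        also have "\<dots> = F K (\<lambda>x. \<Sum>i\<in>UNIV. \<beta> i * Q K i x)"
        proof -
          have F0: "F K (\<lambda>_. 0) = 0" using Fmult[rule_format, OF K affine_fun_zero, of 0] by simp
          have "F K (\<lambda>x. \<Sum>i\<in>I. \<beta> i * Q K i x) = (\<Sum>i\<in>I. \<beta> i * F K (Q K i))" if "finite I" for I
            using that
          proof (induction I)
            case (insert i I)
            have "F K (\<lambda>x. \<beta> i * Q K i x + (\<Sum>i\<in>I. \<beta> i * Q K i x)) = F K (\<lambda>x. \<beta> i * Q K i x) + F K (\<lambda>x. \<Sum>i\<in>I. \<beta> i * Q K i x)"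
              by (rule Fadd[rule_format, OF K]) (intro affine_fun_cmult affine_fun_sum Qa)+
            then show ?case using insert Fmult[rule_format, OF K Qa] by simp
          qed (simp add: F0)
          then show ?thesis by simp
        qed
        also have "\<dots> = F K v" using q(2) \<beta> by (intro Fcong[rule_format, OF K]) auto
        finally show ?thesis .
      qed
      have "(LINT x:\<Omega>|lborel. p x * v x) = (LINT x:\<Omega>|lborel. (\<Sum>K\<in>R. \<Sum>i\<in>UNIV. \<alpha> K i * (complex_of_real (b K i x) * v x)))"
        by (simp add: p_sum sum_distrib_right mult.assoc)
      also have "\<dots> = (LINT x|lborel. (\<Sum>K\<in>R. \<Sum>i\<in>UNIV. \<alpha> K i * (indicator \<Omega> x *\<^sub>R (complex_of_real (b K i x) * v x))))"
        by (simp add: set_lebesgue_integral_def scaleR_sum_right)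
      also have "\<dots> = (\<Sum>K\<in>R. \<Sum>i\<in>UNIV. \<alpha> K i * (LINT x:\<Omega>|lborel. complex_of_real (b K i x) * v x))"
      proof -
        define w where "w K i x = indicator \<Omega> x *\<^sub>R (complex_of_real (b K i x) * v x)" for K i x
        have iw: "integrable lborel (\<lambda>x. \<alpha> K i * w K i x)" for K i
          using ibv[of K i] by (intro integrable_mult_right) (simp add: w_def set_integrable_def)
        have "(LINT x|lborel. (\<Sum>K\<in>R. \<Sum>i\<in>UNIV. \<alpha> K i * w K i x)) = (\<Sum>K\<in>R. LINT x|lborel. (\<Sum>i\<in>UNIV. \<alpha> K i * w K i x))"
          by (intro Bochner_Integration.integral_sum Bochner_Integration.integrable_sum iw)
        also have "\<dots> = (\<Sum>K\<in>R. \<Sum>i\<in>UNIV. LINT x|lborel. \<alpha> K i * w K i x)"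
          by (intro sum.cong refl Bochner_Integration.integral_sum iw)
        also have "\<dots> = (\<Sum>K\<in>R. \<Sum>i\<in>UNIV. \<alpha> K i * (LINT x|lborel. w K i x))"
          by (simp only: integral_mult_right_zero)
        finally show ?thesis by (simp only: w_def set_lebesgue_integral_def)
      qed
      also have "\<dots> = (\<Sum>K\<in>R. F K v)" using one by simp
      finally show ?thesis .
    qed
    show "\<exists>p g. L2fun \<Omega> p \<and> is_weak_grad \<Omega> p g \<and>
      (\<forall>v\<in>Vh \<Omega> \<T>. (LINT x:\<Omega>|lborel. p x * v x) = (\<Sum>K\<in>R. F K v)) \<and>
      (\<forall>K\<in>\<T> - R. \<forall>x\<in>interior K. p x = 0 \<and> g x = 0) \<and>
      (\<forall>K\<in>R. \<forall>x\<in>interior K. cmod (p x) \<le> C * D K / mesh_size \<T> ^ CARD('n) \<and>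
         (\<forall>j. cmod (g x $ j) \<le> C * D K / mesh_size \<T> ^ CARD('n) / mesh_size \<T>))"
      using pg p2 moments p_loc g_loc p_bound[unfolded h_def] g_bound[unfolded h_def]
      by (intro exI[of _ p] exI[of _ g]) (auto simp: vec_eq_iff)
  qed
qed

section \<open>The energy\<close>

lemma Re_mult_cnj_le: "\<bar>Re (a * cnj b)\<bar> \<le> (cmod a)\<^sup>2 / 2 + (cmod b)\<^sup>2 / 2"
proof -
  have "\<bar>Re (a * cnj b)\<bar> \<le> cmod a * cmod b"
    using abs_Re_le_cmod[of "a * cnj b"] by (simp add: norm_mult)
  moreover have "0 \<le> (cmod a - cmod b)\<^sup>2" by simp
  ultimately show ?thesis by (simp add: power2_diff)
qed

lemma Re_mult_cnj_self: "Re (a * cnj a) = (cmod a)\<^sup>2"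
  by (simp add: complex_mult_cnj cmod_power2)

lemma set_integral_Re:
  assumes "set_integrable lborel G (f :: real^'n \<Rightarrow> complex)"
  shows "set_integrable lborel G (\<lambda>x. Re (f x))" "Re (LINT x:G|lborel. f x) = (LINT x:G|lborel. Re (f x))"
proof -
  have e: "indicator G x *\<^sub>R Re (f x) = Re (indicator G x *\<^sub>R f x)" for x by simp
  show "set_integrable lborel G (\<lambda>x. Re (f x))"
    using integrable_bounded_linear[OF bounded_linear_Re assms[unfolded set_integrable_def]]
    unfolding set_integrable_def e .
  show "Re (LINT x:G|lborel. f x) = (LINT x:G|lborel. Re (f x))"
    using integral_bounded_linear[OF bounded_linear_Re assms[unfolded set_integrable_def]]
    unfolding set_lebesgue_integral_def e by simp
qed

lemma L2ip_eq:
  assumes "L2fun G u" "L2fun G v"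
  shows "set_integrable lborel G (\<lambda>x. Re (u x * cnj (v x)))"
    "L2ip G u v = (LINT x:G|lborel. Re (u x * cnj (v x)))"
  using set_integral_Re[OF L2fun_mult_integrable[OF assms(1) L2fun_cnj[OF assms(2)]]]
  by (auto simp: L2ip_def)

lemma L2ipv_eq:
  fixes u v :: "real^'n \<Rightarrow> complex^'n"
  assumes "\<And>j. L2fun G (\<lambda>x. u x $ j)" "\<And>j. L2fun G (\<lambda>x. v x $ j)"
  shows "set_integrable lborel G (\<lambda>x. \<Sum>j\<in>UNIV. Re (u x $ j * cnj (v x $ j)))"
    "L2ipv G u v = (LINT x:G|lborel. (\<Sum>j\<in>UNIV. Re (u x $ j * cnj (v x $ j))))"
proof -
  have "set_integrable lborel G (\<lambda>x. u x $ j * cnj (v x $ j))" for j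
    by (rule L2fun_mult_integrable[OF assms(1) L2fun_cnj[OF assms(2)]])
  then have "set_integrable lborel G (\<lambda>x. \<Sum>j\<in>UNIV. u x $ j * cnj (v x $ j))"
    unfolding set_integrable_def scaleR_sum_right by (intro Bochner_Integration.integrable_sum)
  from set_integral_Re[OF this]
  show "set_integrable lborel G (\<lambda>x. \<Sum>j\<in>UNIV. Re (u x $ j * cnj (v x $ j)))"
    "L2ipv G u v = (LINT x:G|lborel. (\<Sum>j\<in>UNIV. Re (u x $ j * cnj (v x $ j))))"
    by (auto simp: L2ipv_def)
qed

text \<open>Distinct elements overlap only in a null set, since a point of an overlap cannot lie in
  the interior of either element.\<close>

lemma set_integral_mesh_sum:
  fixes f :: "real^'n \<Rightarrow> 'b::{banach, second_countable_topology}"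
  assumes M: "conforming_mesh \<Omega> \<T>" and F: "F \<subseteq> \<T>" and f: "set_integrable lborel \<Omega> f"
  shows "(LINT x:(\<Union>F)|lborel. f x) = (\<Sum>K\<in>F. LINT x:K|lborel. f x)"
proof -
  have "(LINT x:(\<Union>K\<in>F. K)|lborel. f x) = (\<Sum>K\<in>F. LINT x:K|lborel. f x)"
  proof (rule set_integral_finite_UN_AE)
    show "finite F" using F mesh_finite[OF M] finite_subset by blast
    fix K assume K: "K \<in> F"
    then have KT: "K \<in> \<T>" using F by blast
    show "K \<in> sets lborel" using mesh_element(4)[OF M KT] by simp
    show "set_integrable lborel K f"
      using set_integrable_subset[OF f] mesh_element(4,6)[OF M KT] by simp
    fix J assume "J \<in> F"
    then have JT: "J \<in> \<T>" using F by blast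
    show "AE x in lborel. x \<in> K \<and> x \<in> J \<longrightarrow> K = J"
      using AE_mesh_interior[OF M]
      by (rule AE_mp) (use mesh_eq_of_interior[OF M KT JT] KT in auto)
  qed
  then show ?thesis by simp
qed

text \<open>Cutoff and bubble identities hold in element interiors, and gradients agree almost
  everywhere in the interior of \<open>\<Omega>\<close>. Here both are combined into a statement on
  the closed element.\<close>

lemma AE_on_mesh_element:
  assumes M: "conforming_mesh \<Omega> (\<T>::(real^'n) set set)" "K \<in> \<T>"
    and "AE x in lborel. x \<in> interior \<Omega> \<longrightarrow> P x" and "\<And>x. x \<in> interior K \<Longrightarrow> P x \<Longrightarrow> Q x"
  shows "AE x in lborel. x \<in> K \<longrightarrow> Q x"
  using assms(3) AE_mesh_interior[OF M(1)]
proof eventually_elim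
  case (elim x)
  then show ?case using M(2) assms(4) interior_mono[OF mesh_element(6)[OF M]] by blast
qed

text \<open>The locale fixes one mesh and one set of parameters. Its constants \<open>Ca\<close> and
  \<open>Cc\<close> are built from \<open>La\<close>, \<open>Cp\<close> and \<open>Cr\<close> alone,
  which shows their uniformity in \<kappa>, \<open>h\<close> and \<beta>. \<open>poincare\<close> is
  the projection estimate on the kernel of the projection.\<close>

locale lod_setting =
  fixes \<Omega> :: "(real^'n) set" and A :: "real^'n \<Rightarrow> real^'n" and \<kappa> \<beta> :: real
    and \<T> :: "(real^'n) set set" and La Cp Cr :: real
  assumes \<Omega>: "compact \<Omega>" "convex \<Omega>" "interior \<Omega> \<noteq> {}"
    and A_meas: "set_borel_measurable lborel \<Omega> A"
    and A_bound: "AE x in lborel. x \<in> \<Omega> \<longrightarrow> norm (A x) \<le> La"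
    and \<kappa>: "\<kappa> > 0" and \<beta>: "\<beta> \<ge> 0"
    and mesh: "conforming_mesh \<Omega> \<T>"
    and poincare: "\<And>w. w \<in> Wspace \<Omega> \<T> \<Longrightarrow> L2norm \<Omega> w \<le> Cp * mesh_size \<T> * L2normv \<Omega> (wgrad \<Omega> w)"
    and Cr: "Cr > 0" and resolution: "mesh_size \<T> \<le> Cr / \<kappa>"
    and Cr_bound: "4 * Cp\<^sup>2 * La\<^sup>2 * Cr\<^sup>2 \<le> 1"
begin

abbreviation h :: real where "h \<equiv> mesh_size \<T>"
abbreviation mg :: "(real^'n \<Rightarrow> complex) \<Rightarrow> real^'n \<Rightarrow> complex^'n" where "mg \<equiv> mag_grad \<Omega> \<kappa> A"
abbreviation gr :: "(real^'n \<Rightarrow> complex) \<Rightarrow> real^'n \<Rightarrow> complex^'n" where "gr \<equiv> wgrad \<Omega>"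

text \<open>Working with densities allows pointwise comparison followed by integration over single
  elements.\<close>

definition ad :: "(real^'n \<Rightarrow> complex) \<Rightarrow> (real^'n \<Rightarrow> complex) \<Rightarrow> real^'n \<Rightarrow> real" where
  "ad u v x = (\<Sum>j\<in>UNIV. Re (mg u x $ j * cnj (mg v x $ j))) + \<beta> * Re (u x * cnj (v x))"

definition ed :: "(real^'n \<Rightarrow> complex) \<Rightarrow> real^'n \<Rightarrow> real" where
  "ed u x = ((\<Sum>j\<in>UNIV. (cmod (gr u x $ j))\<^sup>2) + (cmod (u x))\<^sup>2 / h\<^sup>2) / \<kappa>\<^sup>2 + \<beta> * (cmod (u x))\<^sup>2"

lemma h_pos: "h > 0" by (rule mesh_size_pos[OF mesh])

lemma kh: "\<kappa> * h \<le> Cr" using resolution \<kappa> by (simp add: field_simps)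

lemma H1_L2: "H1 \<Omega> u \<Longrightarrow> L2fun \<Omega> u" by (simp add: H1_def)

lemma mg_L2:
  assumes "H1 \<Omega> u"
  shows "L2fun \<Omega> (\<lambda>x. mg u x $ j)"
proof -
  have "set_borel_measurable lborel \<Omega> (\<lambda>x. complex_of_real (A x $ j))"
  proof -
    have e: "indicator \<Omega> x *\<^sub>R complex_of_real (A x $ j) = complex_of_real ((indicator \<Omega> x *\<^sub>R A x) $ j)" for x
      by (auto simp: indicator_def)
    have "(\<lambda>y::real^'n. complex_of_real (y $ j)) \<in> borel_measurable borel"
      by (intro borel_measurable_continuous_onI continuous_intros)
    from measurable_compose[OF A_meas[unfolded set_borel_measurable_def] this]
    show ?thesis unfolding set_borel_measurable_def e .
  qed
  moreover have "AE x in lborel. x \<in> \<Omega> \<longrightarrow> cmod (complex_of_real (A x $ j)) \<le> La"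
    using A_bound
  proof eventually_elim
    case (elim x)
    then show ?case using component_le_norm_cart[of "A x" j] by auto
  qed
  ultimately have "L2fun \<Omega> (\<lambda>x. complex_of_real (A x $ j) * u x)"
    using H1_L2[OF assms] by (intro L2fun_bounded_mult)
  moreover have "L2fun \<Omega> (\<lambda>x. (\<i> / complex_of_real \<kappa>) * gr u x $ j)"
    using \<Omega>(1) L2fun_wgrad[OF assms] by (intro L2fun_cmult) (auto simp: borel_closed compact_imp_closed)
  ultimately show ?thesis unfolding mag_grad_def by (auto intro: L2fun_add)
qed

lemma ad_integrable:
  assumes "H1 \<Omega> u" "H1 \<Omega> v"
  shows "set_integrable lborel \<Omega> (ad u v)"
  unfolding ad_def[abs_def]
  using L2ipv_eq(1)[OF mg_L2[OF assms(1)] mg_L2[OF assms(2)]] L2ip_eq(1)[OF H1_L2[OF assms(1)] H1_L2[OF assms(2)]]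
  by (intro set_integral_add set_integrable_mult_right)

lemma a_form_eq:
  assumes u: "H1 \<Omega> u" "H1 \<Omega> v" and G: "G \<subseteq> \<Omega>" "G \<in> sets borel"
  shows "a_form \<Omega> \<kappa> A \<beta> G u v = (LINT x:G|lborel. ad u v x)"
proof -
  have m: "L2fun G (\<lambda>x. mg u x $ j)" "L2fun G (\<lambda>x. mg v x $ j)" for j
    using mg_L2[OF u(1)] mg_L2[OF u(2)] G by (auto intro: L2fun_subset)
  have w: "L2fun G u" "L2fun G v" using u G H1_L2 by (auto intro: L2fun_subset)
  have "(LINT x:G|lborel. ad u v x) = (LINT x:G|lborel. (\<Sum>j\<in>UNIV. Re (mg u x $ j * cnj (mg v x $ j)))) + (LINT x:G|lborel. \<beta> * Re (u x * cnj (v x)))"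
    unfolding ad_def by (intro set_integral_add set_integrable_mult_right L2ipv_eq(1) L2ip_eq(1) m w)
  then show ?thesis unfolding a_form_def L2ipv_eq(2)[OF m] L2ip_eq(2)[OF w] by simp
qed

lemma ed_integrable:
  assumes "H1 \<Omega> u"
  shows "set_integrable lborel \<Omega> (ed u)"
proof -
  have g: "set_integrable lborel \<Omega> (\<lambda>x. (cmod (gr u x $ j))\<^sup>2)" for j
    using L2fun_wgrad[OF assms, of j] by (simp add: L2fun_def)
  have "set_integrable lborel \<Omega> (\<lambda>x. \<Sum>j\<in>UNIV. (cmod (gr u x $ j))\<^sup>2)"
    using g unfolding set_integrable_def scaleR_sum_right by (intro Bochner_Integration.integrable_sum)
  moreover have "set_integrable lborel \<Omega> (\<lambda>x. (cmod (u x))\<^sup>2)"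
    using H1_L2[OF assms] by (simp add: L2fun_def)
  ultimately show ?thesis unfolding ed_def[abs_def]
    by (intro set_integral_add set_integrable_divide set_integrable_mult_right)
qed

lemma ed_nonneg: "ed u x \<ge> 0"
  unfolding ed_def using \<beta> by (intro add_nonneg_nonneg divide_nonneg_nonneg mult_nonneg_nonneg sum_nonneg) auto

lemma ad_self: "ad u u x = (\<Sum>j\<in>UNIV. (cmod (mg u x $ j))\<^sup>2) + \<beta> * (cmod (u x))\<^sup>2"
  by (simp only: ad_def Re_mult_cnj_self)

lemma ad_self_nonneg: "ad u u x \<ge> 0"
  unfolding ad_self using \<beta> by (intro add_nonneg_nonneg sum_nonneg mult_nonneg_nonneg) auto

lemma ad_le_self: "\<bar>ad u v x\<bar> \<le> ad u u x / 2 + ad v v x / 2"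
proof -
  have "\<bar>ad u v x\<bar> \<le> (\<Sum>j\<in>UNIV. \<bar>Re (mg u x $ j * cnj (mg v x $ j))\<bar>) + \<beta> * \<bar>Re (u x * cnj (v x))\<bar>"
    unfolding ad_def using \<beta>
    by (intro order_trans[OF abs_triangle_ineq] add_mono sum_abs) (simp add: abs_mult)
  also have "\<dots> \<le> (\<Sum>j\<in>UNIV. (cmod (mg u x $ j))\<^sup>2 / 2 + (cmod (mg v x $ j))\<^sup>2 / 2) + \<beta> * ((cmod (u x))\<^sup>2 / 2 + (cmod (v x))\<^sup>2 / 2)"
    by (intro add_mono sum_mono mult_left_mono Re_mult_cnj_le \<beta>)
  also have "\<dots> = ad u u x / 2 + ad v v x / 2"
    unfolding ad_self by (simp add: sum.distrib sum_divide_distrib algebra_simps add_divide_distrib)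
  finally show ?thesis .
qed

lemma A_sq_sum: "(\<Sum>j\<in>UNIV. (A x $ j)\<^sup>2) = (norm (A x))\<^sup>2"
  by (simp add: norm_vec_def L2_set_def sum_nonneg)

text \<open>The \<open>2\<close> stems from splitting the square of the magnetic gradient, the
  remainder from the potential term, which \<open>\<kappa> * h \<le> Cr\<close> turns into a
  multiple of the weighted \<open>L^2\<close> part of \<open>ed\<close>.\<close>

definition Ca :: real where "Ca = 2 + 2 * La\<^sup>2 * Cr\<^sup>2"

lemma Ca_ge: "Ca \<ge> 2" by (simp add: Ca_def)

lemma ad_le_ed: "AE x in lborel. x \<in> \<Omega> \<longrightarrow> ad u u x \<le> Ca * ed u x"
  using A_bound
proof eventually_elim
  case (elim x)
  show ?case
  proof
    assume "x \<in> \<Omega>"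
    then have L: "(norm (A x))\<^sup>2 \<le> La\<^sup>2" using elim by (intro power_mono) auto
    have kh2: "1 \<le> Cr\<^sup>2 / (\<kappa>\<^sup>2 * h\<^sup>2)"
    proof -
      have "(\<kappa> * h)\<^sup>2 \<le> Cr\<^sup>2" using kh \<kappa> h_pos by (intro power_mono) auto
      then show ?thesis using \<kappa> h_pos by (simp add: power_mult_distrib)
    qed
    define S where "S = (\<Sum>j\<in>UNIV. (cmod (gr u x $ j))\<^sup>2)"
    define U where "U = (cmod (u x))\<^sup>2"
    have S0: "S \<ge> 0" "U \<ge> 0" by (auto simp: S_def U_def intro: sum_nonneg)
    have "(cmod (mg u x $ j))\<^sup>2 \<le> 2 * ((cmod (gr u x $ j))\<^sup>2 / \<kappa>\<^sup>2) + 2 * ((A x $ j)\<^sup>2 * U)" for j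
      using cmod_add_sq_le[of "(\<i> / complex_of_real \<kappa>) * gr u x $ j" "complex_of_real (A x $ j) * u x"] \<kappa>
      by (simp add: mag_grad_def norm_mult norm_divide power_mult_distrib power_divide U_def)
    then have "(\<Sum>j\<in>UNIV. (cmod (mg u x $ j))\<^sup>2) \<le> (\<Sum>j\<in>UNIV. 2 * ((cmod (gr u x $ j))\<^sup>2 / \<kappa>\<^sup>2) + 2 * ((A x $ j)\<^sup>2 * U))"
      by (rule sum_mono)
    also have "\<dots> = 2 * (S / \<kappa>\<^sup>2) + 2 * ((norm (A x))\<^sup>2 * U)"
      by (simp add: sum.distrib S_def A_sq_sum[symmetric] sum_distrib_left sum_divide_distrib sum_distrib_right)
    also have "\<dots> \<le> 2 * (S / \<kappa>\<^sup>2) + 2 * (La\<^sup>2 * U * (Cr\<^sup>2 / (\<kappa>\<^sup>2 * h\<^sup>2)))"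
    proof -
      have "(norm (A x))\<^sup>2 * U \<le> La\<^sup>2 * U" using L S0 by (intro mult_right_mono)
      also have "\<dots> \<le> La\<^sup>2 * U * (Cr\<^sup>2 / (\<kappa>\<^sup>2 * h\<^sup>2))" using kh2 S0 mult_left_mono[OF kh2, of "La\<^sup>2 * U"] by simp
      finally show ?thesis by simp
    qed
    also have "\<dots> = 2 * (S / \<kappa>\<^sup>2) + (2 * La\<^sup>2 * Cr\<^sup>2) * (U / h\<^sup>2 / \<kappa>\<^sup>2)" by (simp add: mult_ac)
    finally have "ad u u x \<le> 2 * (S / \<kappa>\<^sup>2) + (2 * La\<^sup>2 * Cr\<^sup>2) * (U / h\<^sup>2 / \<kappa>\<^sup>2) + \<beta> * U"
      by (simp add: ad_self U_def)
    also have "\<dots> \<le> Ca * (S / \<kappa>\<^sup>2) + Ca * (U / h\<^sup>2 / \<kappa>\<^sup>2) + Ca * (\<beta> * U)"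
    proof (intro add_mono mult_right_mono)
      have "1 * (\<beta> * U) \<le> Ca * (\<beta> * U)" using \<beta> S0 Ca_ge by (intro mult_right_mono) auto
      then show "\<beta> * U \<le> Ca * (\<beta> * U)" by simp
    qed (use S0 in \<open>auto simp: Ca_def\<close>)
    also have "\<dots> = Ca * ed u x" by (simp add: ed_def S_def U_def distrib_left add_divide_distrib)
    finally show "ad u u x \<le> Ca * ed u x" .
  qed
qed

text \<open>A quarter of the gradient energy survives in the form, and the weighted
  \<open>L^2\<close> part of \<open>ed\<close> costs \<open>Cp^2\<close> times the gradient
  part.\<close>

definition Cc :: real where "Cc = 4 * (1 + Cp\<^sup>2)"

lemma Cc_ge: "Cc \<ge> 4" by (simp add: Cc_def)

text \<open>The potential may cancel the gradient pointwise, so no pointwise bound is available.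
  Integrated over \<open>\<Omega>\<close>, the loss \<open>La^2\<close> times the squared
  \<open>L^2\<close> norm is absorbed by the gradient through the Poincare-type bound on
  \<open>W\<close> and the resolution condition.\<close>

lemma coercive:
  assumes w: "w \<in> Wspace \<Omega> \<T>"
  shows "(LINT x:\<Omega>|lborel. ed w x) \<le> Cc * (LINT x:\<Omega>|lborel. ad w w x)"
proof -
  have H: "H1 \<Omega> w" using w by (simp add: Wspace_def)
  define U where "U = (LINT x:\<Omega>|lborel. (cmod (w x))\<^sup>2)"
  define S where "S = (LINT x:\<Omega>|lborel. (\<Sum>j\<in>UNIV. (cmod (gr w x $ j))\<^sup>2))"
  have iU: "set_integrable lborel \<Omega> (\<lambda>x. (cmod (w x))\<^sup>2)"
    using H1_L2[OF H] by (simp add: L2fun_def)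
  have iS: "set_integrable lborel \<Omega> (\<lambda>x. \<Sum>j\<in>UNIV. (cmod (gr w x $ j))\<^sup>2)"
    using L2ipv_eq(1)[OF L2fun_wgrad[OF H] L2fun_wgrad[OF H]] by (simp only: Re_mult_cnj_self)
  have Ue: "L2ip \<Omega> w w = U"
    using L2ip_eq(2)[OF H1_L2[OF H] H1_L2[OF H]] by (simp only: Re_mult_cnj_self U_def)
  have Se: "L2ipv \<Omega> (gr w) (gr w) = S"
    using L2ipv_eq(2)[OF L2fun_wgrad[OF H] L2fun_wgrad[OF H]] by (simp only: Re_mult_cnj_self S_def)
  have U0: "U \<ge> 0" unfolding U_def set_lebesgue_integral_def by (intro integral_nonneg_AE) auto
  have S0: "S \<ge> 0" unfolding S_def set_lebesgue_integral_def
    by (intro integral_nonneg_AE AE_I2 scaleR_nonneg_nonneg sum_nonneg) auto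
  have "sqrt U \<le> Cp * h * sqrt S"
    using poincare[OF w] by (simp add: L2norm_def L2normv_def Ue Se)
  then have "(sqrt U)\<^sup>2 \<le> (Cp * h * sqrt S)\<^sup>2" using U0 by (intro power_mono) auto
  then have US: "U \<le> Cp\<^sup>2 * h\<^sup>2 * S" using U0 S0 by (simp add: power_mult_distrib)
  have kh2: "h\<^sup>2 \<le> Cr\<^sup>2 / \<kappa>\<^sup>2"
  proof -
    have "h\<^sup>2 \<le> (Cr / \<kappa>)\<^sup>2" using resolution h_pos by (intro power_mono) auto
    then show ?thesis by (simp add: power_divide)
  qed
  \<comment> \<open>The factor \<open>4\<close> in the resolution condition leaves half of the
    available \<open>S / \<kappa>^2 / 2\<close>.\<close>
  have LU: "La\<^sup>2 * U \<le> S / \<kappa>\<^sup>2 / 4"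
  proof -
    have "La\<^sup>2 * U \<le> La\<^sup>2 * (Cp\<^sup>2 * h\<^sup>2 * S)" using US by (intro mult_left_mono) auto
    also have "\<dots> = (La\<^sup>2 * Cp\<^sup>2 * S) * h\<^sup>2" by simp
    also have "\<dots> \<le> (La\<^sup>2 * Cp\<^sup>2 * S) * (Cr\<^sup>2 / \<kappa>\<^sup>2)" using kh2 S0 by (intro mult_left_mono) auto
    also have "\<dots> = (4 * Cp\<^sup>2 * La\<^sup>2 * Cr\<^sup>2) * (S / \<kappa>\<^sup>2 / 4)" by simp
    also have "\<dots> \<le> 1 * (S / \<kappa>\<^sup>2 / 4)" using Cr_bound S0 by (intro mult_right_mono) auto
    finally show ?thesis by simp
  qed
  \<comment> \<open>The gradient is the magnetic gradient minus the potential term; the inequality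
    \<open>|a + b|^2 \<le> 2 |a|^2 + 2 |b|^2\<close> is solved for the former.\<close>
  have low: "AE x \<in> \<Omega> in lborel. (\<Sum>j\<in>UNIV. (cmod (gr w x $ j))\<^sup>2) / \<kappa>\<^sup>2 / 2 - La\<^sup>2 * (cmod (w x))\<^sup>2 + \<beta> * (cmod (w x))\<^sup>2 \<le> ad w w x"
    using A_bound
  proof eventually_elim
    case (elim x)
    show ?case
    proof
      assume "x \<in> \<Omega>"
      then have L: "(norm (A x))\<^sup>2 \<le> La\<^sup>2" using elim by (intro power_mono) auto
      have "(cmod (gr w x $ j))\<^sup>2 / \<kappa>\<^sup>2 / 2 - (A x $ j)\<^sup>2 * (cmod (w x))\<^sup>2 \<le> (cmod (mg w x $ j))\<^sup>2" for j
      proof -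
        have "(\<i> / complex_of_real \<kappa>) * gr w x $ j = mg w x $ j + (- (complex_of_real (A x $ j) * w x))"
          by (simp add: mag_grad_def)
        then have "(cmod ((\<i> / complex_of_real \<kappa>) * gr w x $ j))\<^sup>2 \<le> 2 * (cmod (mg w x $ j))\<^sup>2 + 2 * (cmod (- (complex_of_real (A x $ j) * w x)))\<^sup>2"
          using cmod_add_sq_le by metis
        then show ?thesis using \<kappa>
          by (simp add: norm_mult norm_divide power_mult_distrib power_divide)
      qed
      then have "(\<Sum>j\<in>UNIV. (cmod (gr w x $ j))\<^sup>2 / \<kappa>\<^sup>2 / 2 - (A x $ j)\<^sup>2 * (cmod (w x))\<^sup>2) \<le> (\<Sum>j\<in>UNIV. (cmod (mg w x $ j))\<^sup>2)"
        by (rule sum_mono)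
      moreover have "(\<Sum>j\<in>UNIV. (cmod (gr w x $ j))\<^sup>2 / \<kappa>\<^sup>2 / 2 - (A x $ j)\<^sup>2 * (cmod (w x))\<^sup>2) =
        (\<Sum>j\<in>UNIV. (cmod (gr w x $ j))\<^sup>2) / \<kappa>\<^sup>2 / 2 - (norm (A x))\<^sup>2 * (cmod (w x))\<^sup>2"
        by (simp add: sum_subtractf A_sq_sum[symmetric] sum_divide_distrib sum_distrib_right)
      moreover have "(norm (A x))\<^sup>2 * (cmod (w x))\<^sup>2 \<le> La\<^sup>2 * (cmod (w x))\<^sup>2" using L by (intro mult_right_mono) auto
      ultimately show "(\<Sum>j\<in>UNIV. (cmod (gr w x $ j))\<^sup>2) / \<kappa>\<^sup>2 / 2 - La\<^sup>2 * (cmod (w x))\<^sup>2 + \<beta> * (cmod (w x))\<^sup>2 \<le> ad w w x"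
        unfolding ad_self by linarith
    qed
  qed
  have i1: "set_integrable lborel \<Omega> (\<lambda>x. (\<Sum>j\<in>UNIV. (cmod (gr w x $ j))\<^sup>2) / \<kappa>\<^sup>2 / 2)"
    and i2: "set_integrable lborel \<Omega> (\<lambda>x. La\<^sup>2 * (cmod (w x))\<^sup>2)"
    and i3: "set_integrable lborel \<Omega> (\<lambda>x. \<beta> * (cmod (w x))\<^sup>2)"
    using iS iU by (auto intro!: set_integrable_divide)
  have e1: "(LINT x:\<Omega>|lborel. (\<Sum>j\<in>UNIV. (cmod (gr w x $ j))\<^sup>2) / \<kappa>\<^sup>2 / 2) = S / \<kappa>\<^sup>2 / 2"
    unfolding S_def by (simp only: set_integral_divide_zero)
  have "S / \<kappa>\<^sup>2 / 2 - La\<^sup>2 * U + \<beta> * U = (LINT x:\<Omega>|lborel. (\<Sum>j\<in>UNIV. (cmod (gr w x $ j))\<^sup>2) / \<kappa>\<^sup>2 / 2 - La\<^sup>2 * (cmod (w x))\<^sup>2 + \<beta> * (cmod (w x))\<^sup>2)"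
    using i1 i2 i3 e1 by (subst set_integral_add(2)) (auto simp: set_integral_diff U_def)
  also have "\<dots> \<le> (LINT x:\<Omega>|lborel. ad w w x)"
    using i1 i2 i3 low by (intro set_integral_mono_AE set_integral_add set_integral_diff ad_integrable H)
  finally have up: "S / \<kappa>\<^sup>2 / 2 - La\<^sup>2 * U + \<beta> * U \<le> (LINT x:\<Omega>|lborel. ad w w x)" .
  define Z where "Z = S / \<kappa>\<^sup>2"
  have main: "S / \<kappa>\<^sup>2 / 4 + \<beta> * U \<le> (LINT x:\<Omega>|lborel. ad w w x)"
    using up LU unfolding Z_def[symmetric] by linarith

  have "(LINT x:\<Omega>|lborel. ed w x) = (S + U / h\<^sup>2) / \<kappa>\<^sup>2 + \<beta> * U"
  proof -
    have "(LINT x:\<Omega>|lborel. ed w x) = (LINT x:\<Omega>|lborel. ((\<Sum>j\<in>UNIV. (cmod (gr w x $ j))\<^sup>2) + (cmod (w x))\<^sup>2 / h\<^sup>2) / \<kappa>\<^sup>2) + (LINT x:\<Omega>|lborel. \<beta> * (cmod (w x))\<^sup>2)"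
      unfolding ed_def using iS iU i3 by (intro set_integral_add set_integrable_divide)
    also have "(LINT x:\<Omega>|lborel. ((\<Sum>j\<in>UNIV. (cmod (gr w x $ j))\<^sup>2) + (cmod (w x))\<^sup>2 / h\<^sup>2) / \<kappa>\<^sup>2) = (S + U / h\<^sup>2) / \<kappa>\<^sup>2"
      unfolding S_def U_def set_integral_divide_zero
      using set_integral_add(2)[OF iS set_integrable_divide[OF iU, of "h\<^sup>2"]] by (simp add: set_integral_divide_zero)
    finally show ?thesis by (simp add: U_def)
  qed
  also have "\<dots> \<le> (S + Cp\<^sup>2 * S) / \<kappa>\<^sup>2 + \<beta> * U"
    using US h_pos \<kappa> by (intro add_mono divide_right_mono) (auto simp: divide_le_eq mult_ac)
  also have "\<dots> \<le> Cc * (S / \<kappa>\<^sup>2 / 4) + Cc * (\<beta> * U)"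
  proof (intro add_mono)
    show "(S + Cp\<^sup>2 * S) / \<kappa>\<^sup>2 \<le> Cc * (S / \<kappa>\<^sup>2 / 4)" by (simp add: Cc_def algebra_simps add_divide_distrib)
    have "1 * (\<beta> * U) \<le> Cc * (\<beta> * U)" using \<beta> U0 Cc_ge by (intro mult_right_mono) auto
    then show "\<beta> * U \<le> Cc * (\<beta> * U)" by simp
  qed
  also have "\<dots> = Cc * (S / \<kappa>\<^sup>2 / 4 + \<beta> * U)" by (simp add: distrib_left)
  also have "\<dots> \<le> Cc * (LINT x:\<Omega>|lborel. ad w w x)" using main Cc_ge by (intro mult_left_mono) auto
  finally show ?thesis .
qed

end

section \<open>Orthogonality to discrete functions and integrals over elements\<close>

lemma set_integral_zero_AE:
  fixes f :: "real^'n \<Rightarrow> 'b::{banach, second_countable_topology}"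
  assumes "AE x in lborel. x \<in> K \<longrightarrow> f x = 0"
  shows "(LINT x:K|lborel. f x) = 0"
  unfolding set_lebesgue_integral_def
  by (rule integral_eq_zero_AE) (use assms in \<open>auto simp: indicator_def elim: eventually_mono\<close>)

lemma Vh_cmult:
  assumes "v \<in> Vh \<Omega> \<T>"
  shows "(\<lambda>x. a * v x) \<in> Vh \<Omega> \<T>"
  unfolding Vh_def
proof (intro CollectI conjI ballI)
  show "continuous_on \<Omega> (\<lambda>x. a * v x)" using assms by (auto simp: Vh_def intro!: continuous_intros)
  fix T assume "T \<in> \<T>"
  then obtain c b where "\<And>x. x \<in> T \<Longrightarrow> v x = c + (\<Sum>j\<in>UNIV. b $ j * complex_of_real (x $ j))"
    using assms unfolding Vh_def by blast
  then show "\<exists>c b. \<forall>x\<in>T. a * v x = c + (\<Sum>j\<in>UNIV. b $ j * complex_of_real (x $ j))"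
    by (intro exI[of _ "a * c"] exI[of _ "\<chi> j. a * b $ j"]) (simp add: distrib_left sum_distrib_left mult.assoc)
qed

lemma Vh_cnj:
  assumes "v \<in> Vh \<Omega> \<T>"
  shows "(\<lambda>x. cnj (v x)) \<in> Vh \<Omega> \<T>"
  unfolding Vh_def
proof (intro CollectI conjI ballI)
  show "continuous_on \<Omega> (\<lambda>x. cnj (v x))" using assms by (auto simp: Vh_def intro!: continuous_intros)
  fix T assume "T \<in> \<T>"
  then obtain c b where "\<And>x. x \<in> T \<Longrightarrow> v x = c + (\<Sum>j\<in>UNIV. b $ j * complex_of_real (x $ j))"
    using assms unfolding Vh_def by blast
  then show "\<exists>c b. \<forall>x\<in>T. cnj (v x) = c + (\<Sum>j\<in>UNIV. b $ j * complex_of_real (x $ j))"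
    by (intro exI[of _ "cnj c"] exI[of _ "\<chi> j. cnj (b $ j)"]) simp
qed

lemma Vh_const: "(\<lambda>_. c) \<in> Vh (\<Omega>::(real^'n) set) \<T>"
proof -
  have "\<exists>a (b::complex^'n). \<forall>x\<in>T. c = a + (\<Sum>j\<in>UNIV. b $ j * complex_of_real (x $ j))" for T :: "(real^'n) set"
    by (rule exI[of _ c], rule exI[of _ 0]) simp
  then show ?thesis unfolding Vh_def by simp
qed

text \<open>\<open>W\<close> is defined through real parts of conjugated pairings. Since
  \<open>Vh\<close> is closed under multiplication by the imaginary unit and under conjugation, the
  full complex pairing without conjugation vanishes, which is the form the bubbles can
  correct.\<close>

lemma Wspace_iff:
  assumes \<Omega>: "compact \<Omega>"
  shows "w \<in> Wspace \<Omega> \<T> \<longleftrightarrow> H1 \<Omega> w \<and> (\<forall>q\<in>Vh \<Omega> \<T>. (LINT x:\<Omega>|lborel. w x * q x) = 0)"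
proof
  assume w: "w \<in> Wspace \<Omega> \<T>"
  have re: "Re (LINT x:\<Omega>|lborel. w x * q x) = 0" if "q \<in> Vh \<Omega> \<T>" for q
    using w Vh_cnj[OF that] by (auto simp: Wspace_def is_L2_proj_def L2ip_def)
  have "(LINT x:\<Omega>|lborel. w x * q x) = 0" if q: "q \<in> Vh \<Omega> \<T>" for q
  proof (rule complex_eqI)
    have "(LINT x:\<Omega>|lborel. w x * (\<i> * q x)) = \<i> * (LINT x:\<Omega>|lborel. w x * q x)"
      by (simp flip: set_integral_mult_right add: mult_ac)
    then show "Im (LINT x:\<Omega>|lborel. w x * q x) = Im 0" using re[OF Vh_cmult[OF q, of \<i>]] by simp
  qed (use re[OF q] in simp)
  then show "H1 \<Omega> w \<and> (\<forall>q\<in>Vh \<Omega> \<T>. (LINT x:\<Omega>|lborel. w x * q x) = 0)" using w by (simp add: Wspace_def)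
next
  assume "H1 \<Omega> w \<and> (\<forall>q\<in>Vh \<Omega> \<T>. (LINT x:\<Omega>|lborel. w x * q x) = 0)"
  then show "w \<in> Wspace \<Omega> \<T>" by (auto simp: Wspace_def is_L2_proj_def L2ip_def Vh_const Vh_cnj)
qed

lemma mesh_measure_pos:
  assumes M: "conforming_mesh \<Omega> (\<T>::(real^'n) set set)" "K \<in> \<T>"
  shows "measure lborel K > 0"
proof -
  obtain x where "x \<in> interior K" using mesh_element(7)[OF M] by blast
  then obtain r where r: "r > 0" "ball x r \<subseteq> K" by (auto simp: mem_interior)
  have "0 < measure lborel (ball x r)" by (rule content_ball_pos[OF r(1)])
  also have "\<dots> \<le> measure lborel K"
    by (rule measure_mono_fmeasurable)
       (use r mesh_element(3)[OF M] emeasure_bounded_finite[OF mesh_element(5)[OF M]] in \<open>auto simp: fmeasurable_def\<close>)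
  finally show ?thesis .
qed

lemma mesh_measure_le:
  assumes M: "conforming_mesh \<Omega> (\<T>::(real^'n) set set)" "K \<in> \<T>"
  shows "measure lborel K \<le> 2 ^ CARD('n) * measure lborel (ball (0::real^'n) 1) * mesh_size \<T> ^ CARD('n)"
proof -
  have h: "mesh_size \<T> > 0" by (rule mesh_size_pos[OF M(1)])
  obtain x where x: "x \<in> K" using mesh_element(7)[OF M] interior_subset by blast
  have "K \<subseteq> ball x (2 * mesh_size \<T>)"
    using mesh_dist_le[OF M x] h by force
  then have "measure lborel K \<le> measure lborel (ball x (2 * mesh_size \<T>))"
    using emeasure_lborel_ball_finite[of x "2 * mesh_size \<T>"] mesh_element(4)[OF M]
    by (intro measure_mono_fmeasurable) (auto simp: fmeasurable_def less_top)
  also have "\<dots> = (2 * mesh_size \<T>) ^ CARD('n) * measure lborel (ball (0::real^'n) 1)"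
    using h content_ball_conv_unit_ball[of "2 * mesh_size \<T>" x] by simp
  finally show ?thesis by (simp add: power_mult_distrib mult_ac)
qed

lemma set_integral_const_compact:
  assumes "compact (K :: (real^'n) set)"
  shows "set_integrable lborel K (\<lambda>_. c::real)" "(LINT x:K|lborel. c) = measure lborel K * c"
proof -
  show "set_integrable lborel K (\<lambda>_. c)"
    unfolding set_integrable_def using borel_integrable_compact[OF assms, of "\<lambda>_. c"] by simp
  show "(LINT x:K|lborel. c) = measure lborel K * c"
    using assms by (simp add: set_lebesgue_integral_def)
qed

text \<open>Integrating the nonnegative square of \<open>k * cmod (u x) - m\<close>, with
  \<open>k\<close> the measure and \<open>m\<close> the integral, and dividing by \<open>k\<close>
  gives the estimate.\<close>

lemma set_integral_Cauchy_Schwarz_measure: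
  fixes u :: "real^'n \<Rightarrow> complex"
  assumes K: "compact K" "measure lborel K > 0" and u: "L2fun K u"
  shows "set_integrable lborel K (\<lambda>x. cmod (u x))"
    "(LINT x:K|lborel. cmod (u x))\<^sup>2 \<le> measure lborel K * (LINT x:K|lborel. (cmod (u x))\<^sup>2)"
proof -
  show i1: "set_integrable lborel K (\<lambda>x. cmod (u x))"
    by (rule set_integrable_norm[OF L2fun_integrable[OF K(1) u]])
  have i2: "set_integrable lborel K (\<lambda>x. (cmod (u x))\<^sup>2)" using u by (simp add: L2fun_def)
  define m where "m = (LINT x:K|lborel. cmod (u x))"
  define k where "k = measure lborel K"
  define S where "S = (LINT x:K|lborel. (cmod (u x))\<^sup>2)"
  have sq: "(k * cmod (u x) - m)\<^sup>2 = (k\<^sup>2 * (cmod (u x))\<^sup>2 - 2 * k * m * cmod (u x)) + m\<^sup>2" for x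
    by (simp add: power2_eq_square algebra_simps)
  have "0 \<le> (LINT x:K|lborel. (k * cmod (u x) - m)\<^sup>2)"
    unfolding set_lebesgue_integral_def by (intro integral_nonneg_AE AE_I2 scaleR_nonneg_nonneg) auto
  also have "\<dots> = (LINT x:K|lborel. (k\<^sup>2 * (cmod (u x))\<^sup>2 - 2 * k * m * cmod (u x)) + m\<^sup>2)"
    by (simp only: sq)
  also have "\<dots> = k\<^sup>2 * S - 2 * k * m * m + k * m\<^sup>2"
    using i1 i2 set_integral_const_compact[OF K(1), of "m\<^sup>2"]
    by (subst set_integral_add(2); (intro set_integral_diff set_integrable_mult_right)?)
       (auto simp: set_integral_diff(2) S_def m_def k_def)
  finally have "0 \<le> k * (k * S - m\<^sup>2)" by (simp add: power2_eq_square algebra_simps)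
  then have "0 \<le> k * S - m\<^sup>2" using K(2) by (simp add: k_def zero_le_mult_iff)
  then show "(LINT x:K|lborel. cmod (u x))\<^sup>2 \<le> measure lborel K * (LINT x:K|lborel. (cmod (u x))\<^sup>2)"
    by (simp add: m_def k_def S_def)
qed

section \<open>The localized test function and its energy estimates\<close>

context lod_setting
begin

text \<open>To localise the moments of \<open>\<eta> c\<close> against \<open>q\<close>, subtract the vanishing moment of \<open>c\<close> against the
  interpolant \<open>q'\<close> of the nodal values of \<open>q\<close> on the outer elements: what remains is supported on the
  transition elements.\<close>

lemma test_function:
  assumes c: "c \<in> Wspace \<Omega> \<T>"
    and IJ: "I \<subseteq> J" "J \<subseteq> \<T>" and sep: "\<And>K K'. K \<in> I \<Longrightarrow> K' \<in> \<T> - J \<Longrightarrow> K \<inter> K' = {}"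
    and \<eta>: "smooth_fun \<eta>" "\<And>x. 0 \<le> \<eta> x" "\<And>x. \<eta> x \<le> 1" "\<And>j x. \<bar>pderiv_r \<eta> j x\<bar> \<le> Ce / h"
    and \<eta>0: "\<And>K x. K \<in> I \<Longrightarrow> x \<in> K \<Longrightarrow> \<eta> x = 0"
    and \<eta>1: "\<And>K x. K \<in> \<T> - J \<Longrightarrow> x \<in> K \<Longrightarrow> \<eta> x = 1"
    and MC: "moment_corrector Cm \<Omega> \<T>"
  shows "\<exists>w\<in>Wspace \<Omega> \<T>. (\<forall>K\<in>I. AE x in lborel. x \<in> K \<longrightarrow> w x = 0 \<and> gr w x = 0) \<and>
     (\<forall>K\<in>\<T> - J. AE x in lborel. x \<in> K \<longrightarrow> w x = c x \<and> gr w x = gr c x) \<and>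
     (\<forall>K\<in>J - I. (LINT x:K|lborel. ed w x) \<le>
        (6 + 4 * real CARD('n) * Ce\<^sup>2 + (2 * real CARD('n) + 2) *
          (Cm * (real CARD('n) + 2) * (2 ^ CARD('n) * measure lborel (ball (0::real^'n) 1)))\<^sup>2) * (LINT x:K|lborel. ed c x))"
proof -
  have cH: "H1 \<Omega> c" using c by (simp add: Wspace_def)
  have cL: "L2fun \<Omega> c" by (rule H1_L2[OF cH])
  have fin: "finite \<T>" by (rule mesh_finite[OF mesh])
  define n where "n = real CARD('n)"
  define R where "R = J - I"
  define Out where "Out = \<T> - J"
  have RT: "R \<subseteq> \<T>" using IJ by (auto simp: R_def)
  define Ov where "Ov = (\<Union>K\<in>Out. verts K)"
  have cK: "L2fun K c" if "K \<in> \<T>" for K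
    using cL mesh_element(4,6)[OF mesh that] by (rule L2fun_subset)
  \<comment> \<open>These are the barycentric coordinates of \<open>K\<close>; for \<open>z\<close>
    not a vertex of \<open>K\<close> the condition forces the zero function on
    \<open>K\<close>.\<close>
  have "\<forall>K\<in>\<T>. \<forall>z. \<exists>f. affine_fun f \<and> (\<forall>y\<in>verts K. f y = (if y = z then 1 else 0))"
  proof (intro ballI allI)
    fix K z assume "K \<in> \<T>"
    then show "\<exists>f. affine_fun f \<and> (\<forall>y\<in>verts K. f y = (if y = z then 1 else 0))"
      using affine_fun_interpolate[OF mesh_verts(3)[OF mesh], of K "\<lambda>y. if y = z then 1 else 0"] by blast
  qed
  then obtain \<Lambda> where \<Lambda>: "\<And>K z. K \<in> \<T> \<Longrightarrow> affine_fun (\<Lambda> K z)"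
    "\<And>K z y. K \<in> \<T> \<Longrightarrow> y \<in> verts K \<Longrightarrow> \<Lambda> K z y = (if y = z then 1 else 0)" by metis
  have \<Lambda>1: "cmod (\<Lambda> K z x) \<le> 1" if "K \<in> \<T>" "x \<in> K" for K z x
  proof (rule affine_fun_bound_on_hull[OF \<Lambda>(1)[OF that(1)]])
    show "x \<in> convex hull (verts K)" using that(2) mesh_verts(4)[OF mesh that(1)] by simp
  qed (simp add: \<Lambda>(2)[OF that(1)])
  \<comment> \<open>The subtracted sum interpolates \<open>q\<close> at the vertices shared with
    outer elements. Inside, cutoff and sum both vanish; outside, they cancel for affine
    \<open>q\<close>; only transition elements keep a contribution.\<close>
  define G where "G K q x = complex_of_real (\<eta> x) * q x - (\<Sum>z\<in>verts K \<inter> Ov. q z * \<Lambda> K z x)" for K q x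
  define F where "F K q = (LINT x:K|lborel. c x * G K q x)" for K q
  \<comment> \<open>One unit for the cutoff term and at most \<open>n + 1\<close> for the vertices
    of the interpolant.\<close>
  define D where "D K = (n + 2) * (LINT x:K|lborel. cmod (c x))" for K
  have Gc: "continuous_on K (G K q)" if "K \<in> \<T>" "continuous_on K q" for K q
    unfolding G_def[abs_def]
    by (intro continuous_intros continuous_on_smooth_complex \<eta> that affine_fun_continuous \<Lambda>)
  have Gi: "set_integrable lborel K (\<lambda>x. c x * G K q x)" if "K \<in> \<T>" "continuous_on K q" for K q
    by (intro L2fun_mult_integrable[OF cK[OF that(1)]] L2fun_continuous mesh_element(1)[OF mesh that(1)] Gc that)
  have Fadd: "F K (\<lambda>x. q x + r x) = F K q + F K r" if "K \<in> R" "affine_fun q" "affine_fun r" for K q r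
  proof -
    have KT: "K \<in> \<T>" using that RT by blast
    have "c x * G K (\<lambda>x. q x + r x) x = c x * G K q x + c x * G K r x" for x
      by (simp add: G_def algebra_simps sum.distrib)
    then show ?thesis unfolding F_def
      using set_integral_add(2)[OF Gi[OF KT affine_fun_continuous[OF that(2)]] Gi[OF KT affine_fun_continuous[OF that(3)]]] by simp
  qed
  have Fmult: "F K (\<lambda>x. a * q x) = a * F K q" for K q a
  proof -
    have "c x * G K (\<lambda>x. a * q x) x = a * (c x * G K q x)" for x
      by (simp add: G_def algebra_simps sum_distrib_left)
    then show ?thesis unfolding F_def by (simp only: set_integral_mult_right)
  qed
  have Fcong: "F K q = F K r" if "K \<in> R" "\<And>x. x \<in> K \<Longrightarrow> q x = r x" for K q r
  proof -
    have KT: "K \<in> \<T>" using that RT by blast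
    have "(\<Sum>z\<in>verts K \<inter> Ov. q z * \<Lambda> K z x) = (\<Sum>z\<in>verts K \<inter> Ov. r z * \<Lambda> K z x)" for x
      using that(2) mesh_verts(5)[OF mesh KT] by (intro sum.cong) auto
    then have "c x * G K q x = c x * G K r x" if "x \<in> K" for x
      using \<open>\<And>x. x \<in> K \<Longrightarrow> q x = r x\<close>[OF that] by (simp add: G_def)
    then show ?thesis unfolding F_def using mesh_element(4)[OF mesh KT]
      by (intro set_lebesgue_integral_cong) auto
  qed
  have Fbnd: "cmod (F K q) \<le> m * D K" if KR: "K \<in> R" and qa: "affine_fun q" and qm: "\<And>x. x \<in> K \<Longrightarrow> cmod (q x) \<le> m" for K q m
  proof -
    have KT: "K \<in> \<T>" using KR RT by blast
    note i = Gi[OF KT affine_fun_continuous[OF qa]]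
    have ic: "set_integrable lborel K (\<lambda>x. cmod (c x))"
      by (rule set_integrable_norm[OF L2fun_integrable[OF mesh_element(1)[OF mesh KT] cK[OF KT]]])
    obtain y where "y \<in> K" using mesh_element(7)[OF mesh KT] interior_subset by blast
    then have m0: "m \<ge> 0" using order_trans[OF norm_ge_zero qm] by blast
    have GB: "cmod (G K q x) \<le> m * (n + 2)" if x: "x \<in> K" for x
    proof -
      have "cmod (\<Sum>z\<in>verts K \<inter> Ov. q z * \<Lambda> K z x) \<le> (\<Sum>z\<in>verts K \<inter> Ov. m * 1)"
      proof (rule sum_norm_le)
        fix z assume "z \<in> verts K \<inter> Ov"
        then have "z \<in> K" using mesh_verts(5)[OF mesh KT] by blast
        then show "cmod (q z * \<Lambda> K z x) \<le> m * 1"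
          unfolding norm_mult using qm \<Lambda>1[OF KT x] m0 by (intro mult_mono) auto
      qed
      also have "\<dots> \<le> (n + 1) * m"
      proof -
        have "card (verts K \<inter> Ov) \<le> CARD('n) + 1"
          using card_mono[OF mesh_verts(1)[OF mesh KT], of "verts K \<inter> Ov"] mesh_verts(2)[OF mesh KT] by simp
        then have "real (card (verts K \<inter> Ov)) \<le> n + 1" unfolding n_def by linarith
        then show ?thesis using m0 by (simp add: mult_right_mono)
      qed
      finally have 1: "cmod (\<Sum>z\<in>verts K \<inter> Ov. q z * \<Lambda> K z x) \<le> (n + 1) * m" .
      have "cmod (complex_of_real (\<eta> x) * q x) \<le> 1 * m"
        unfolding norm_mult using \<eta>(2,3)[of x] qm[OF x] by (intro mult_mono) auto
      then show ?thesis unfolding G_def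
        using norm_triangle_ineq4[of "complex_of_real (\<eta> x) * q x" "\<Sum>z\<in>verts K \<inter> Ov. q z * \<Lambda> K z x"] 1
        by (simp add: algebra_simps)
    qed
    have "cmod (F K q) \<le> (LINT x:K|lborel. norm (c x * G K q x))"
      unfolding F_def by (rule set_integral_norm_bound[OF i])
    also have "\<dots> \<le> (LINT x:K|lborel. (m * (n + 2)) * cmod (c x))"
    proof (rule set_integral_mono[OF set_integrable_norm[OF i]])
      show "set_integrable lborel K (\<lambda>x. (m * (n + 2)) * cmod (c x))" using ic by (intro set_integrable_mult_right)
      show "norm (c x * G K q x) \<le> (m * (n + 2)) * cmod (c x)" if "x \<in> K" for x
        using mult_left_mono[OF GB[OF that] norm_ge_zero[of "c x"]] by (simp add: norm_mult mult_ac)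
    qed
    also have "\<dots> = m * D K" by (simp add: D_def)
    finally show ?thesis .
  qed
  have "\<forall>K\<in>R. \<forall>q r. affine_fun q \<longrightarrow> affine_fun r \<longrightarrow> F K (\<lambda>x. q x + r x) = F K q + F K r"
    by (intro ballI allI impI) (rule Fadd)
  moreover have "\<forall>K\<in>R. \<forall>q a. affine_fun q \<longrightarrow> F K (\<lambda>x. a * q x) = a * F K q"
    by (intro ballI allI impI) (rule Fmult)
  moreover have "\<forall>K\<in>R. \<forall>q r. (\<forall>x\<in>K. q x = r x) \<longrightarrow> F K q = F K r"
    by (intro ballI allI impI) (rule Fcong, auto)
  moreover have "\<forall>K\<in>R. \<forall>q m. affine_fun q \<longrightarrow> (\<forall>x\<in>K. cmod (q x) \<le> m) \<longrightarrow> cmod (F K q) \<le> m * D K"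
    by (intro ballI allI impI) (rule Fbnd, auto)
  ultimately have "\<exists>p g. L2fun \<Omega> p \<and> is_weak_grad \<Omega> p g \<and>
      (\<forall>v\<in>Vh \<Omega> \<T>. (LINT x:\<Omega>|lborel. p x * v x) = (\<Sum>K\<in>R. F K v)) \<and>
      (\<forall>K\<in>\<T> - R. \<forall>x\<in>interior K. p x = 0 \<and> g x = 0) \<and>
      (\<forall>K\<in>R. \<forall>x\<in>interior K. cmod (p x) \<le> Cm * D K / h ^ CARD('n) \<and>
         (\<forall>j. cmod (g x $ j) \<le> Cm * D K / h ^ CARD('n) / h))"
    by (rule MC[unfolded moment_corrector_def, THEN spec[of _ R], THEN spec[of _ F], THEN spec[of _ D],
        THEN mp, THEN mp, THEN mp, THEN mp, THEN mp, OF RT])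
  then obtain p g where p: "L2fun \<Omega> p" "is_weak_grad \<Omega> p g"
    and pm: "\<And>v. v \<in> Vh \<Omega> \<T> \<Longrightarrow> (LINT x:\<Omega>|lborel. p x * v x) = (\<Sum>K\<in>R. F K v)"
    and p0: "\<And>K x. K \<in> \<T> - R \<Longrightarrow> x \<in> interior K \<Longrightarrow> p x = 0 \<and> g x = 0"
    and pb: "\<And>K x. K \<in> R \<Longrightarrow> x \<in> interior K \<Longrightarrow> cmod (p x) \<le> Cm * D K / h ^ CARD('n)"
    and gb: "\<And>K x j. K \<in> R \<Longrightarrow> x \<in> interior K \<Longrightarrow> cmod (g x $ j) \<le> Cm * D K / h ^ CARD('n) / h"
    by blast
  define w where "w x = complex_of_real (\<eta> x) * c x + (-1) * p x" for x
  define gw :: "real^'n \<Rightarrow> complex^'n" where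
    "gw x = (\<chi> j. complex_of_real (\<eta> x) * gr c x $ j + complex_of_real (pderiv_r \<eta> j x) * c x) + (\<chi> j. (-1) * g x $ j)" for x
  have \<eta>cL: "L2fun \<Omega> (\<lambda>x. complex_of_real (\<eta> x) * c x)"
    by (intro L2fun_cont_mult \<Omega> cL continuous_on_smooth_complex \<eta>)
  have pL: "L2fun \<Omega> (\<lambda>x. (-1) * p x)"
    using \<Omega>(1) by (intro L2fun_cmult p) (simp add: borel_closed compact_imp_closed)
  have wg: "is_weak_grad \<Omega> w gw"
    unfolding w_def[abs_def] gw_def[abs_def]
    by (intro weak_grad_add \<Omega> \<eta>cL pL weak_grad_smooth_mult cL is_weak_grad_wgrad[OF cH] \<eta> weak_grad_cmult p)
  have wH: "H1 \<Omega> w" unfolding H1_def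
  proof
    show "L2fun \<Omega> w" unfolding w_def[abs_def] by (intro L2fun_add \<eta>cL pL)
  qed (use wg in blast)
  have gwAE: "AE x in lborel. x \<in> interior \<Omega> \<longrightarrow> gr w x = gw x" by (rule wgrad_eq_AE[OF \<Omega>(1) wg])
  have d0: "pderiv_r \<eta> j x = 0" if "K \<in> I \<union> Out" "x \<in> interior K" for K x j
  proof (cases "K \<in> I")
    case True
    have "pderiv_r \<eta> j x = pderiv_r (\<lambda>_. 0) j x"
      by (rule pderiv_r_local[OF open_interior that(2)]) (use \<eta>0[OF True] interior_subset in blast)
    then show ?thesis by simp
  next
    case False
    then have "K \<in> \<T> - J" using that by (simp add: Out_def)
    then have "pderiv_r \<eta> j x = pderiv_r (\<lambda>_. 1) j x"
      by (intro pderiv_r_local[OF open_interior that(2)]) (use \<eta>1 interior_subset in blast)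
    then show ?thesis by simp
  qed
  have inner: "AE x in lborel. x \<in> K \<longrightarrow> w x = 0 \<and> gr w x = 0" if K: "K \<in> I" for K
  proof (rule AE_on_mesh_element[OF mesh _ gwAE])
    show "K \<in> \<T>" using K IJ by blast
    fix x assume x: "x \<in> interior K" "gr w x = gw x"
    have "p x = 0 \<and> g x = 0" using p0[of K x] K x IJ by (auto simp: R_def)
    moreover have "\<eta> x = 0" using \<eta>0[OF K] x interior_subset by blast
    ultimately show "w x = 0 \<and> gr w x = 0"
      using d0[of K x] K x by (simp add: w_def gw_def vec_eq_iff)
  qed
  have outer: "AE x in lborel. x \<in> K \<longrightarrow> w x = c x \<and> gr w x = gr c x" if K: "K \<in> \<T> - J" for K
  proof (rule AE_on_mesh_element[OF mesh _ gwAE])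
    show "K \<in> \<T>" using K by blast
    fix x assume x: "x \<in> interior K" "gr w x = gw x"
    have "p x = 0 \<and> g x = 0" using p0[of K x] K x by (auto simp: R_def)
    moreover have "\<eta> x = 1" using \<eta>1[OF K] x interior_subset by blast
    ultimately show "w x = c x \<and> gr w x = gr c x"
      using d0[of K x] K x by (simp add: w_def gw_def vec_eq_iff Out_def)
  qed
  have wW: "w \<in> Wspace \<Omega> \<T>"
    unfolding Wspace_iff[OF \<Omega>(1)]
  proof (intro conjI ballI wH)
    fix q assume q: "q \<in> Vh \<Omega> \<T>"
    have qc: "continuous_on \<Omega> q" using q by (simp add: Vh_def)
    have qL: "L2fun \<Omega> q" by (rule L2fun_continuous[OF \<Omega>(1) qc])
    obtain q' where q': "q' \<in> Vh \<Omega> \<T>" "\<And>K z. K \<in> \<T> \<Longrightarrow> z \<in> verts K \<Longrightarrow> q' z = (if z \<in> Ov then q z else 0)"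
      using Vh_interpolate[OF mesh, of "\<lambda>z. if z \<in> Ov then q z else 0"] by blast
    have q'L: "L2fun \<Omega> q'" using q'(1) by (intro L2fun_continuous \<Omega>) (simp add: Vh_def)
    have i1: "set_integrable lborel \<Omega> (\<lambda>x. (complex_of_real (\<eta> x) * c x) * q x)" by (rule L2fun_mult_integrable[OF \<eta>cL qL])
    have i2: "set_integrable lborel \<Omega> (\<lambda>x. c x * q' x)" by (rule L2fun_mult_integrable[OF cL q'L])
    have q'_eq: "q' x = (\<Sum>z\<in>verts K \<inter> Ov. q z * \<Lambda> K z x)" if K: "K \<in> \<T>" "x \<in> K" for K x
    proof -
      obtain f where f: "affine_fun f" "\<And>x. x \<in> K \<Longrightarrow> q' x = f x" using Vh_affine[OF q'(1) K(1)] by blast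
      have "f x = (\<Sum>z\<in>verts K \<inter> Ov. q z * \<Lambda> K z x)"
      proof (rule affine_fun_eq_on_hull[OF f(1)])
        show "affine_fun (\<lambda>x. \<Sum>z\<in>verts K \<inter> Ov. q z * \<Lambda> K z x)"
          by (intro affine_fun_sum affine_fun_cmult \<Lambda> K)
        show "x \<in> convex hull (verts K)" using K mesh_verts(4)[OF mesh K(1)] by simp
        fix y assume y: "y \<in> verts K"
        have "(\<Sum>z\<in>verts K \<inter> Ov. q z * \<Lambda> K z y) = (\<Sum>z\<in>verts K \<inter> Ov. if z = y then q z else 0)"
          using \<Lambda>(2)[OF K(1) y] by (intro sum.cong) auto
        also have "\<dots> = (if y \<in> Ov then q y else 0)"
          using y mesh_verts(1)[OF mesh K(1)] by simp
        finally show "f y = (\<Sum>z\<in>verts K \<inter> Ov. q z * \<Lambda> K z y)"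
          using q'(2)[OF K(1) y] f(2)[of y] y mesh_verts(5)[OF mesh K(1)] by (metis subsetD)
      qed
      then show ?thesis using f(2)[OF K(2)] by simp
    qed
    have loc: "(LINT x:K|lborel. (complex_of_real (\<eta> x) * c x) * q x) - (LINT x:K|lborel. c x * q' x) = (if K \<in> R then F K q else 0)"
      if K: "K \<in> \<T>" for K
    proof -
      have Kb: "K \<in> sets lborel" using mesh_element(4)[OF mesh K] by simp
      have KO: "K \<subseteq> \<Omega>" by (rule mesh_element(6)[OF mesh K])
      have "(LINT x:K|lborel. (complex_of_real (\<eta> x) * c x) * q x) - (LINT x:K|lborel. c x * q' x)
        = (LINT x:K|lborel. (complex_of_real (\<eta> x) * c x) * q x - c x * q' x)"
        by (rule set_integral_diff(2)[symmetric]) (rule set_integrable_subset[OF i1 Kb KO], rule set_integrable_subset[OF i2 Kb KO])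
      also have "\<dots> = (LINT x:K|lborel. c x * G K q x)"
        using q'_eq[OF K] by (intro set_lebesgue_integral_cong Kb) (auto simp: G_def algebra_simps)
      also have "\<dots> = (if K \<in> R then F K q else 0)"
      proof (cases "K \<in> R")
        case False
        then consider "K \<in> I" | "K \<in> Out" using K by (auto simp: R_def Out_def)
        then have "c x * G K q x = 0" if x: "x \<in> K" for x
        proof cases
          case 1
          \<comment> \<open>An inner element shares no vertex with an outer one; this is the use of
            the separation hypothesis \<open>sep\<close>.\<close>
          have "verts K \<inter> Ov = {}"
          proof (rule ccontr)
            assume "verts K \<inter> Ov \<noteq> {}"
            then obtain z K' where "z \<in> verts K" "K' \<in> Out" "z \<in> verts K'" by (auto simp: Ov_def)
            moreover have "K' \<in> \<T>" using \<open>K' \<in> Out\<close> by (simp add: Out_def)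
            ultimately have "z \<in> K \<inter> K'" using mesh_verts(5)[OF mesh] K by blast
            then show False using sep[OF 1, of K'] \<open>K' \<in> Out\<close> by (auto simp: Out_def)
          qed
          then show ?thesis using \<eta>0[OF 1 x] by (simp add: G_def)
        next
          case 2
          \<comment> \<open>All vertices count on an outer element, so the sum reproduces the affine
            function \<open>q\<close> and cancels \<open>\<eta> * q = q\<close>.\<close>
          have "verts K \<inter> Ov = verts K" using 2 by (auto simp: Ov_def)
          obtain f where f: "affine_fun f" "\<And>x. x \<in> K \<Longrightarrow> q x = f x" using Vh_affine[OF q K] by blast
          have "f x = (\<Sum>z\<in>verts K. q z * \<Lambda> K z x)"
          proof (rule affine_fun_eq_on_hull[OF f(1)])
            show "affine_fun (\<lambda>x. \<Sum>z\<in>verts K. q z * \<Lambda> K z x)"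
              by (intro affine_fun_sum affine_fun_cmult \<Lambda> K)
            show "x \<in> convex hull (verts K)" using x mesh_verts(4)[OF mesh K] by simp
            fix y assume y: "y \<in> verts K"
            have "(\<Sum>z\<in>verts K. q z * \<Lambda> K z y) = (\<Sum>z\<in>verts K. if z = y then q z else 0)"
              using \<Lambda>(2)[OF K y] by (intro sum.cong) auto
            also have "\<dots> = q y" using y mesh_verts(1)[OF mesh K] by simp
            finally show "f y = (\<Sum>z\<in>verts K. q z * \<Lambda> K z y)"
              using f(2)[of y] y mesh_verts(5)[OF mesh K] by (metis subsetD)
          qed
          then show ?thesis using \<open>verts K \<inter> Ov = verts K\<close> \<eta>1[of K x] 2 f(2)[OF x] x
            by (simp add: G_def Out_def)
        qed
        then have "(LINT x:K|lborel. c x * G K q x) = (LINT x:K|lborel. 0)"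
          by (intro set_lebesgue_integral_cong Kb) auto
        then show ?thesis using False by simp
      qed (simp add: F_def)
      finally show ?thesis .
    qed
    have "(LINT x:\<Omega>|lborel. (complex_of_real (\<eta> x) * c x) * q x) - (LINT x:\<Omega>|lborel. c x * q' x) =
      (\<Sum>K\<in>\<T>. (LINT x:K|lborel. (complex_of_real (\<eta> x) * c x) * q x) - (LINT x:K|lborel. c x * q' x))"
      using set_integral_mesh_sum[OF mesh order_refl i1] set_integral_mesh_sum[OF mesh order_refl i2]
      by (simp add: mesh_Union[OF mesh] sum_subtractf)
    also have "\<dots> = (\<Sum>K\<in>\<T>. if K \<in> R then F K q else 0)" using loc by (intro sum.cong) auto
    also have "\<dots> = (\<Sum>K\<in>R. F K q)"
      using RT fin by (simp add: sum.If_cases Int_absorb1)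
    finally have "(LINT x:\<Omega>|lborel. (complex_of_real (\<eta> x) * c x) * q x) = (\<Sum>K\<in>R. F K q)"
      using c q'(1) by (simp add: Wspace_iff[OF \<Omega>(1)])
    moreover have "(LINT x:\<Omega>|lborel. w x * q x) = (LINT x:\<Omega>|lborel. (complex_of_real (\<eta> x) * c x) * q x) - (LINT x:\<Omega>|lborel. p x * q x)"
      using set_integral_diff(2)[OF i1 L2fun_mult_integrable[OF p(1) qL]] by (simp add: w_def left_diff_distrib)
    ultimately show "(LINT x:\<Omega>|lborel. w x * q x) = 0" using pm[OF q] by simp
  qed
  define V where "V = 2 ^ CARD('n) * measure lborel (ball (0::real^'n) 1)"
  define B where "B = (Cm * (n + 2) * V)\<^sup>2"
  have bound: "(LINT x:K|lborel. ed w x) \<le> (6 + 4 * n * Ce\<^sup>2 + (2 * n + 2) * B) * (LINT x:K|lborel. ed c x)" if K: "K \<in> R" for K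
  proof -
    have KT: "K \<in> \<T>" using K RT by blast
    have Kb: "K \<in> sets lborel" using mesh_element(4)[OF mesh KT] by simp
    have KO: "K \<subseteq> \<Omega>" by (rule mesh_element(6)[OF mesh KT])
    define P where "P = Cm * D K / h ^ CARD('n)"
    define S where "S = (LINT x:K|lborel. (cmod (c x))\<^sup>2)"
    \<comment> \<open>Exactly the weight of the squared modulus in \<open>ed\<close>. Values and
      gradients of the bubbles both cost at most a multiple of it, and \<open>e * S\<close> is again
      part of the energy of \<open>c\<close>.\<close>
    define e where "e = 1 / (h\<^sup>2 * \<kappa>\<^sup>2) + \<beta>"
    have e0: "e \<ge> 0" using \<beta> by (simp add: e_def)
    have n0: "n \<ge> 0" by (simp add: n_def)
    have iw: "set_integrable lborel K (ed w)" and ic: "set_integrable lborel K (ed c)"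
      using set_integrable_subset[OF ed_integrable[OF wH] Kb KO] set_integrable_subset[OF ed_integrable[OF cH] Kb KO] .
    have iS: "set_integrable lborel K (\<lambda>x. (cmod (c x))\<^sup>2)" using cK[OF KT] by (simp add: L2fun_def)
    \<comment> \<open>The first coefficient dominates \<open>4\<close> for the gradient,
      \<open>4 * n * Ce^2 + 2\<close> for the weighted \<open>L^2\<close> part, where the slope of
      the cutoff enters, and \<open>2\<close> for the \<beta> part.\<close>
    have pt: "AE x in lborel. x \<in> K \<longrightarrow> ed w x \<le> (6 + 4 * n * Ce\<^sup>2) * ed c x + (2 * n + 2) * e * P\<^sup>2"
    proof (rule AE_on_mesh_element[OF mesh KT gwAE])
      fix x assume x: "x \<in> interior K" "gr w x = gw x"
      define U where "U = (cmod (c x))\<^sup>2"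
      define Sg where "Sg = (\<Sum>j\<in>UNIV. (cmod (gr c x $ j))\<^sup>2)"
      have U0: "U \<ge> 0" "Sg \<ge> 0" by (auto simp: U_def Sg_def intro: sum_nonneg)
      have \<eta>x: "\<bar>\<eta> x\<bar> \<le> 1" using \<eta>(2,3)[of x] by simp
      have pP: "(cmod (p x))\<^sup>2 \<le> P\<^sup>2" using pb[OF K x(1)] by (intro power_mono) (auto simp: P_def)
      have gP: "(cmod (g x $ j))\<^sup>2 \<le> P\<^sup>2 / h\<^sup>2" for j
      proof -
        have "(cmod (g x $ j))\<^sup>2 \<le> (P / h)\<^sup>2" using gb[OF K x(1), of j] by (intro power_mono) (auto simp: P_def)
        then show ?thesis by (simp add: power_divide)
      qed
      have \<eta>c2: "(cmod (complex_of_real (\<eta> x) * y))\<^sup>2 \<le> (cmod y)\<^sup>2" for y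
      proof -
        have "cmod (complex_of_real (\<eta> x) * y) \<le> 1 * cmod y" unfolding norm_mult using \<eta>x by (intro mult_right_mono) auto
        then show ?thesis by (intro power_mono) auto
      qed
      have np: "(cmod ((-1) * p x))\<^sup>2 = (cmod (p x))\<^sup>2" by simp
      have w2: "(cmod (w x))\<^sup>2 \<le> 2 * U + 2 * P\<^sup>2"
        using cmod_add_sq_le[of "complex_of_real (\<eta> x) * c x" "(-1) * p x"] \<eta>c2[of "c x"] pP np
        unfolding w_def U_def by linarith
      have g2: "(cmod (gr w x $ j))\<^sup>2 \<le> 4 * (cmod (gr c x $ j))\<^sup>2 + 4 * (Ce\<^sup>2 / h\<^sup>2 * U) + 2 * (P\<^sup>2 / h\<^sup>2)" for j
      proof -
        have "(cmod (complex_of_real (pderiv_r \<eta> j x) * c x))\<^sup>2 = \<bar>pderiv_r \<eta> j x\<bar>\<^sup>2 * U"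
          by (simp add: norm_mult power_mult_distrib U_def)
        also have "\<dots> \<le> (Ce / h)\<^sup>2 * U" using \<eta>(4)[of j x] U0 by (intro mult_right_mono power_mono) auto
        finally have 1: "(cmod (complex_of_real (pderiv_r \<eta> j x) * c x))\<^sup>2 \<le> Ce\<^sup>2 / h\<^sup>2 * U" by (simp add: power_divide)
        have "gr w x $ j = (complex_of_real (\<eta> x) * gr c x $ j + complex_of_real (pderiv_r \<eta> j x) * c x) + (-1) * g x $ j"
          using x(2) by (simp add: gw_def)
        then have "(cmod (gr w x $ j))\<^sup>2 \<le> 2 * (cmod (complex_of_real (\<eta> x) * gr c x $ j + complex_of_real (pderiv_r \<eta> j x) * c x))\<^sup>2 + 2 * (cmod ((-1) * g x $ j))\<^sup>2"
          using cmod_add_sq_le by metis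
        moreover have "(cmod ((-1) * g x $ j))\<^sup>2 = (cmod (g x $ j))\<^sup>2" by simp
        ultimately show ?thesis
          using cmod_add_sq_le[of "complex_of_real (\<eta> x) * gr c x $ j" "complex_of_real (pderiv_r \<eta> j x) * c x"]
            1 \<eta>c2[of "gr c x $ j"] gP[of j] by linarith
      qed
      have "(\<Sum>j\<in>UNIV. (cmod (gr w x $ j))\<^sup>2) \<le> (\<Sum>j\<in>UNIV. 4 * (cmod (gr c x $ j))\<^sup>2 + 4 * (Ce\<^sup>2 / h\<^sup>2 * U) + 2 * (P\<^sup>2 / h\<^sup>2))"
        by (intro sum_mono g2)
      also have "\<dots> = 4 * Sg + n * (4 * (Ce\<^sup>2 / h\<^sup>2 * U)) + n * (2 * (P\<^sup>2 / h\<^sup>2))"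
        by (simp add: sum.distrib Sg_def sum_distrib_left n_def)
      finally have gs: "(\<Sum>j\<in>UNIV. (cmod (gr w x $ j))\<^sup>2) \<le> 4 * Sg + n * (4 * (Ce\<^sup>2 / h\<^sup>2 * U)) + n * (2 * (P\<^sup>2 / h\<^sup>2))" .
      have "ed w x \<le> ((4 * Sg + n * (4 * (Ce\<^sup>2 / h\<^sup>2 * U)) + n * (2 * (P\<^sup>2 / h\<^sup>2))) + (2 * U + 2 * P\<^sup>2) / h\<^sup>2) / \<kappa>\<^sup>2 + \<beta> * (2 * U + 2 * P\<^sup>2)"
        unfolding ed_def using gs w2 \<beta> by (intro add_mono divide_right_mono mult_left_mono) auto
      also have "\<dots> = 4 * (Sg / \<kappa>\<^sup>2) + (4 * n * Ce\<^sup>2 + 2) * (U / h\<^sup>2 / \<kappa>\<^sup>2) + 2 * (\<beta> * U) + ((2 * n + 2) * (1 / (h\<^sup>2 * \<kappa>\<^sup>2)) + 2 * \<beta>) * P\<^sup>2"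
        using h_pos \<kappa> by (simp add: field_simps)
      also have "\<dots> \<le> (6 + 4 * n * Ce\<^sup>2) * (Sg / \<kappa>\<^sup>2) + (6 + 4 * n * Ce\<^sup>2) * (U / h\<^sup>2 / \<kappa>\<^sup>2) + (6 + 4 * n * Ce\<^sup>2) * (\<beta> * U) + ((2 * n + 2) * (1 / (h\<^sup>2 * \<kappa>\<^sup>2)) + (2 * n + 2) * \<beta>) * P\<^sup>2"
      proof -
        have z: "0 \<le> 4 * n * Ce\<^sup>2" using n0 by simp
        have r: "0 \<le> Sg / \<kappa>\<^sup>2" "0 \<le> U / h\<^sup>2 / \<kappa>\<^sup>2" "0 \<le> \<beta> * U" using U0 \<beta> by auto
        have "4 * (Sg / \<kappa>\<^sup>2) \<le> (6 + 4 * n * Ce\<^sup>2) * (Sg / \<kappa>\<^sup>2)"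
          by (rule mult_right_mono[OF _ r(1)]) (use z in linarith)
        moreover have "(4 * n * Ce\<^sup>2 + 2) * (U / h\<^sup>2 / \<kappa>\<^sup>2) \<le> (6 + 4 * n * Ce\<^sup>2) * (U / h\<^sup>2 / \<kappa>\<^sup>2)"
          by (rule mult_right_mono[OF _ r(2)]) linarith
        moreover have "2 * (\<beta> * U) \<le> (6 + 4 * n * Ce\<^sup>2) * (\<beta> * U)"
          by (rule mult_right_mono[OF _ r(3)]) (use z in linarith)
        moreover have "((2 * n + 2) * (1 / (h\<^sup>2 * \<kappa>\<^sup>2)) + 2 * \<beta>) * P\<^sup>2 \<le> ((2 * n + 2) * (1 / (h\<^sup>2 * \<kappa>\<^sup>2)) + (2 * n + 2) * \<beta>) * P\<^sup>2"
          using \<beta> n0 by (intro mult_right_mono add_left_mono) auto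
        ultimately show ?thesis by linarith
      qed
      also have "\<dots> = (6 + 4 * n * Ce\<^sup>2) * ed c x + (2 * n + 2) * e * P\<^sup>2"
        by (simp add: ed_def U_def Sg_def e_def distrib_left distrib_right add_divide_distrib)
      finally show "ed w x \<le> (6 + 4 * n * Ce\<^sup>2) * ed c x + (2 * n + 2) * e * P\<^sup>2" .
    qed
    have iP: "set_integrable lborel K (\<lambda>x. (2 * n + 2) * e * P\<^sup>2)"
      by (rule set_integral_const_compact(1)[OF mesh_element(1)[OF mesh KT]])
    have "(LINT x:K|lborel. ed w x) \<le> (LINT x:K|lborel. (6 + 4 * n * Ce\<^sup>2) * ed c x + (2 * n + 2) * e * P\<^sup>2)"
      using pt by (intro set_integral_mono_AE[OF iw] set_integral_add set_integrable_mult_right ic iP) auto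
    also have "\<dots> = (6 + 4 * n * Ce\<^sup>2) * (LINT x:K|lborel. ed c x) + measure lborel K * ((2 * n + 2) * e * P\<^sup>2)"
      using set_integral_add(2)[OF set_integrable_mult_right[of "6 + 4 * n * Ce\<^sup>2", OF ic] iP]
        set_integral_const_compact(2)[OF mesh_element(1)[OF mesh KT], of "(2 * n + 2) * e * P\<^sup>2"] by simp
    also have "measure lborel K * ((2 * n + 2) * e * P\<^sup>2) = (2 * n + 2) * e * (measure lborel K * P\<^sup>2)" by simp
    \<comment> \<open>\<open>P\<close> contains the integral of \<open>cmod c\<close>;
      Cauchy-Schwarz contributes one power of the volume of \<open>K\<close>, the outer integral a
      second, and these two cancel the powers of \<open>h\<close> in the denominator.\<close>
    also have "\<dots> \<le> (2 * n + 2) * e * (B * S)"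
    proof (rule mult_left_mono)
      define k where "k = measure lborel K"
      have k: "0 \<le> k" "k \<le> V * h ^ CARD('n)"
        using mesh_measure_le[OF mesh KT] by (auto simp: k_def V_def)
      have CS: "(LINT x:K|lborel. cmod (c x))\<^sup>2 \<le> k * S"
        unfolding k_def S_def
        by (rule set_integral_Cauchy_Schwarz_measure(2)[OF mesh_element(1)[OF mesh KT] mesh_measure_pos[OF mesh KT] cK[OF KT]])
      have S0: "S \<ge> 0" unfolding S_def set_lebesgue_integral_def by (intro integral_nonneg_AE) auto
      define H where "H = h ^ CARD('n)"
      have H: "H > 0" using h_pos by (simp add: H_def)
      have "k * P\<^sup>2 = k * ((Cm * (n + 2))\<^sup>2 * (LINT x:K|lborel. cmod (c x))\<^sup>2 / H\<^sup>2)"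
        by (simp add: P_def D_def H_def power_divide power_mult_distrib)
      also have "\<dots> \<le> k * ((Cm * (n + 2))\<^sup>2 * (k * S) / H\<^sup>2)"
        using CS k by (intro mult_left_mono divide_right_mono) auto
      also have "\<dots> = (Cm * (n + 2))\<^sup>2 * S / H\<^sup>2 * k\<^sup>2" by (simp add: power2_eq_square)
      also have "\<dots> \<le> (Cm * (n + 2))\<^sup>2 * S / H\<^sup>2 * (V * H)\<^sup>2"
        using k S0 unfolding H_def by (intro mult_left_mono power_mono) auto
      also have "\<dots> = B * S" using H by (simp add: B_def power_mult_distrib)
      finally show "measure lborel K * P\<^sup>2 \<le> B * S" by (simp add: k_def)
    qed (use n0 e0 in simp)
    also have "\<dots> = (2 * n + 2) * B * (e * S)" by simp
    also have "\<dots> \<le> (2 * n + 2) * B * (LINT x:K|lborel. ed c x)"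
    proof (rule mult_left_mono)
      have "e * S = (LINT x:K|lborel. e * (cmod (c x))\<^sup>2)" by (simp add: S_def)
      also have "\<dots> \<le> (LINT x:K|lborel. ed c x)"
      proof (rule set_integral_mono[OF _ ic])
        show "set_integrable lborel K (\<lambda>x. e * (cmod (c x))\<^sup>2)" using iS by (intro set_integrable_mult_right)
        show "e * (cmod (c x))\<^sup>2 \<le> ed c x" for x
        proof -
          have "0 \<le> (\<Sum>j\<in>UNIV. (cmod (gr c x $ j))\<^sup>2) / \<kappa>\<^sup>2" by (intro divide_nonneg_nonneg sum_nonneg) auto
          then show ?thesis by (simp add: ed_def e_def distrib_right add_divide_distrib)
        qed
      qed
      finally show "e * S \<le> (LINT x:K|lborel. ed c x)" .
    qed (use n0 in \<open>simp add: B_def\<close>)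
    finally show ?thesis by (simp add: distrib_right)
  qed
  show ?thesis using wW inner outer bound[unfolded R_def B_def V_def n_def] by blast
qed

text \<open>\<open>w\<close> vanishes on \<open>T\<close>, so the corrector equation makes the
  integral of \<open>ad c w\<close> zero. Subtracting it from the integral of \<open>ad w w\<close>
  gives a density that vanishes wherever \<open>w\<close> is zero or equals \<open>c\<close>;
  coercivity on \<open>W\<close> then bounds the outer energy.\<close>

lemma transition_energy:
  assumes c: "c \<in> Wspace \<Omega> \<T>" and w: "w \<in> Wspace \<Omega> \<T>" and v: "H1 \<Omega> v"
    and IJ: "I \<subseteq> J" "J \<subseteq> \<T>" and T: "T \<in> I"
    and inner: "\<And>K. K \<in> I \<Longrightarrow> AE x in lborel. x \<in> K \<longrightarrow> w x = 0 \<and> gr w x = 0"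
    and outer: "\<And>K. K \<in> \<T> - J \<Longrightarrow> AE x in lborel. x \<in> K \<longrightarrow> w x = c x \<and> gr w x = gr c x"
    and trans: "\<And>K. K \<in> J - I \<Longrightarrow> (LINT x:K|lborel. ed w x) \<le> Cw * (LINT x:K|lborel. ed c x)"
    and corr: "a_form \<Omega> \<kappa> A \<beta> \<Omega> c w = a_form \<Omega> \<kappa> A \<beta> T v w"
  shows "(\<Sum>K\<in>\<T> - J. LINT x:K|lborel. ed c x) \<le> (Cc * Ca * (3/2 * Cw + 1/2)) * (\<Sum>K\<in>J - I. LINT x:K|lborel. ed c x)"
proof -
  have cH: "H1 \<Omega> c" and wH: "H1 \<Omega> w" using c w by (auto simp: Wspace_def)
  have fin: "finite \<T>" by (rule mesh_finite[OF mesh])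
  have TT: "T \<in> \<T>" using T IJ by blast
  have \<Omega>b: "\<Omega> \<in> sets borel" using \<Omega>(1) by (simp add: borel_closed compact_imp_closed)
  have sub: "set_integrable lborel K f" if "set_integrable lborel \<Omega> f" "K \<in> \<T>" for K and f :: "real^'n \<Rightarrow> real"
    using set_integrable_subset[OF that(1)] mesh_element(4,6)[OF mesh that(2)] by simp
  have ad0: "ad u w x = 0" if "w x = 0 \<and> gr w x = 0" for u x
    using that by (simp add: ad_def mag_grad_def)
  have "(LINT x:\<Omega>|lborel. ad c w x) = (LINT x:T|lborel. ad v w x)"
    using corr a_form_eq[OF cH wH order_refl \<Omega>b] a_form_eq[OF v wH mesh_element(6,4)[OF mesh TT]] by simp
  also have "\<dots> = 0"
    by (rule set_integral_zero_AE) (use inner[OF T] ad0 in \<open>auto elim: eventually_mono\<close>)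
  finally have cw0: "(LINT x:\<Omega>|lborel. ad c w x) = 0" .
  define d where "d x = ad w w x - ad c w x" for x
  have di: "set_integrable lborel \<Omega> d" unfolding d_def[abs_def] by (intro set_integral_diff ad_integrable wH cH)
  have dz: "(LINT x:K|lborel. d x) = 0" if K: "K \<in> \<T> - (J - I)" for K
  proof (rule set_integral_zero_AE)
    show "AE x in lborel. x \<in> K \<longrightarrow> d x = 0"
    proof (cases "K \<in> I")
      case True
      show ?thesis using inner[OF True] by eventually_elim (auto simp: d_def ad0)
    next
      case False
      then have "K \<in> \<T> - J" using K by blast
      from outer[OF this] show ?thesis by eventually_elim (auto simp: d_def ad_def mag_grad_def)
    qed
  qed
  \<comment> \<open>Young's inequality for the mixed term adds half of \<open>ad w w\<close> to the
    full one and leaves half of \<open>ad c c\<close>.\<close>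
  have dR: "(LINT x:K|lborel. d x) \<le> Ca * (3/2 * Cw + 1/2) * (LINT x:K|lborel. ed c x)" if K: "K \<in> J - I" for K
  proof -
    have KT: "K \<in> \<T>" using K IJ by blast
    have iw: "set_integrable lborel K (ed w)" and ic: "set_integrable lborel K (ed c)"
      using sub[OF ed_integrable[OF wH] KT] sub[OF ed_integrable[OF cH] KT] .
    have i: "set_integrable lborel K (\<lambda>x. (3/2 * Ca) * ed w x + (1/2 * Ca) * ed c x)"
      using iw ic by (intro set_integral_add set_integrable_mult_right)
    have "(LINT x:K|lborel. d x) \<le> (LINT x:K|lborel. (3/2 * Ca) * ed w x + (1/2 * Ca) * ed c x)"
    proof (rule set_integral_mono_AE[OF sub[OF di KT] i])
      show "AE x\<in>K in lborel. d x \<le> (3/2 * Ca) * ed w x + (1/2 * Ca) * ed c x"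
        using ad_le_ed[of w] ad_le_ed[of c]
      proof eventually_elim
        case (elim x)
        show ?case
        proof
          assume "x \<in> K"
          then have "x \<in> \<Omega>" using mesh_element(6)[OF mesh KT] by blast
          then have "ad w w x \<le> Ca * ed w x" "ad c c x \<le> Ca * ed c x" using elim by auto
          then show "d x \<le> (3/2 * Ca) * ed w x + (1/2 * Ca) * ed c x"
            using ad_le_self[of c w x] by (simp add: d_def abs_le_iff)
        qed
      qed
    qed
    also have "\<dots> = (3/2 * Ca) * (LINT x:K|lborel. ed w x) + (1/2 * Ca) * (LINT x:K|lborel. ed c x)"
      using set_integral_add(2)[OF set_integrable_mult_right[of "3/2 * Ca", OF iw] set_integrable_mult_right[of "1/2 * Ca", OF ic]] by simp
    also have "\<dots> \<le> (3/2 * Ca) * (Cw * (LINT x:K|lborel. ed c x)) + (1/2 * Ca) * (LINT x:K|lborel. ed c x)"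
      using trans[OF K] Ca_ge by (intro add_mono mult_left_mono) auto
    finally show ?thesis by (simp add: algebra_simps)
  qed
  have eqs: "(LINT x:K|lborel. ed c x) \<le> (LINT x:K|lborel. ed w x)" if K: "K \<in> \<T> - J" for K
  proof (rule set_integral_mono_AE)
    show "AE x\<in>K in lborel. ed c x \<le> ed w x"
      using outer[OF K] by eventually_elim (auto simp: ed_def)
  qed (use K sub[OF ed_integrable[OF wH]] sub[OF ed_integrable[OF cH]] in auto)
  have ed0: "0 \<le> (LINT x:K|lborel. ed w x)" for K
    unfolding set_lebesgue_integral_def by (intro integral_nonneg_AE AE_I2 scaleR_nonneg_nonneg ed_nonneg) auto
  have "(\<Sum>K\<in>\<T> - J. LINT x:K|lborel. ed c x) \<le> (\<Sum>K\<in>\<T> - J. LINT x:K|lborel. ed w x)"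
    by (intro sum_mono eqs)
  also have "\<dots> \<le> (\<Sum>K\<in>\<T>. LINT x:K|lborel. ed w x)"
    using fin ed0 by (intro sum_mono2) auto
  also have "\<dots> = (LINT x:\<Omega>|lborel. ed w x)"
    using set_integral_mesh_sum[OF mesh order_refl ed_integrable[OF wH]] by (simp add: mesh_Union[OF mesh])
  also have "\<dots> \<le> Cc * (LINT x:\<Omega>|lborel. ad w w x)" by (rule coercive[OF w])
  also have "(LINT x:\<Omega>|lborel. ad w w x) = (LINT x:\<Omega>|lborel. d x)"
    using set_integral_diff(2)[OF ad_integrable[OF wH wH] ad_integrable[OF cH wH]] cw0 by (simp add: d_def)
  also have "\<dots> = (\<Sum>K\<in>\<T>. LINT x:K|lborel. d x)"
    using set_integral_mesh_sum[OF mesh order_refl di] by (simp add: mesh_Union[OF mesh])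
  also have "\<dots> = (\<Sum>K\<in>J - I. LINT x:K|lborel. d x)"
    using fin IJ dz by (intro sum.mono_neutral_right) auto
  also have "Cc * (\<Sum>K\<in>J - I. LINT x:K|lborel. d x) \<le> Cc * (\<Sum>K\<in>J - I. Ca * (3/2 * Cw + 1/2) * (LINT x:K|lborel. ed c x))"
    using Cc_ge by (intro mult_left_mono sum_mono dR) auto
  finally show ?thesis by (simp add: sum_distrib_left mult.assoc)
qed

text \<open>The corrector is tested with itself. Young's inequality on \<open>T\<close> produces
  half of its energy there, which is absorbed into the left-hand side.\<close>

lemma energy_le_source:
  assumes c: "c \<in> Wspace \<Omega> \<T>" and v: "H1 \<Omega> v" and T: "T \<in> \<T>"
    and corr: "a_form \<Omega> \<kappa> A \<beta> \<Omega> c c = a_form \<Omega> \<kappa> A \<beta> T v c"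
  shows "(LINT x:\<Omega>|lborel. ed c x) \<le> Cc * a_form \<Omega> \<kappa> A \<beta> T v v"
proof -
  have cH: "H1 \<Omega> c" using c by (simp add: Wspace_def)
  have \<Omega>b: "\<Omega> \<in> sets borel" using \<Omega>(1) by (simp add: borel_closed compact_imp_closed)
  note Te = mesh_element(6,4)[OF mesh T]
  have sub: "set_integrable lborel T (ad u u')" if "H1 \<Omega> u" "H1 \<Omega> u'" for u u'
    using set_integrable_subset[OF ad_integrable[OF that]] Te by simp
  have i: "set_integrable lborel T (\<lambda>x. 1/2 * ad v v x + 1/2 * ad c c x)"
    using sub v cH by (intro set_integral_add set_integrable_mult_right)
  have "(LINT x:\<Omega>|lborel. ad c c x) = (LINT x:T|lborel. ad v c x)"
    using corr a_form_eq[OF cH cH order_refl \<Omega>b] a_form_eq[OF v cH Te] by simp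
  also have "\<dots> \<le> (LINT x:T|lborel. 1/2 * ad v v x + 1/2 * ad c c x)"
    using ad_le_self[of v c] by (intro set_integral_mono[OF sub[OF v cH] i]) (simp add: abs_le_iff)
  also have "\<dots> = 1/2 * (LINT x:T|lborel. ad v v x) + 1/2 * (LINT x:T|lborel. ad c c x)"
    using set_integral_add(2)[OF set_integrable_mult_right[of "1/2", OF sub[OF v v]] set_integrable_mult_right[of "1/2", OF sub[OF cH cH]]] by simp
  finally have "(LINT x:\<Omega>|lborel. ad c c x) \<le> 1/2 * (LINT x:T|lborel. ad v v x) + 1/2 * (LINT x:T|lborel. ad c c x)" .
  moreover have "(LINT x:T|lborel. ad c c x) \<le> (LINT x:\<Omega>|lborel. ad c c x)"
    unfolding set_lebesgue_integral_def
    using sub[OF cH cH] ad_integrable[OF cH cH] Te ad_self_nonneg unfolding set_integrable_def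
    by (intro integral_mono) (auto simp: indicator_def)
  ultimately have "(LINT x:\<Omega>|lborel. ad c c x) \<le> (LINT x:T|lborel. ad v v x)" by linarith
  then have "Cc * (LINT x:\<Omega>|lborel. ad c c x) \<le> Cc * a_form \<Omega> \<kappa> A \<beta> T v v"
    using Cc_ge a_form_eq[OF v v Te] by (intro mult_left_mono) auto
  then show ?thesis using coercive[OF c] by linarith
qed

text \<open>Up to a null set, a point outside the open patch lies in an element outside the layers,
  so the truncated norm is controlled by the elementwise energies.\<close>

lemma enorm_patch_le:
  assumes c: "H1 \<Omega> c" and T: "T \<in> \<T>" and l: "l \<ge> 1"
  shows "(enorm \<Omega> \<kappa> A \<beta> (\<Omega> - patch_pow \<T> l T) c)\<^sup>2 \<le> Ca * (\<Sum>K\<in>\<T> - layers \<T> T l. LINT x:K|lborel. ed c x)"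
proof -
  define Pl where "Pl = patch_pow \<T> l T"
  have Pl: "Pl = interior (\<Union>(layers \<T> T l))" unfolding Pl_def by (rule patch_pow_layers(2)[OF mesh T l])
  have \<Omega>b: "\<Omega> \<in> sets borel" using \<Omega>(1) by (simp add: borel_closed compact_imp_closed)
  have Db: "\<Omega> - Pl \<in> sets borel" using \<Omega>b by (simp add: Pl)
  define X where "X = \<Union>(\<T> - layers \<T> T l)"
  have Xb: "X \<in> sets lborel"
    unfolding X_def using mesh_finite[OF mesh] mesh_element(4)[OF mesh] by (intro sets.finite_Union) auto
  have X\<Omega>: "X \<subseteq> \<Omega>" unfolding X_def using mesh_element(6)[OF mesh] by blast
  have "(enorm \<Omega> \<kappa> A \<beta> (\<Omega> - Pl) c)\<^sup>2 = (LINT x:\<Omega> - Pl|lborel. ad c c x)"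
  proof -
    have "0 \<le> (LINT x:\<Omega> - Pl|lborel. ad c c x)"
      unfolding set_lebesgue_integral_def by (intro integral_nonneg_AE AE_I2 scaleR_nonneg_nonneg ad_self_nonneg) auto
    then show ?thesis by (simp add: enorm_def a_form_eq[OF c c Diff_subset Db])
  qed
  also have "\<dots> \<le> (LINT x:X|lborel. Ca * ed c x)"
    unfolding set_lebesgue_integral_def
  proof (rule integral_mono_AE)
    show "integrable lborel (\<lambda>x. indicator (\<Omega> - Pl) x *\<^sub>R ad c c x)"
      using set_integrable_subset[OF ad_integrable[OF c c], of "\<Omega> - Pl"] Db by (simp add: set_integrable_def)
    show "integrable lborel (\<lambda>x. indicator X x *\<^sub>R (Ca * ed c x))"
      using set_integrable_mult_right[of Ca, OF set_integrable_subset[OF ed_integrable[OF c] Xb X\<Omega>]]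
      unfolding set_integrable_def .
    show "AE x in lborel. indicator (\<Omega> - Pl) x *\<^sub>R ad c c x \<le> indicator X x *\<^sub>R (Ca * ed c x)"
      using AE_mesh_interior[OF mesh] ad_le_ed[of c]
    proof eventually_elim
      case (elim x)
      show ?case
      proof (cases "x \<in> \<Omega> - Pl")
        case True
        then obtain K where K: "K \<in> \<T>" "x \<in> K" using mesh_Union[OF mesh] by blast
        have "K \<notin> layers \<T> T l"
        proof
          assume "K \<in> layers \<T> T l"
          then have "interior K \<subseteq> Pl" unfolding Pl by (intro interior_mono) auto
          then show False using True K elim by blast
        qed
        then have "x \<in> X" using K by (auto simp: X_def)
        then show ?thesis using True elim by simp
      next
        case False
        have "0 \<le> Ca * ed c x" using Ca_ge ed_nonneg[of c x] by (intro mult_nonneg_nonneg) auto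
        then show ?thesis using False by (auto simp: indicator_def)
      qed
    qed
  qed
  also have "\<dots> = Ca * (LINT x:X|lborel. ed c x)" by simp
  also have "(LINT x:X|lborel. ed c x) = (\<Sum>K\<in>\<T> - layers \<T> T l. LINT x:K|lborel. ed c x)"
    unfolding X_def by (rule set_integral_mesh_sum[OF mesh Diff_subset ed_integrable[OF c]])
  finally show ?thesis by (simp add: Pl_def)
qed

end

section \<open>Decay\<close>

text \<open>A negative bound would make the interior of \<open>\<Omega>\<close> a null set. Hence
  the set of essential bounds is bounded below and its infimum is meaningful.\<close>

lemma essential_bound_nonneg:
  fixes \<Omega> :: "(real^'n) set" and A :: "real^'n \<Rightarrow> real^'n"
  assumes "AE x in lborel. x \<in> \<Omega> \<longrightarrow> norm (A x) \<le> M" "interior \<Omega> \<noteq> {}"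
  shows "M \<ge> 0"
proof (rule ccontr)
  assume M: "\<not> M \<ge> 0"
  have "AE x in lborel. x \<notin> interior \<Omega>"
    using assms(1)
  proof eventually_elim
    case (elim x)
    show ?case
    proof
      assume "x \<in> interior \<Omega>"
      then have "x \<in> \<Omega>" by (rule subsetD[OF interior_subset])
      then have "norm (A x) \<le> M" using elim by simp
      then show False using M norm_ge_zero[of "A x"] by linarith
    qed
  qed
  then have "interior \<Omega> \<in> null_sets lborel"
    using AE_iff_null_sets[of "interior \<Omega>" lborel] by simp
  then have "negligible (interior \<Omega>)"
    by (simp add: negligible_iff_null_sets null_sets_completionI)
  then show False using assms(2) open_not_negligible[OF open_interior] by blast
qed

text \<open>The infimum of the essential bounds is attained: the bounds
  \<open>Inf S + 1 / real (Suc k)\<close> hold jointly almost everywhere, as there are countably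
  many.\<close>

lemma AE_le_Linf_norm:
  fixes \<Omega> :: "(real^'n) set"
  assumes A: "AE x in lborel. x \<in> \<Omega> \<longrightarrow> norm (A x) \<le> M" and \<Omega>: "interior \<Omega> \<noteq> {}"
  shows "AE x in lborel. x \<in> \<Omega> \<longrightarrow> norm (A x) \<le> Linf_norm \<Omega> A"
proof -
  define S where "S = {M. AE x in lborel. x \<in> \<Omega> \<longrightarrow> norm (A x) \<le> M}"
  have S: "S \<noteq> {}" "bdd_below S"
    using A essential_bound_nonneg[OF _ \<Omega>] by (auto simp: S_def bdd_below_def)
  have "AE x in lborel. x \<in> \<Omega> \<longrightarrow> norm (A x) \<le> Inf S + 1 / real (Suc k)" for k
  proof -
    have "Inf S < Inf S + 1 / real (Suc k)" by simp
    then obtain m where "m \<in> S" "m < Inf S + 1 / real (Suc k)"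
      using cInf_less_iff[OF S] by blast
    then show ?thesis unfolding S_def by (auto elim!: eventually_mono)
  qed
  then have "AE x in lborel. \<forall>k. x \<in> \<Omega> \<longrightarrow> norm (A x) \<le> Inf S + 1 / real (Suc k)"
    by (subst AE_all_countable) blast
  then show ?thesis
  proof eventually_elim
    case (elim x)
    show ?case
    proof
      assume x: "x \<in> \<Omega>"
      have "norm (A x) \<le> Inf S"
      proof (rule field_le_epsilon)
        fix e :: real assume "e > 0"
        then obtain k where "1 / real (Suc k) < e" using nat_approx_posE by blast
        then show "norm (A x) \<le> Inf S + e" using elim[rule_format, OF x, of k] by linarith
      qed
      then show "norm (A x) \<le> Linf_norm \<Omega> A" by (simp add: Linf_norm_def S_def)
    qed
  qed
qed

text \<open>Only complete blocks of \<open>N\<close> layers contract; the incomplete last block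
  costs the factor \<open>1 / q\<close>. Monotonicity passes from multiples of \<open>N\<close> to
  arbitrary \<open>l\<close>.\<close>

lemma geometric_decay_of_step:
  fixes E :: "nat \<Rightarrow> real"
  assumes N: "N \<ge> 1" and q: "0 < q" "q < 1" and anti: "\<And>k l. k \<le> l \<Longrightarrow> E l \<le> E k" and E0: "E 0 \<ge> 0"
    and step: "\<And>l. E (l + N) \<le> q * E l"
  shows "E l \<le> (1 / q) * (q powr (1 / real N)) powr (real l / 6) * E 0"
proof -
  have "E (k * N) \<le> q ^ k * E 0" for k
  proof (induction k)
    case (Suc k)
    have "E (Suc k * N) \<le> q * E (k * N)" using step[of "k * N"] by (simp add: add.commute)
    also have "\<dots> \<le> q * (q ^ k * E 0)" using Suc q by (intro mult_left_mono) auto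
    finally show ?case by simp
  qed simp
  then have "E l \<le> q ^ (l div N) * E 0"
    using anti[of "l div N * N" l] order_trans by (simp add: div_times_less_eq_dividend) blast
  also have "\<dots> \<le> (1 / q) * (q powr (1 / real N)) powr (real l / 6) * E 0"
  proof (rule mult_right_mono[OF _ E0])
    have "real l = real (l div N) * real N + real (l mod N)"
      by (metis div_mult_mod_eq of_nat_add of_nat_mult)
    moreover have "real (l mod N) \<le> real N" using N by (simp add: less_imp_le)
    ultimately have "real l \<le> (real (l div N) + 1) * real N" by (simp add: distrib_right)
    then have a: "real l / real N - 1 \<le> real (l div N)" using N by (simp add: field_simps)
    \<comment> \<open>A deliberate loss: with the square root taken later, the exponent
      \<open>1/6\<close> becomes the \<open>1/12\<close> of the statement.\<close>
    have "real l / (6 * real N) \<le> real l / real N" using N by (simp add: field_simps)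
    then have b: "real l / (6 * real N) - 1 \<le> real (l div N)" using a by linarith
    have "q ^ (l div N) = q powr real (l div N)" using q by (simp add: powr_realpow)
    also have "\<dots> \<le> q powr (real l / (6 * real N) - 1)" using b q by (intro powr_mono') auto
    also have "\<dots> = (1 / q) * q powr (real l / (6 * real N))" using q by (simp add: powr_diff)
    also have "\<dots> = (1 / q) * (q powr (1 / real N)) powr (real l / 6)" by (simp add: powr_powr mult.commute)
    finally show "q ^ (l div N) \<le> (1 / q) * (q powr (1 / real N)) powr (real l / 6)" .
  qed
  finally show ?thesis .
qed

context lod_setting
begin

text \<open>The cutoff falls off over distance \<open>h\<close> around the layers up to
  \<open>l\<close>. \<open>N\<close> is large enough for \<open>layers_reach\<close> to place every
  element within that distance in the layers up to \<open>l + N\<close>, so the cutoff equals one on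
  all others.\<close>

lemma layer_energy_step:
  assumes Ce: "\<And>(G::(real^'n) set) \<delta>. bounded G \<Longrightarrow> \<delta> > 0 \<Longrightarrow>
     \<exists>\<psi>. smooth_fun \<psi> \<and> (\<forall>x. 0 \<le> \<psi> x \<and> \<psi> x \<le> 1) \<and> (\<forall>x\<in>G. \<psi> x = 1) \<and>
       (\<forall>x. \<psi> x \<noteq> 0 \<longrightarrow> (\<exists>y\<in>G. dist x y \<le> \<delta>)) \<and> (\<forall>j x. \<bar>pderiv_r \<psi> j x\<bar> \<le> Ce / \<delta>)"
    and Cm: "moment_corrector Cm \<Omega> \<T>"
    and reg: "shape_regular \<sigma> \<T>" "quasi_uniform \<rho> \<T>" "\<sigma> > 0" "\<rho> > 0"
    and N: "N \<ge> 1" "(6 * \<sigma> / \<rho>) ^ CARD('n) \<le> real N"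
    and T: "T \<in> \<T>" and v: "H1 \<Omega> v" and c: "c \<in> Wspace \<Omega> \<T>"
    and corr: "\<And>w. w \<in> Wspace \<Omega> \<T> \<Longrightarrow> a_form \<Omega> \<kappa> A \<beta> \<Omega> c w = a_form \<Omega> \<kappa> A \<beta> T v w"
  shows "(\<Sum>K\<in>\<T> - layers \<T> T (l + N). LINT x:K|lborel. ed c x) \<le>
    (Cc * Ca * (3/2 * (6 + 4 * real CARD('n) * Ce\<^sup>2 + (2 * real CARD('n) + 2) *
          (Cm * (real CARD('n) + 2) * (2 ^ CARD('n) * measure lborel (ball (0::real^'n) 1)))\<^sup>2) + 1/2)) *
    (\<Sum>K\<in>layers \<T> T (l + N) - layers \<T> T l. LINT x:K|lborel. ed c x)"
proof -
  define I where "I = layers \<T> T l"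
  define J where "J = layers \<T> T (l + N)"
  have IJ: "I \<subseteq> J" "J \<subseteq> \<T>" "T \<in> I"
    using layers_mono[OF mesh T, of l "l + N"] layers_subset[OF T] layers_mono[OF mesh T, of 0 l]
    by (auto simp: I_def J_def)
  \<comment> \<open>A neighbour of an inner element lies in layer \<open>l + 1\<close>, and
    \<open>N \<ge> 1\<close> puts that layer into \<open>J\<close>.\<close>
  have sep: "K \<inter> K' = {}" if "K \<in> I" "K' \<in> \<T> - J" for K K'
  proof (rule ccontr)
    assume "K \<inter> K' \<noteq> {}"
    then have "K' \<in> layers \<T> T (Suc l)" using that by (auto simp: I_def)
    then have "K' \<in> J" using layers_mono[OF mesh T, of "Suc l" "l + N"] N by (auto simp: J_def)
    then show False using that by blast
  qed
  have "compact (\<Union>I)"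
    using mesh_finite[OF mesh] mesh_element(1)[OF mesh] IJ by (intro compact_Union) (auto intro: finite_subset)
  then obtain \<psi> where \<psi>: "smooth_fun \<psi>" "\<And>x. 0 \<le> \<psi> x" "\<And>x. \<psi> x \<le> 1" "\<And>x. x \<in> \<Union>I \<Longrightarrow> \<psi> x = 1"
    "\<And>x. \<psi> x \<noteq> 0 \<Longrightarrow> \<exists>y\<in>\<Union>I. dist x y \<le> h" "\<And>j x. \<bar>pderiv_r \<psi> j x\<bar> \<le> Ce / h"
    using Ce[OF compact_imp_bounded h_pos] by meson
  define \<eta> where "\<eta> x = 1 - \<psi> x" for x
  have d\<eta>: "pderiv_r \<eta> j x = - pderiv_r \<psi> j x" for j x
    unfolding \<eta>_def[abs_def] by (rule pderiv_r_const_diff[OF \<psi>(1)])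
  have \<eta>1: "\<eta> x = 1" if K: "K \<in> \<T> - J" "x \<in> K" for K x
  proof (rule ccontr)
    assume "\<eta> x \<noteq> 1"
    then obtain y where "y \<in> \<Union>I" "dist x y \<le> h" using \<psi>(5)[of x] by (auto simp: \<eta>_def)
    then have "K \<in> layers \<T> T (l + N)"
      using layers_reach[OF mesh \<Omega>(2) reg N(2) T, of y l x K] K by (simp add: I_def dist_commute)
    then show False using K by (simp add: J_def)
  qed
  have "\<exists>w\<in>Wspace \<Omega> \<T>. (\<forall>K\<in>I. AE x in lborel. x \<in> K \<longrightarrow> w x = 0 \<and> gr w x = 0) \<and>
     (\<forall>K\<in>\<T> - J. AE x in lborel. x \<in> K \<longrightarrow> w x = c x \<and> gr w x = gr c x) \<and>
     (\<forall>K\<in>J - I. (LINT x:K|lborel. ed w x) \<le>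
        (6 + 4 * real CARD('n) * Ce\<^sup>2 + (2 * real CARD('n) + 2) *
          (Cm * (real CARD('n) + 2) * (2 ^ CARD('n) * measure lborel (ball (0::real^'n) 1)))\<^sup>2) * (LINT x:K|lborel. ed c x))"
  proof (rule test_function[OF c IJ(1,2) sep, of \<eta>])
    show "smooth_fun \<eta>" unfolding \<eta>_def[abs_def] by (intro smooth_diff smooth_const \<psi>)
    show "0 \<le> \<eta> x" "\<eta> x \<le> 1" for x using \<psi>(2,3)[of x] by (simp_all add: \<eta>_def)
    show "\<eta> x = 0" if "K \<in> I" "x \<in> K" for K x using \<psi>(4)[of x] that by (auto simp: \<eta>_def)
    show "\<eta> x = 1" if "K \<in> \<T> - J" "x \<in> K" for K x using \<eta>1[OF that] .
    show "\<bar>pderiv_r \<eta> j x\<bar> \<le> Ce / h" for j x using \<psi>(6)[of j x] by (simp add: d\<eta>)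
    show "moment_corrector Cm \<Omega> \<T>" by (rule Cm)
  qed
  then obtain w where w: "w \<in> Wspace \<Omega> \<T>" "\<And>K. K \<in> I \<Longrightarrow> AE x in lborel. x \<in> K \<longrightarrow> w x = 0 \<and> gr w x = 0"
    "\<And>K. K \<in> \<T> - J \<Longrightarrow> AE x in lborel. x \<in> K \<longrightarrow> w x = c x \<and> gr w x = gr c x"
    "\<And>K. K \<in> J - I \<Longrightarrow> (LINT x:K|lborel. ed w x) \<le>
        (6 + 4 * real CARD('n) * Ce\<^sup>2 + (2 * real CARD('n) + 2) *
          (Cm * (real CARD('n) + 2) * (2 ^ CARD('n) * measure lborel (ball (0::real^'n) 1)))\<^sup>2) * (LINT x:K|lborel. ed c x)"
    by blast
  show ?thesis
    using transition_energy[OF c w(1) v IJ w(2,3,4) corr[OF w(1)]] by (simp only: I_def J_def)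
qed

end

theorem theorem5p1:
  fixes \<Omega> :: "(real^'n) set" and A :: "(real^'n) \<Rightarrow> real^'n"
    and \<sigma> \<rho> C\<^sub>\<pi> C\<^sub>r\<^sub>e\<^sub>s :: real
  assumes dim: "CARD('n) = 2 \<or> CARD('n) = 3"
    and dom: "polytope \<Omega>" "interior \<Omega> \<noteq> {}"
    and pot: "admissible_potential \<Omega> A"
    and mesh_consts: "\<sigma> > 0" "\<rho> > 0"
    and Cres_pos: "C\<^sub>r\<^sub>e\<^sub>s > 0"
    and Cres: "1 / C\<^sub>r\<^sub>e\<^sub>s\<^sup>2 \<ge> 4 * C\<^sub>\<pi>\<^sup>2 * (Linf_norm \<Omega> A)\<^sup>2 + 2 * C\<^sub>\<pi>\<^sup>2"
  shows "\<exists>C1 C2. C1 > 0 \<and> C2 > 0 \<and>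
    (\<forall>(\<kappa>::real) (h::real) (\<T>::(real^'n) set set) (\<beta>::real) T v c.
      \<kappa> > 0 \<longrightarrow>
      conforming_mesh \<Omega> \<T> \<longrightarrow> shape_regular \<sigma> \<T> \<longrightarrow> quasi_uniform \<rho> \<T> \<longrightarrow>
      h = mesh_size \<T> \<longrightarrow>
      (\<forall>w p. H1 \<Omega> w \<longrightarrow> is_L2_proj \<Omega> \<T> w p \<longrightarrow>
         L2norm \<Omega> (\<lambda>x. w x - p x) \<le> C\<^sub>\<pi> * h * L2normv \<Omega> (wgrad \<Omega> w)) \<longrightarrow>
      h \<le> C\<^sub>r\<^sub>e\<^sub>s / \<kappa> \<longrightarrow>
      \<beta> \<ge> 0 \<longrightarrow>
      T \<in> \<T> \<longrightarrow>
      v \<in> Vh \<Omega> \<T> \<longrightarrow>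
      c \<in> Wspace \<Omega> \<T> \<longrightarrow>
      (\<forall>w\<in>Wspace \<Omega> \<T>. a_form \<Omega> \<kappa> A \<beta> \<Omega> c w = a_form \<Omega> \<kappa> A \<beta> T v w) \<longrightarrow>
      (\<exists>\<theta>. 0 < \<theta> \<and> \<theta> < 1 \<and>
         \<theta> \<le> (1 - 1 / (1 + C2 * (1 + \<kappa> * \<beta> * h))) powr (1/12) \<and>
         (\<forall>l::nat. l \<ge> 1 \<longrightarrow>
            enorm \<Omega> \<kappa> A \<beta> (\<Omega> - patch_pow \<T> l T) c \<le> C1 * \<theta> ^ l * enorm \<Omega> \<kappa> A \<beta> T v)))"
proof -
  define La where "La = Linf_norm \<Omega> A"
  have \<Omega>: "compact \<Omega>" "convex \<Omega>" using dom by (auto simp: polytope_imp_compact polytope_imp_convex)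
  have A_meas: "set_borel_measurable lborel \<Omega> A" using pot by (simp add: admissible_potential_def)
  have A_bound: "AE x in lborel. x \<in> \<Omega> \<longrightarrow> norm (A x) \<le> La"
    using pot AE_le_Linf_norm[OF _ dom(2)] unfolding admissible_potential_def La_def by blast
  have Cr_bound: "4 * C\<^sub>\<pi>\<^sup>2 * La\<^sup>2 * C\<^sub>r\<^sub>e\<^sub>s\<^sup>2 \<le> 1"
  proof -
    have "4 * C\<^sub>\<pi>\<^sup>2 * La\<^sup>2 \<le> 1 / C\<^sub>r\<^sub>e\<^sub>s\<^sup>2" using Cres zero_le_power2[of C\<^sub>\<pi>] unfolding La_def by linarith
    then show ?thesis using Cres_pos by (simp add: le_divide_eq)
  qed
  obtain Ce where Ce: "Ce > 0" "\<And>(G::(real^'n) set) \<delta>. bounded G \<Longrightarrow> \<delta> > 0 \<Longrightarrow>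
     \<exists>\<psi>. smooth_fun \<psi> \<and> (\<forall>x. 0 \<le> \<psi> x \<and> \<psi> x \<le> 1) \<and> (\<forall>x\<in>G. \<psi> x = 1) \<and>
       (\<forall>x. \<psi> x \<noteq> 0 \<longrightarrow> (\<exists>y\<in>G. dist x y \<le> \<delta>)) \<and> (\<forall>j x. \<bar>pderiv_r \<psi> j x\<bar> \<le> Ce / \<delta>)"
    using smooth_cutoff[where 'n = 'n] by metis
  obtain Cm where Cm: "\<And>(\<Theta>::(real^'n) set) \<T>. compact \<Theta> \<Longrightarrow> conforming_mesh \<Theta> \<T> \<Longrightarrow>
      shape_regular \<sigma> \<T> \<Longrightarrow> quasi_uniform \<rho> \<T> \<Longrightarrow> moment_corrector Cm \<Theta> \<T>"
    using moment_correction[OF mesh_consts, where 'n = 'n] by blast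
  obtain N :: nat where N: "N \<ge> 1" "(6 * \<sigma> / \<rho>) ^ CARD('n) \<le> real N"
  proof -
    obtain k :: nat where "(6 * \<sigma> / \<rho>) ^ CARD('n) \<le> real k" using real_arch_simple by blast
    then show thesis using that[of "Suc k"] by simp
  qed
  define Ka where "Ka = 2 + 2 * La\<^sup>2 * C\<^sub>r\<^sub>e\<^sub>s\<^sup>2"
  define Kc where "Kc = 4 * (1 + C\<^sub>\<pi>\<^sup>2)"
  define Cw where "Cw = 6 + 4 * real CARD('n) * Ce\<^sup>2 + (2 * real CARD('n) + 2) *
          (Cm * (real CARD('n) + 2) * (2 ^ CARD('n) * measure lborel (ball (0::real^'n) 1)))\<^sup>2"
  define C' where "C' = Kc * Ka * (3/2 * Cw + 1/2)"
  have Ka: "Ka > 0" by (simp add: Ka_def add_pos_nonneg)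
  have Kc: "Kc > 0" by (simp add: Kc_def add_pos_nonneg)
  have "Cw \<ge> 0" unfolding Cw_def by (intro add_nonneg_nonneg mult_nonneg_nonneg) auto
  then have C': "C' > 0" unfolding C'_def using Ka Kc by (intro mult_pos_pos) auto
  \<comment> \<open>Solves \<open>E (l + N) \<le> C' * (E l - E (l + N))\<close> for
    \<open>E (l + N)\<close>: the transition energy is a difference of consecutive outer
    energies.\<close>
  define q where "q = C' / (1 + C')"
  have q: "0 < q" "q < 1" using C' by (auto simp: q_def)
  define t where "t = q powr (1 / real N)"
  have t: "0 < t" "t < 1" using q N powr_less_mono2[of "1 / real N" q 1] by (auto simp: t_def)
  \<comment> \<open>The solution of \<open>1 - 1 / (1 + C2) = t\<close>. A nonnegative
    \<open>\<kappa> * \<beta> * h\<close> only raises the bound above \<open>t\<close>.\<close>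
  define C2 where "C2 = t / (1 - t)"
  have C2: "C2 > 0" using t by (simp add: C2_def)
  have tC2: "1 - 1 / (1 + C2) = t" using t by (simp add: C2_def field_simps)
  \<comment> \<open>\<open>Ka\<close> converts the energy to the norm, \<open>Kc\<close> bounds the
    initial energy by the source, and \<open>1 / q\<close> is the loss from the incomplete block;
    the root accounts for squared norms.\<close>
  define C1 where "C1 = sqrt (Ka * Kc / q)"
  have C1: "C1 > 0" using Ka Kc q by (simp add: C1_def)
  \<comment> \<open>With this exponent \<open>(\<theta> ^ l)^2\<close> is the energy rate
    \<open>t powr (real l / 6)\<close>.\<close>
  define \<theta> where "\<theta> = t powr (1/12)"
  have \<theta>: "0 < \<theta>" "\<theta> < 1" using t powr_less_mono2[of "1/12" t 1] by (auto simp: \<theta>_def)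
  show ?thesis
  proof (rule exI[of _ C1], rule exI[of _ C2], intro conjI C1 C2 allI impI)
    fix \<kappa> h' \<beta> :: real and \<T> :: "(real^'n) set set" and T v c
    assume \<kappa>: "\<kappa> > 0" and M: "conforming_mesh \<Omega> \<T>" and sr: "shape_regular \<sigma> \<T>" and qu: "quasi_uniform \<rho> \<T>"
      and h: "h' = mesh_size \<T>"
      and proj: "\<forall>w p. H1 \<Omega> w \<longrightarrow> is_L2_proj \<Omega> \<T> w p \<longrightarrow>
         L2norm \<Omega> (\<lambda>x. w x - p x) \<le> C\<^sub>\<pi> * h' * L2normv \<Omega> (wgrad \<Omega> w)"
      and res: "h' \<le> C\<^sub>r\<^sub>e\<^sub>s / \<kappa>" and \<beta>: "\<beta> \<ge> 0" and T: "T \<in> \<T>" and v: "v \<in> Vh \<Omega> \<T>" and c: "c \<in> Wspace \<Omega> \<T>"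
      and corr: "\<forall>w\<in>Wspace \<Omega> \<T>. a_form \<Omega> \<kappa> A \<beta> \<Omega> c w = a_form \<Omega> \<kappa> A \<beta> T v w"
    \<comment> \<open>On \<open>W\<close> the projection is zero, so the approximation estimate
      becomes a Poincare-type inequality.\<close>
    have poin: "L2norm \<Omega> w \<le> C\<^sub>\<pi> * mesh_size \<T> * L2normv \<Omega> (wgrad \<Omega> w)" if "w \<in> Wspace \<Omega> \<T>" for w
      using proj[rule_format, of w "\<lambda>_. 0"] that by (simp add: Wspace_def h)
    interpret lod_setting \<Omega> A \<kappa> \<beta> \<T> La C\<^sub>\<pi> C\<^sub>r\<^sub>e\<^sub>s
      by (unfold_locales) (use \<Omega> dom A_meas A_bound \<kappa> \<beta> M poin Cres_pos res h Cr_bound in auto)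
    have KaCa: "Ca = Ka" "Cc = Kc" by (simp_all add: Ca_def Cc_def Ka_def Kc_def)
    have vH: "H1 \<Omega> v" by (rule Vh_H1[OF M \<Omega>(1,2) v])
    have cH: "H1 \<Omega> c" using c by (simp add: Wspace_def)
    define E where "E l = (\<Sum>K\<in>\<T> - layers \<T> T l. LINT x:K|lborel. ed c x)" for l
    have pos: "0 \<le> (LINT x:K|lborel. ed c x)" for K
      unfolding set_lebesgue_integral_def by (intro integral_nonneg_AE AE_I2 scaleR_nonneg_nonneg ed_nonneg) auto
    have fin: "finite \<T>" by (rule mesh_finite[OF M])
    have anti: "E l \<le> E k" if "k \<le> l" for k l
      unfolding E_def using layers_mono[OF M T that] fin pos by (intro sum_mono2) auto
    have E0: "E 0 \<ge> 0" unfolding E_def by (intro sum_nonneg pos)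
    have step: "E (l + N) \<le> q * E l" for l
    proof -
      have "E (l + N) \<le> C' * (\<Sum>K\<in>layers \<T> T (l + N) - layers \<T> T l. LINT x:K|lborel. ed c x)"
        using layer_energy_step[OF Ce(2) Cm[OF \<Omega>(1) M sr qu] sr qu mesh_consts N T vH c corr[rule_format], of l]
        unfolding E_def C'_def Cw_def KaCa by simp
      also have "(\<Sum>K\<in>layers \<T> T (l + N) - layers \<T> T l. LINT x:K|lborel. ed c x) = E l - E (l + N)"
      proof -
        have "\<T> - layers \<T> T l = (layers \<T> T (l + N) - layers \<T> T l) \<union> (\<T> - layers \<T> T (l + N))"
          using layers_mono[OF M T, of l "l + N"] layers_subset[OF T, of "l + N"] by auto
        then have "E l = (\<Sum>K\<in>(layers \<T> T (l + N) - layers \<T> T l) \<union> (\<T> - layers \<T> T (l + N)). LINT x:K|lborel. ed c x)"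
          by (simp only: E_def)
        also have "\<dots> = (\<Sum>K\<in>layers \<T> T (l + N) - layers \<T> T l. LINT x:K|lborel. ed c x) + E (l + N)"
          unfolding E_def
          by (rule sum.union_disjoint) (use fin finite_subset[OF layers_subset[OF T] fin] in auto)
        finally show ?thesis by simp
      qed
      finally show ?thesis using C' by (simp add: q_def field_simps)
    qed
    define Y where "Y = a_form \<Omega> \<kappa> A \<beta> T v v"
    have Y: "Y \<ge> 0"
      unfolding Y_def a_form_eq[OF vH vH mesh_element(6,4)[OF M T]] set_lebesgue_integral_def
      by (intro integral_nonneg_AE AE_I2 scaleR_nonneg_nonneg ad_self_nonneg) auto
    have "E 0 \<le> (\<Sum>K\<in>\<T>. LINT x:K|lborel. ed c x)"
      unfolding E_def using fin pos by (intro sum_mono2) auto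
    also have "\<dots> = (LINT x:\<Omega>|lborel. ed c x)"
      using set_integral_mesh_sum[OF M order_refl ed_integrable[OF cH]] by (simp add: mesh_Union[OF M])
    also have "\<dots> \<le> Kc * Y"
      using energy_le_source[OF c vH T corr[rule_format, OF c]] by (simp add: KaCa Y_def)
    finally have EY: "E 0 \<le> Kc * Y" .
    show "\<exists>\<theta>. 0 < \<theta> \<and> \<theta> < 1 \<and>
         \<theta> \<le> (1 - 1 / (1 + C2 * (1 + \<kappa> * \<beta> * h'))) powr (1/12) \<and>
         (\<forall>l::nat. l \<ge> 1 \<longrightarrow>
            enorm \<Omega> \<kappa> A \<beta> (\<Omega> - patch_pow \<T> l T) c \<le> C1 * \<theta> ^ l * enorm \<Omega> \<kappa> A \<beta> T v)"
    proof (intro exI[of _ \<theta>] conjI \<theta> allI impI)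
      have "1 * C2 \<le> (1 + \<kappa> * \<beta> * h') * C2"
        using \<kappa> \<beta> h_pos C2 h by (intro mult_right_mono) auto
      then have "1 + C2 \<le> 1 + C2 * (1 + \<kappa> * \<beta> * h')" by (simp add: mult.commute)
      then have "1 / (1 + C2 * (1 + \<kappa> * \<beta> * h')) \<le> 1 / (1 + C2)" using C2 by (intro frac_le) auto
      then have "t \<le> 1 - 1 / (1 + C2 * (1 + \<kappa> * \<beta> * h'))" using tC2 by linarith
      then show "\<theta> \<le> (1 - 1 / (1 + C2 * (1 + \<kappa> * \<beta> * h'))) powr (1/12)"
        unfolding \<theta>_def using t by (intro powr_mono2) auto
      fix l :: nat assume l: "l \<ge> 1"
      have tl: "t powr (real l / 6) = (\<theta> ^ l)\<^sup>2"
      proof -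
        have "(\<theta> ^ l)\<^sup>2 = \<theta> powr (real (l * 2))" by (simp only: powr_realpow[OF \<theta>(1)] power_mult)
        then show ?thesis by (simp add: \<theta>_def powr_powr)
      qed
      have "(enorm \<Omega> \<kappa> A \<beta> (\<Omega> - patch_pow \<T> l T) c)\<^sup>2 \<le> Ka * E l"
        using enorm_patch_le[OF cH T l] by (simp add: KaCa E_def)
      also have "\<dots> \<le> Ka * ((1 / q) * t powr (real l / 6) * E 0)"
        using geometric_decay_of_step[of N q E, OF N(1) q anti E0 step] Ka
        unfolding t_def by (intro mult_left_mono) auto
      also have "\<dots> \<le> Ka * ((1 / q) * t powr (real l / 6) * (Kc * Y))"
        using Ka q EY by (intro mult_left_mono) auto
      also have "\<dots> = (C1 * \<theta> ^ l * enorm \<Omega> \<kappa> A \<beta> T v)\<^sup>2"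
        using Y Ka Kc q by (simp add: tl C1_def power_mult_distrib enorm_def Y_def[symmetric])
      finally show "enorm \<Omega> \<kappa> A \<beta> (\<Omega> - patch_pow \<T> l T) c \<le> C1 * \<theta> ^ l * enorm \<Omega> \<kappa> A \<beta> T v"
        by (rule power2_le_imp_le) (use C1 \<theta> Y in \<open>simp add: enorm_def Y_def[symmetric]\<close>)
    qed
  qed
qed

end
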